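(* Up to isomorphism, there are exactly $64$ tournaments $T$ on $8$ vertices such that $\chi_d(T)=3$ and $T$ does not contain, as a subtournament, any tournament on $7$ vertices with dichromatic number $3$.
   Context: A tournament is an orientation of a complete graph. A $k$-coloring of a digraph $D$ is a mapping from the vertices of $D$ to $\{1,\dots,k\}$ such that each color class induces an acyclic digraph (no directed cycle). The dichromatic number $\chi_d(D)$ is the minimum integer $k$ such that $D$ admits a $k$-coloring. *)

theory Defs
  imports "Graph_Theory.Digraph_Isomorphism"
begin

text \<open>
  The locale \<^locale>\<open>digraph\<close> gives a finite digraph without loops and parallel arcs; the exclusive or
  says that every edge of the complete graph on the vertex set receives exactly one direction.
\<close>

locale tournament = digraph +
  assumes oriented_complete:
    "\<lbrakk>u \<in> verts G; v \<in> verts G; u \<noteq> v\<rbrakk>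
      \<Longrightarrow> (u \<rightarrow>\<^bsub>G\<^esub> v \<and> \<not> v \<rightarrow>\<^bsub>G\<^esub> u) \<or> (v \<rightarrow>\<^bsub>G\<^esub> u \<and> \<not> u \<rightarrow>\<^bsub>G\<^esub> v)"

text \<open>
  The cycles of the library are nonempty directed closed walks without repeated vertices.
\<close>

definition acyclic_digraph :: "('a, 'b) pre_digraph \<Rightarrow> bool" where
  "acyclic_digraph G \<longleftrightarrow> \<not> (\<exists>p. pre_digraph.cycle G p)"

definition acyclic_coloring :: "('a, 'b) pre_digraph \<Rightarrow> nat \<Rightarrow> ('a \<Rightarrow> nat) \<Rightarrow> bool" where
  "acyclic_coloring G k c \<longleftrightarrow>
     c ` verts G \<subseteq> {1..k} \<and>
     (\<forall>i \<in> {1..k}. acyclic_digraph (G \<restriction> {v \<in> verts G. c v = i}))"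

text \<open>
  Every finite loopfree digraph has a coloring by an injective map, so that the least element exists.
\<close>

definition dichromatic_number :: "('a, 'b) pre_digraph \<Rightarrow> nat" where
  "dichromatic_number G = (LEAST k. \<exists>c. acyclic_coloring G k c)"

definition minimal_3_dichromatic_8 :: "('a, 'b) pre_digraph \<Rightarrow> bool" where
  "minimal_3_dichromatic_8 T \<longleftrightarrow>
     tournament T \<and> card (verts T) = 8 \<and> dichromatic_number T = 3 \<and>
     \<not> (\<exists>H. subgraph H T \<and> tournament H \<and> card (verts H) = 7 \<and> dichromatic_number H = 3)"

end

theory Submission
  imports Defs
begin

text \<open>
  A digraph of the kind in question is first replaced by a relation on eight labelled vertices. In a
  tournament a vertex set is acyclic if and only if it contains no cyclic triangle, so a coloring
  with two colors is a splitting of the vertices into two triangle-free sets, that is, into two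
  transitive tournaments. A tournament with eight vertices is minimal with dichromatic number 3 if and
  only if it is critical: it cannot be split, but each of its subtournaments with seven vertices can
  (\<open>minimal_iff_critical\<close>). A third color for the deleted vertex shows that such a tournament has
  dichromatic number 3, and monotonicity of the dichromatic number handles the other direction.

  It remains to classify the critical relations. A splitting of seven vertices has a part with at
  least four vertices, so a critical tournament contains a transitive tournament on four vertices,
  whose complement is not transitive and therefore contains a cyclic triangle
  (\<open>critical_occurs_S0\<close>). From this pattern \<open>S0\<close> a case distinction on the directions of the
  remaining arcs is made by decision trees. A branch stops as soon as the known arcs exhibit a
  splitting (patterns \<open>Halves\<close> and \<open>FiveThree\<close>), or one of four unsplittable tournaments on seven
  vertices (patterns \<open>Seven1\<close> to \<open>Seven4\<close>), or one of 64 explicit tournaments. The tree for \<open>S0\<close>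
  alone would be far too large; it becomes small because a branch may also stop when the known
  arcs contain a pattern that has been dealt with by a tree of its own. The patterns \<open>S1\<close> to \<open>S17\<close>
  serve this purpose: choosing a favourable copy of such a pattern in the tournament breaks the symmetry
  between its many copies. The trees were found by a computer search; \<open>decides_sound\<close> shows that a tree
  which passes the check \<open>decides\<close> proves its claim, and the simplifier runs the check.

  The 64 tournaments are critical, which a backtracking search for splittings verifies
  (\<open>rep_critical\<close>). They are pairwise non-isomorphic, because the sum of the cubes of the numbers of
  walks of length 4 from each vertex is invariant under isomorphism and takes 64 different values on
  them (\<open>rep_iso_unique\<close>).
\<close>

section \<open>Two-colorings of tournaments and triangle-free sets\<close>

definition triangle_free :: "('a \<Rightarrow> 'a \<Rightarrow> bool) \<Rightarrow> 'a set \<Rightarrow> bool" where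
  "triangle_free R A \<longleftrightarrow> (\<forall>x\<in>A. \<forall>y\<in>A. \<forall>z\<in>A. \<not> (R x y \<and> R y z \<and> R z x))"

text \<open>
  The two parts may overlap and may leave \<open>W\<close>: shrinking a triangle-free set keeps it
  triangle-free, and without a disjointness condition the property passes to preimages directly.
\<close>

definition splittable :: "('a \<Rightarrow> 'a \<Rightarrow> bool) \<Rightarrow> 'a set \<Rightarrow> bool" where
  "splittable R W \<longleftrightarrow> (\<exists>A B. W \<subseteq> A \<union> B \<and> triangle_free R A \<and> triangle_free R B)"

lemma triangle_free_mono:
  "triangle_free R A \<Longrightarrow> B \<subseteq> A \<Longrightarrow> (\<And>x y. S x y \<Longrightarrow> R x y) \<Longrightarrow> triangle_free S B"
  unfolding triangle_free_def by (meson subsetD)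

lemma splittable_image:
  assumes "splittable R W" and "\<And>x. x \<in> V \<Longrightarrow> f x \<in> W"
    and "\<And>x y. x \<in> V \<Longrightarrow> y \<in> V \<Longrightarrow> S x y \<Longrightarrow> R (f x) (f y)"
  shows "splittable S V"
proof -
  obtain A B where AB: "W \<subseteq> A \<union> B" "triangle_free R A" "triangle_free R B"
    using assms(1) unfolding splittable_def by blast
  let ?P = "\<lambda>A. {x \<in> V. f x \<in> A}"
  have "triangle_free S (?P X)" if "triangle_free R X" for X
    unfolding triangle_free_def
  proof (intro ballI notI)
    fix x y z assume *: "x \<in> ?P X" "y \<in> ?P X" "z \<in> ?P X" and "S x y \<and> S y z \<and> S z x"
    then have "R (f x) (f y)" "R (f y) (f z)" "R (f z) (f x)" using assms(3) by auto
    then show False using * that unfolding triangle_free_def by blast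
  qed
  moreover have "V \<subseteq> ?P A \<union> ?P B" using AB(1) assms(2) by auto
  ultimately show ?thesis unfolding splittable_def using AB by blast
qed

context tournament
begin

lemma dominates_asym: "u \<rightarrow> v \<Longrightarrow> \<not> v \<rightarrow> u"
  using oriented_complete[of u v] adj_not_same adj_in_verts by blast

lemma dominates_total: "u \<in> verts G \<Longrightarrow> v \<in> verts G \<Longrightarrow> u \<noteq> v \<Longrightarrow> u \<rightarrow> v \<or> v \<rightarrow> u"
  using oriented_complete by blast

lemma triangle_imp_cycle:
  assumes "x \<in> X" "y \<in> X" "z \<in> X" "x \<rightarrow> y" "y \<rightarrow> z" "z \<rightarrow> x"
  shows "\<exists>p. pre_digraph.cycle (G \<restriction> X) p"
proof -
  have ne: "x \<noteq> y" "y \<noteq> z" "z \<noteq> x" using assms adj_not_same by blast+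
  obtain a b c where e: "a \<in> arcs G" "tail G a = x" "head G a = y"
    "b \<in> arcs G" "tail G b = y" "head G b = z" "c \<in> arcs G" "tail G c = z" "head G c = x"
    using assms(4-6) by (meson reachableE)
  have "pre_digraph.cycle (G \<restriction> X) [a, b, c]"
    unfolding pre_digraph.cycle_def
    by (rule exI[of _ x]) (use e assms ne in
      \<open>auto simp: pre_digraph.awalk_def pre_digraph.cas.simps pre_digraph.awalk_verts.simps\<close>)
  then show ?thesis by blast
qed

text \<open>
  Without a cyclic triangle the relation is transitive on \<open>X\<close>, so the number of
  in-neighbours within \<open>X\<close> is a rank that grows along every arc, and no walk can close up.
\<close>

lemma triangle_free_walk_rank:
  assumes "triangle_free (dominates G) X" "X \<subseteq> verts G"
    and "pre_digraph.cas (G \<restriction> X) u p v" "set p \<subseteq> arcs (G \<restriction> X)" "p \<noteq> []"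
  shows "card {w \<in> X. w \<rightarrow> u} < card {w \<in> X. w \<rightarrow> v}"
  using assms(3-5)
proof (induction p arbitrary: u)
  case Nil
  then show ?case by simp
next
  case (Cons e p)
  define w where "w = head G e"
  have e: "e \<in> arcs G" "tail G e = u" "u \<in> X" "w \<in> X" and cas: "pre_digraph.cas (G \<restriction> X) w p v"
    using Cons.prems by (auto simp: pre_digraph.cas.simps w_def)
  then have uw: "u \<rightarrow> w" unfolding w_def by (metis in_arcs_imp_in_arcs_ends)
  have "{x \<in> X. x \<rightarrow> u} \<subset> {x \<in> X. x \<rightarrow> w}"
  proof
    show "{x \<in> X. x \<rightarrow> u} \<subseteq> {x \<in> X. x \<rightarrow> w}"
    proof clarify
      fix x assume x: "x \<in> X" "x \<rightarrow> u"
      then have "x \<noteq> w" using uw dominates_asym by blast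
      moreover have "\<not> w \<rightarrow> x"
        using assms(1) x e uw unfolding triangle_free_def by blast
      ultimately show "x \<rightarrow> w" using dominates_total[of x w] assms(2) x e by blast
    qed
    show "{x \<in> X. x \<rightarrow> u} \<noteq> {x \<in> X. x \<rightarrow> w}"
      using uw e dominates_asym by blast
  qed
  moreover have "finite {x \<in> X. x \<rightarrow> w}"
    using assms(2) finite_subset[OF _ finite_verts] by auto
  ultimately have less: "card {x \<in> X. x \<rightarrow> u} < card {x \<in> X. x \<rightarrow> w}"
    by (rule psubset_card_mono[rotated])
  show ?case
  proof (cases "p = []")
    case True
    then show ?thesis using cas less by (simp add: pre_digraph.cas.simps)
  next
    case False
    then show ?thesis using Cons.IH[OF cas] Cons.prems less by auto
  qed
qed

lemma acyclic_iff_triangle_free: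
  assumes "X \<subseteq> verts G"
  shows "acyclic_digraph (G \<restriction> X) \<longleftrightarrow> triangle_free (dominates G) X"
proof
  assume "acyclic_digraph (G \<restriction> X)"
  then show "triangle_free (dominates G) X"
    unfolding acyclic_digraph_def triangle_free_def using triangle_imp_cycle by blast
next
  assume tf: "triangle_free (dominates G) X"
  show "acyclic_digraph (G \<restriction> X)"
    unfolding acyclic_digraph_def
  proof
    assume "\<exists>p. pre_digraph.cycle (G \<restriction> X) p"
    then obtain p u where "pre_digraph.awalk (G \<restriction> X) u p u" "p \<noteq> []"
      unfolding pre_digraph.cycle_def by blast
    then show False
      using triangle_free_walk_rank[OF tf assms, of u p u] unfolding pre_digraph.awalk_def by simp
  qed
qed

lemma acyclic_coloring_iff:
  "acyclic_coloring G k c \<longleftrightarrow>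
    c ` verts G \<subseteq> {1..k} \<and> (\<forall>i. triangle_free (dominates G) {v \<in> verts G. c v = i})"
proof -
  have "triangle_free (dominates G) {v \<in> verts G. c v = i}"
    if "c ` verts G \<subseteq> {1..k}" "i \<notin> {1..k}" for i
  proof -
    have "{v \<in> verts G. c v = i} = {}" using that by auto
    then show ?thesis unfolding triangle_free_def by blast
  qed
  then show ?thesis
    unfolding acyclic_coloring_def using acyclic_iff_triangle_free[of "{v \<in> verts G. c v = _}"]
    by (auto simp del: induce_subgraph_verts)
qed

lemma acyclic_coloring_mono: "acyclic_coloring G k c \<Longrightarrow> k \<le> l \<Longrightarrow> acyclic_coloring G l c"
  unfolding acyclic_coloring_iff by fastforce

text \<open>
  The least element in the definition of the dichromatic number exists because an injective
  coloring has singleton classes, and these contain no cyclic triangle.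
\<close>

lemma dichromatic_number_le_iff:
  "dichromatic_number G \<le> k \<longleftrightarrow> (\<exists>c. acyclic_coloring G k c)"
proof
  obtain f :: "'a \<Rightarrow> nat" and n where f: "f ` verts G = {i. i < n}" "inj_on f (verts G)"
    using finite_imp_inj_to_nat_seg[OF finite_verts] by metis
  have lt: "f v < n" if "v \<in> verts G" for v using f(1) that by blast
  have "triangle_free (dominates G) {v \<in> verts G. Suc (f v) = i}" for i
    unfolding triangle_free_def using f(2) adj_not_same by (auto simp: inj_on_def)
  then have "acyclic_coloring G n (\<lambda>v. Suc (f v))"
    unfolding acyclic_coloring_iff using lt by (auto simp: Suc_le_eq)
  then have "\<exists>k c. acyclic_coloring G k c" by blast
  then have "\<exists>c. acyclic_coloring G (dichromatic_number G) c"
    unfolding dichromatic_number_def by (rule LeastI_ex)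
  moreover assume "dichromatic_number G \<le> k"
  ultimately show "\<exists>c. acyclic_coloring G k c" using acyclic_coloring_mono by blast
next
  assume "\<exists>c. acyclic_coloring G k c"
  then show "dichromatic_number G \<le> k"
    unfolding dichromatic_number_def by (rule Least_le)
qed

lemma dichromatic_number_le_2_iff:
  "dichromatic_number G \<le> 2 \<longleftrightarrow> splittable (dominates G) (verts G)"
  unfolding dichromatic_number_le_iff
proof
  assume "\<exists>c. acyclic_coloring G 2 c"
  then obtain c :: "'a \<Rightarrow> nat" where c: "c ` verts G \<subseteq> {1..2}"
    "\<And>i. triangle_free (dominates G) {v \<in> verts G. c v = i}"
    unfolding acyclic_coloring_iff by blast
  have "verts G \<subseteq> {v \<in> verts G. c v = 1} \<union> {v \<in> verts G. c v = 2}" using c(1) by force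
  then show "splittable (dominates G) (verts G)" unfolding splittable_def using c(2) by blast
next
  assume "splittable (dominates G) (verts G)"
  then obtain A B where AB: "verts G \<subseteq> A \<union> B"
    "triangle_free (dominates G) A" "triangle_free (dominates G) B"
    unfolding splittable_def by blast
  have "acyclic_coloring G 2 (\<lambda>v. if v \<in> A then 1 else 2)"
    unfolding acyclic_coloring_iff
  proof (intro conjI allI)
    fix i :: nat
    show "triangle_free (dominates G) {v \<in> verts G. (if v \<in> A then 1 else 2) = i}"
    proof (cases "i = 1")
      case True
      then have "{v \<in> verts G. (if v \<in> A then 1 else 2) = i} \<subseteq> A" by auto
      then show ?thesis by (rule triangle_free_mono[OF AB(2)])
    next
      case False
      have "{v \<in> verts G. (if v \<in> A then 1 else 2) = i} \<subseteq> B"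
        using AB(1) False by auto
      then show ?thesis by (rule triangle_free_mono[OF AB(3)])
    qed
  qed auto
  then show "\<exists>c. acyclic_coloring G 2 c" by blast
qed

lemma dichromatic_number_subgraph:
  assumes "subgraph H G" "tournament H"
  shows "dichromatic_number H \<le> dichromatic_number G"
proof -
  interpret H: tournament H by fact
  obtain c where c: "c ` verts G \<subseteq> {1..dichromatic_number G}"
    "\<And>i. triangle_free (dominates G) {v \<in> verts G. c v = i}"
    using dichromatic_number_le_iff[of "dichromatic_number G"]
    unfolding acyclic_coloring_iff by blast
  have sub: "verts H \<subseteq> verts G" using assms(1) by (rule subgraphE)
  have "triangle_free (dominates H) {v \<in> verts H. c v = i}" for i
    using c(2)[of i] by (rule triangle_free_mono) (use sub adj_mono[OF _ assms(1)] in auto)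
  moreover have "c ` verts H \<subseteq> {1..dichromatic_number G}" using c(1) sub by blast
  ultimately have "acyclic_coloring H (dichromatic_number G) c"
    unfolding H.acyclic_coloring_iff by blast
  then show ?thesis using H.dichromatic_number_le_iff by blast
qed

lemma tournament_induce_subgraph:
  assumes "X \<subseteq> verts G"
  shows "tournament (G \<restriction> X)" and "subgraph (G \<restriction> X) G"
    and "dominates (G \<restriction> X) u v \<longleftrightarrow> u \<in> X \<and> v \<in> X \<and> u \<rightarrow> v"
proof -
  show "subgraph (G \<restriction> X) G" using assms by (rule subgraph_induce_subgraphI)
  interpret H: digraph "G \<restriction> X"
    by (rule digraphI_induced) (rule induced_induce[OF assms])
  show dom: "dominates (G \<restriction> X) u v \<longleftrightarrow> u \<in> X \<and> v \<in> X \<and> u \<rightarrow> v" for u v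
    by (auto simp: arcs_ends_conv)
  show "tournament (G \<restriction> X)"
    by unfold_locales (use oriented_complete assms in \<open>auto simp: dom\<close>)
qed

end

section \<open>Tournaments on eight labelled vertices\<close>

datatype vtx = V0 | V1 | V2 | V3 | V4 | V5 | V6 | V7

text \<open>
  Functions on the vertices and adjacency matrices are eight-tuples and eight-tuples of eight-tuples.
  Looking up or changing an entry is then one rewrite step, so that the simplifier can carry out
  all computations below.
\<close>

datatype 'a oct = Oct 'a 'a 'a 'a 'a 'a 'a 'a

fun get :: "vtx \<Rightarrow> 'a oct \<Rightarrow> 'a" where
  "get V0 (Oct a b c d e f g h) = a"
| "get V1 (Oct a b c d e f g h) = b"
| "get V2 (Oct a b c d e f g h) = c"
| "get V3 (Oct a b c d e f g h) = d"
| "get V4 (Oct a b c d e f g h) = e"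
| "get V5 (Oct a b c d e f g h) = f"
| "get V6 (Oct a b c d e f g h) = g"
| "get V7 (Oct a b c d e f g h) = h"

fun put :: "vtx \<Rightarrow> 'a \<Rightarrow> 'a oct \<Rightarrow> 'a oct" where
  "put V0 x (Oct a b c d e f g h) = Oct x b c d e f g h"
| "put V1 x (Oct a b c d e f g h) = Oct a x c d e f g h"
| "put V2 x (Oct a b c d e f g h) = Oct a b x d e f g h"
| "put V3 x (Oct a b c d e f g h) = Oct a b c x e f g h"
| "put V4 x (Oct a b c d e f g h) = Oct a b c d x f g h"
| "put V5 x (Oct a b c d e f g h) = Oct a b c d e x g h"
| "put V6 x (Oct a b c d e f g h) = Oct a b c d e f x h"
| "put V7 x (Oct a b c d e f g h) = Oct a b c d e f g x"

primrec row :: "vtx list \<Rightarrow> bool oct" where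
  "row [] = Oct False False False False False False False False"
| "row (v # vs) = put v True (row vs)"

fun matrix :: "vtx list oct \<Rightarrow> bool oct oct" where
  "matrix (Oct a b c d e f g h) =
     Oct (row a) (row b) (row c) (row d) (row e) (row f) (row g) (row h)"

lemma UNIV_vtx: "UNIV = {V0, V1, V2, V3, V4, V5, V6, V7}"
  using vtx.exhaust by blast

instance vtx :: finite
  by standard (simp add: UNIV_vtx)

lemma card_vtx: "card (UNIV :: vtx set) = 8"
  by (simp add: UNIV_vtx)

lemma all_vtx: "(\<forall>v. P v) \<longleftrightarrow> P V0 \<and> P V1 \<and> P V2 \<and> P V3 \<and> P V4 \<and> P V5 \<and> P V6 \<and> P V7"
  by (metis vtx.exhaust)

lemma get_put: "get u (put v x f) = (if u = v then x else get u f)"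
  by (cases f; cases u; cases v) simp_all

lemma range_get: "range (\<lambda>v. get v (Oct a b c d e f g h)) = {a, b, c, d, e, f, g, h}"
  by (simp add: UNIV_vtx)

lemma inj_get: "distinct [a, b, c, d, e, f, g, h] \<Longrightarrow> inj (\<lambda>v. get v (Oct a b c d e f g h))"
  by (rule eq_card_imp_inj_on) (simp_all add: range_get card_vtx)

definition adj :: "bool oct oct \<Rightarrow> vtx \<Rightarrow> vtx \<Rightarrow> bool" where
  "adj M u v = get v (get u M)"

lemma get_row: "get v (row vs) \<longleftrightarrow> v \<in> set vs"
proof (induction vs)
  case Nil
  then show ?case by (cases v) simp_all
qed (simp add: get_put)

lemma adj_matrix: "adj (matrix P) u v \<longleftrightarrow> v \<in> set (get u P)"
  by (cases P; cases u) (simp_all add: adj_def get_row)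

definition oriented :: "(vtx \<Rightarrow> vtx \<Rightarrow> bool) \<Rightarrow> bool" where
  "oriented t \<longleftrightarrow> (\<forall>u v. t u v = (u \<noteq> v \<and> \<not> t v u))"

text \<open>
  The property to which minimality of a tournament with eight vertices comes down: no partition
  into two transitive parts exists, but one appears after the deletion of any vertex.
\<close>

definition critical :: "(vtx \<Rightarrow> vtx \<Rightarrow> bool) \<Rightarrow> bool" where
  "critical t \<longleftrightarrow> oriented t \<and> \<not> splittable t UNIV \<and> (\<forall>v. splittable t (- {v}))"

text \<open>
  A pattern lists for each of its vertices some out-neighbours; pairs of vertices that carry no arc
  of the pattern are left open. It occurs in a tournament on the same number of vertices, so that an
  occurrence of a pattern with all 28 arcs is an isomorphism.
\<close>

definition occurs :: "vtx list oct \<Rightarrow> (vtx \<Rightarrow> vtx \<Rightarrow> bool) \<Rightarrow> bool" where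
  "occurs P t \<longleftrightarrow> (\<exists>f. inj f \<and> (\<forall>u v. adj (matrix P) u v \<longrightarrow> t (f u) (f v)))"

section \<open>Representatives and patterns\<close>

text \<open>
  The representatives \<open>rep i j\<close> are indexed by pairs of vertices, since there are 64 = 8 * 8 of them.
  The patterns \<open>Halves\<close> and \<open>FiveThree\<close> consist of two transitive parts. Since \<open>Seven1\<close> to \<open>Seven4\<close>
  leave \<open>V7\<close> without arcs, their occurrences are subtournaments on seven vertices. In \<open>S0\<close> to \<open>S17\<close> the vertices \<open>V0\<close> to \<open>V3\<close> are in transitive
  order. The other four vertices contain the triangle \<open>V4\<close>, \<open>V5\<close>, \<open>V6\<close> in \<open>S0\<close>, which \<open>V7\<close>
  dominates in \<open>S1\<close> and which dominates \<open>V7\<close> in \<open>S4\<close>; in \<open>S7\<close> they form the strongly connected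
  tournament. Each remaining pattern adds a few arcs to one of \<open>S1\<close>, \<open>S4\<close> and \<open>S7\<close>.
\<close>

datatype shape = Rep vtx vtx
  | Halves | FiveThree | Seven1 | Seven2 | Seven3 | Seven4
  | S0 | S1 | S2 | S3 | S4 | S5 | S6 | S7 | S8 | S9 | S10 | S11 | S12 | S13 | S14 | S15 | S16 | S17

definition reps :: "vtx list oct oct oct" where
  "reps = Oct
    (Oct
      (Oct [V1,V2,V3,V4,V5] [V2,V3,V4,V5,V7] [V3,V4] [V4,V6,V7] [V5,V6] [V2,V3,V6] [V0,V1,V2,V7] [V0,V2,V4,V5])
      (Oct [V1,V2,V3,V4] [V2,V3,V4,V5,V6] [V3,V4,V5,V7] [V4,V6] [V5,V6] [V0,V3,V6] [V0,V2,V7] [V0,V1,V3,V4,V5])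
      (Oct [V1,V2,V3,V4,V5] [V2,V3,V4,V7] [V3,V5] [V4,V6] [V2,V5,V6] [V1,V3,V6,V7] [V0,V1,V2,V7] [V0,V2,V3,V4])
      (Oct [V1,V2,V3,V4,V6] [V2,V3,V4,V5,V7] [V3,V5,V6] [V4,V5] [V2,V5,V6] [V0,V6,V7] [V1,V3,V7] [V0,V2,V3,V4])
      (Oct [V1,V2,V3,V4] [V2,V3,V4,V7] [V3,V5] [V4,V6] [V2,V5,V6] [V0,V1,V3,V6,V7] [V0,V1,V2,V7] [V0,V2,V3,V4])
      (Oct [V1,V2,V3,V4] [V2,V3,V4,V7] [V3,V6] [V4,V5] [V2,V5,V6] [V0,V1,V2,V6,V7] [V0,V1,V3,V7] [V0,V2,V3,V4])
      (Oct [V1,V2,V3,V4,V6] [V2,V3,V4,V5,V7] [V3,V5,V6] [V4,V5,V6] [V2,V5,V6] [V0,V6,V7] [V1,V7] [V0,V2,V3,V4])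
      (Oct [V1,V2,V3,V4,V6] [V2,V3,V7] [V3,V6,V7] [V4,V5] [V1,V2,V5,V6] [V0,V1,V2,V6,V7] [V1,V3,V7] [V0,V3,V4]))
    (Oct
      (Oct [V1,V2,V3,V5] [V2,V3,V4,V5,V6] [V3,V4,V6,V7] [V4,V5] [V0,V5,V6] [V2,V6,V7] [V0,V3,V7] [V0,V1,V3,V4])
      (Oct [V1,V2,V3,V5] [V2,V3,V4,V5,V6] [V3,V4,V7] [V4,V5] [V0,V5,V6] [V2,V6,V7] [V0,V2,V3,V7] [V0,V1,V3,V4])
      (Oct [V1,V2,V3,V4,V5] [V2,V3,V4,V6] [V3,V4,V7] [V4,V5] [V5,V6,V7] [V1,V2,V6] [V0,V2,V3,V7] [V0,V1,V3,V5])
      (Oct [V1,V2,V3,V4] [V2,V3,V4,V5,V6] [V3,V4,V6,V7] [V4,V5,V7] [V5,V6] [V0,V2,V6] [V0,V3,V7] [V0,V1,V4,V5])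
      (Oct [V1,V2,V3,V4,V5] [V2,V3,V4,V6] [V3,V4,V7] [V4,V5,V6,V7] [V5,V6] [V1,V2,V6] [V0,V2,V7] [V0,V1,V4,V5])
      (Oct [V1,V2,V3,V4] [V2,V3,V4,V5,V6] [V3,V4,V5,V7] [V4,V6,V7] [V5,V6] [V0,V3,V6] [V0,V2,V7] [V0,V1,V4,V5])
      (Oct [V1,V2,V3,V4,V5] [V2,V3,V4,V7] [V3,V4,V6,V7] [V4,V5] [V5,V6,V7] [V1,V2,V6] [V0,V1,V3,V7] [V0,V3,V5])
      (Oct [V1,V2,V3,V4,V5] [V2,V3,V4,V7] [V3,V4,V6] [V4,V5] [V5,V6,V7] [V1,V2,V6] [V0,V1,V3,V7] [V0,V2,V3,V5]))
    (Oct
      (Oct [V1,V2,V3,V4] [V2,V3,V4,V5,V6] [V3,V4,V7] [V4,V6,V7] [V5,V6] [V0,V2,V3,V6] [V0,V2,V7] [V0,V1,V4,V5])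
      (Oct [V1,V2,V3,V4,V5] [V2,V3,V4] [V3,V4,V6,V7] [V4,V5,V7] [V5,V6] [V1,V2,V6] [V0,V1,V3,V7] [V0,V1,V4,V5])
      (Oct [V1,V2,V3,V4,V5] [V2,V3,V4,V7] [V3,V4,V6] [V4,V5,V6,V7] [V5,V6] [V1,V2,V6] [V0,V1,V7] [V0,V2,V4,V5])
      (Oct [V1,V2,V3,V4] [V2,V3,V4,V6,V7] [V3,V4,V5,V6] [V4,V5,V7] [V5,V6] [V0,V1,V6] [V0,V3,V7] [V0,V2,V4,V5])
      (Oct [V1,V2,V3,V4,V6] [V2,V3,V4,V7] [V3,V4,V6] [V4,V5] [V5,V6,V7] [V0,V1,V2,V6] [V1,V3,V7] [V0,V2,V3,V5])
      (Oct [V1,V2,V3,V4,V5] [V2,V3,V6] [V3,V4,V5,V7] [V4,V6] [V1,V5,V6] [V1,V3,V6,V7] [V0,V2,V7] [V0,V1,V3,V4])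
      (Oct [V1,V2,V3,V4,V5] [V2,V3,V4] [V3,V4,V5,V7] [V4,V6,V7] [V5,V6] [V1,V3,V6] [V0,V1,V2,V7] [V0,V1,V4,V5])
      (Oct [V1,V2,V3,V4,V5] [V2,V3,V4,V6] [V3,V4,V5,V7] [V4,V6,V7] [V5,V6] [V1,V3,V6] [V0,V2,V7] [V0,V1,V4,V5]))
    (Oct
      (Oct [V1,V2,V3,V4,V6] [V2,V3,V5,V7] [V3,V5,V6] [V4,V5,V6] [V1,V2,V5,V6] [V0,V6,V7] [V1,V7] [V0,V2,V3,V4])
      (Oct [V1,V2,V3,V4] [V2,V3,V4,V5,V7] [V3,V4,V5,V6] [V4,V6,V7] [V5,V6] [V0,V3,V6] [V0,V1,V7] [V0,V2,V4,V5])
      (Oct [V1,V2,V3,V4,V6] [V2,V3,V5] [V3,V4,V6,V7] [V4,V5] [V1,V5,V6] [V0,V2,V6,V7] [V1,V3,V7] [V0,V1,V3,V4])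
      (Oct [V1,V2,V3,V5,V7] [V2,V3,V4,V6] [V3,V4,V6,V7] [V4,V5] [V0,V5,V6] [V1,V2,V6,V7] [V0,V3,V7] [V1,V3,V4])
      (Oct [V1,V2,V3,V4] [V2,V3,V4,V5,V7] [V3,V4,V6] [V4,V6,V7] [V5,V6] [V0,V2,V3,V6] [V0,V1,V7] [V0,V2,V4,V5])
      (Oct [V1,V2,V3,V4] [V2,V3,V4,V6,V7] [V3,V4,V5] [V4,V5,V7] [V5,V6] [V0,V1,V6] [V0,V2,V3,V7] [V0,V2,V4,V5])
      (Oct [V1,V2,V3,V4,V6] [V2,V3,V4,V7] [V3,V4,V6,V7] [V4,V5] [V5,V6,V7] [V0,V1,V2,V6] [V1,V3,V7] [V0,V3,V5])
      (Oct [V1,V2,V3,V4] [V2,V3,V4,V5,V7] [V3,V4,V5] [V4,V6,V7] [V5,V6] [V0,V3,V6] [V0,V1,V2,V7] [V0,V2,V4,V5]))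
    (Oct
      (Oct [V1,V2,V3,V4,V5] [V2,V3,V4,V7] [V3,V4,V6] [V4,V5,V7] [V5,V6] [V1,V2,V6] [V0,V1,V3,V7] [V0,V2,V4,V5])
      (Oct [V1,V2,V3,V4,V7] [V2,V3,V4,V6] [V3,V4,V6,V7] [V4,V5] [V5,V6,V7] [V0,V1,V2,V6] [V0,V3,V7] [V1,V3,V5])
      (Oct [V1,V2,V3,V4] [V2,V3,V4,V7] [V3,V4,V6] [V4,V6,V7] [V5,V6] [V0,V1,V2,V3,V6] [V0,V1,V7] [V0,V2,V4,V5])
      (Oct [V1,V2,V3,V4] [V2,V3,V4,V6] [V3,V4,V7] [V4,V6,V7] [V5,V6] [V0,V1,V2,V3,V6] [V0,V2,V7] [V0,V1,V4,V5])
      (Oct [V1,V2,V3,V4,V7] [V2,V3,V4,V6] [V3,V4,V5] [V4,V5,V7] [V5,V6] [V0,V1,V6] [V0,V2,V3,V7] [V1,V2,V4,V5])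
      (Oct [V1,V2,V3,V4,V7] [V2,V3,V4,V5] [V3,V4,V6] [V4,V5,V7] [V5,V6] [V0,V2,V6] [V0,V1,V3,V7] [V1,V2,V4,V5])
      (Oct [V1,V2,V3,V4] [V2,V3,V4,V6] [V3,V4,V7] [V4,V5,V6,V7] [V5,V6] [V0,V1,V2,V6] [V0,V2,V7] [V0,V1,V4,V5])
      (Oct [V1,V2,V3,V4] [V2,V3,V4,V7] [V3,V4,V6] [V4,V5,V6,V7] [V5,V6] [V0,V1,V2,V6] [V0,V1,V7] [V0,V2,V4,V5]))
    (Oct
      (Oct [V1,V2,V3,V5] [V2,V3,V4,V7] [V3,V5,V6] [V4,V6] [V0,V2,V5,V6] [V1,V3,V6,V7] [V0,V1,V7] [V0,V2,V3,V4])
      (Oct [V1,V2,V3,V5] [V2,V3,V4,V6] [V3,V4,V6,V7] [V4,V5] [V0,V5,V6] [V1,V2,V6,V7] [V0,V3,V7] [V0,V1,V3,V4])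
      (Oct [V1,V2,V3,V5] [V2,V3,V5,V7] [V3,V4,V6] [V4,V5] [V0,V1,V5,V6] [V2,V6,V7] [V0,V1,V3,V7] [V0,V2,V3,V4])
      (Oct [V1,V2,V3,V4] [V2,V3,V6] [V3,V5,V7] [V4,V5] [V1,V2,V5,V6] [V0,V1,V6,V7] [V0,V2,V3,V7] [V0,V1,V3,V4])
      (Oct [V1,V2,V3,V5] [V2,V3,V4,V6] [V3,V4,V7] [V4,V5] [V0,V5,V6] [V1,V2,V6,V7] [V0,V2,V3,V7] [V0,V1,V3,V4])
      (Oct [V1,V2,V3,V4] [V2,V3,V4,V6] [V3,V4,V7] [V4,V5] [V5,V6,V7] [V0,V1,V2,V6] [V0,V2,V3,V7] [V0,V1,V3,V5])
      (Oct [V1,V2,V3,V4] [V2,V3,V4,V7] [V3,V4,V6] [V4,V5] [V5,V6,V7] [V0,V1,V2,V6] [V0,V1,V3,V7] [V0,V2,V3,V5])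
      (Oct [V1,V2,V3,V4] [V2,V3,V4,V5] [V3,V4,V5,V7] [V4,V6,V7] [V5,V6] [V0,V3,V6] [V0,V1,V2,V7] [V0,V1,V4,V5]))
    (Oct
      (Oct [V1,V2,V3,V4,V6] [V2,V3,V4] [V3,V4,V5,V7] [V4,V5,V6] [V5,V6,V7] [V0,V1,V6] [V1,V2,V7] [V0,V1,V3,V5])
      (Oct [V1,V2,V3,V4] [V2,V3,V4,V7] [V3,V4,V5] [V4,V6,V7] [V5,V6] [V0,V1,V3,V6] [V0,V1,V2,V7] [V0,V2,V4,V5])
      (Oct [V1,V2,V3,V4,V7] [V2,V3,V4] [V3,V4,V6,V7] [V4,V5,V6] [V5,V6,V7] [V0,V1,V2,V6] [V0,V1,V7] [V1,V3,V5])
      (Oct [V1,V2,V3] [V2,V3,V5,V6] [V3,V5,V7] [V4,V5,V6] [V0,V1,V2,V5,V6] [V0,V6,V7] [V0,V2,V7] [V0,V1,V3,V4])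
      (Oct [V1,V2,V3,V4,V6] [V2,V3,V5] [V3,V4,V5,V7] [V4,V5,V6] [V1,V5,V6] [V0,V6,V7] [V1,V2,V7] [V0,V1,V3,V4])
      (Oct [V1,V2,V3] [V2,V3,V6] [V3,V5,V7] [V4,V5,V6] [V0,V1,V2,V5,V6] [V0,V1,V6,V7] [V0,V2,V7] [V0,V1,V3,V4])
      (Oct [V1,V2,V3,V4,V5] [V2,V3,V6] [V3,V5,V7] [V4,V5,V6] [V1,V2,V5,V6] [V1,V6,V7] [V0,V2,V7] [V0,V1,V3,V4])
      (Oct [V1,V2,V3,V4] [V2,V3,V4,V6,V7] [V3,V4,V5,V7] [V4,V5,V6] [V5,V6,V7] [V0,V1,V6] [V0,V2,V7] [V0,V3,V5]))
    (Oct
      (Oct [V1,V2,V3,V4,V5] [V2,V3,V5,V7] [V3,V4,V6,V7] [V4,V5,V6] [V1,V5,V6] [V2,V6,V7] [V0,V1,V7] [V0,V3,V4])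
      (Oct [V1,V2,V3,V4,V5] [V2,V3,V4,V7] [V3,V4,V6] [V4,V5,V6] [V5,V6,V7] [V1,V2,V6] [V0,V1,V7] [V0,V2,V3,V5])
      (Oct [V1,V2,V3,V4] [V2,V3,V4,V5,V7] [V3,V4,V6,V7] [V4,V5,V6] [V5,V6,V7] [V0,V2,V6] [V0,V1,V7] [V0,V3,V5])
      (Oct [V1,V2,V3,V4,V7] [V2,V3,V4,V6] [V3,V4,V5,V7] [V4,V5,V6] [V5,V6,V7] [V0,V1,V6] [V0,V2,V7] [V1,V3,V5])
      (Oct [V1,V2,V3] [V2,V3,V4,V6] [V3,V5,V7] [V4,V5,V6] [V0,V2,V5,V6] [V0,V1,V6,V7] [V0,V2,V7] [V0,V1,V3,V4])
      (Oct [V1,V2,V3,V6] [V2,V3,V5] [V3,V4,V5,V7] [V4,V5,V6] [V0,V1,V5,V6] [V0,V6,V7] [V1,V2,V7] [V0,V1,V3,V4])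
      (Oct [V1,V2,V3] [V2,V3,V4,V5] [V3,V5,V7] [V4,V5,V6] [V0,V2,V5,V6] [V0,V6,V7] [V0,V1,V2,V7] [V0,V1,V3,V4])
      (Oct [V1,V2,V3,V5] [V2,V3,V7] [V3,V4,V5,V7] [V4,V5,V6] [V0,V1,V5,V6] [V1,V6,V7] [V0,V1,V2,V7] [V0,V3,V4]))"

definition rep :: "vtx \<Rightarrow> vtx \<Rightarrow> vtx list oct" where
  "rep i j = get j (get i reps)"

primrec pat :: "shape \<Rightarrow> vtx list oct" where
  "pat (Rep i j) = rep i j"
| "pat Halves = Oct [V1,V2,V3] [V2,V3] [V3] [] [V5,V6,V7] [V6,V7] [V7] []"
| "pat FiveThree = Oct [V1,V2,V3,V4] [V2,V3,V4] [V3,V4] [V4] [] [V6,V7] [V7] []"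
| "pat Seven1 = Oct [V1,V2,V3,V4] [V2,V3,V4,V6] [V3,V5] [V4,V5] [V2,V5] [V0,V1,V6] [V0,V2,V3,V4] []"
| "pat Seven2 = Oct [V1,V2,V3] [V2,V3,V5] [V3,V4,V6] [V4,V5] [V0,V1,V5] [V0,V2,V6] [V0,V1,V3,V4] []"
| "pat Seven3 = Oct [V1,V2,V3] [V2,V3,V6] [V3,V4,V5] [V4,V5,V6] [V0,V1,V5] [V0,V1,V6] [V0,V2,V4] []"
| "pat Seven4 = Oct [V1,V2,V4] [V2,V3,V5] [V3,V4,V6] [V0,V4,V5] [V1,V5,V6] [V0,V2,V6] [V0,V1,V3] []"
| "pat S0 = Oct [V1,V2,V3] [V2,V3] [V3] [] [V5] [V6] [V4] []"
| "pat S1 = Oct [V1,V2,V3] [V2,V3] [V3] [] [V5] [V6] [V4] [V4,V5,V6]"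
| "pat S2 = Oct [V1,V2,V3] [V2,V3] [V3] [] [V2,V5] [V6] [V4] [V4,V5,V6]"
| "pat S3 = Oct [V1,V2,V3] [V2,V3] [V3] [] [V2,V5] [V2,V6] [V4] [V4,V5,V6]"
| "pat S4 = Oct [V1,V2,V3] [V2,V3] [V3] [] [V5,V7] [V6,V7] [V4,V7] []"
| "pat S5 = Oct [V1,V2,V3,V4] [V2,V3] [V3] [] [V5,V7] [V6,V7] [V4,V7] []"
| "pat S6 = Oct [V1,V2,V3,V4] [V2,V3] [V3] [] [V2,V5,V7] [V6,V7] [V4,V7] []"
| "pat S7 = Oct [V1,V2,V3] [V2,V3] [V3] [] [V5,V6] [V6,V7] [V7] [V4]"
| "pat S8 = Oct [V1,V2,V3] [V2,V3] [V3] [V7] [V5,V6] [V6,V7] [V7] [V4]"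
| "pat S9 = Oct [V1,V2,V3] [V2,V3] [V3] [V6,V7] [V5,V6] [V6,V7] [V7] [V4]"
| "pat S10 = Oct [V1,V2,V3] [V2,V3] [V3] [] [V5,V6] [V6,V7] [V7] [V2,V4]"
| "pat S11 = Oct [V1,V2,V3] [V2,V3] [V3] [] [V5,V6] [V6,V7] [V7] [V1,V2,V4]"
| "pat S12 = Oct [V1,V2,V3,V4] [V2,V3] [V3] [] [V5,V6] [V6,V7] [V7] [V4]"
| "pat S13 = Oct [V1,V2,V3,V4] [V2,V3,V4] [V3] [] [V5,V6] [V6,V7] [V7] [V4]"
| "pat S14 = Oct [V1,V2,V3,V4] [V2,V3] [V3] [] [V2,V5,V6] [V6,V7] [V7] [V4]"
| "pat S15 = Oct [V1,V2,V3,V4] [V2,V3] [V3] [] [V5,V6] [V0,V6,V7] [V7] [V4]"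
| "pat S16 = Oct [V1,V2,V3,V4] [V2,V3] [V3] [] [V2,V5,V6] [V0,V6,V7] [V7] [V4]"
| "pat S17 = Oct [V1,V2,V3,V4] [V2,V3] [V3] [] [V5,V6] [V0,V6,V7] [V7] [V2,V4]"

section \<open>Decision trees\<close>

datatype tree = Hit shape vtx vtx vtx vtx vtx vtx vtx vtx | Ask vtx vtx tree tree

definition arrow :: "vtx \<Rightarrow> vtx \<Rightarrow> bool oct oct \<Rightarrow> bool oct oct" where
  "arrow u v M = put u (put v True (get u M)) M"

primrec row_ok :: "vtx list \<Rightarrow> bool oct \<Rightarrow> vtx oct \<Rightarrow> bool" where
  "row_ok [] r f = True"
| "row_ok (v # vs) r f = (get (get v f) r \<and> row_ok vs r f)"

fun placed :: "vtx list oct \<Rightarrow> vtx oct \<Rightarrow> bool oct oct \<Rightarrow> bool" where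
  "placed (Oct p0 p1 p2 p3 p4 p5 p6 p7) (Oct a b c d e f g h) M \<longleftrightarrow>
     row_ok p0 (get a M) (Oct a b c d e f g h) \<and> row_ok p1 (get b M) (Oct a b c d e f g h) \<and>
     row_ok p2 (get c M) (Oct a b c d e f g h) \<and> row_ok p3 (get d M) (Oct a b c d e f g h) \<and>
     row_ok p4 (get e M) (Oct a b c d e f g h) \<and> row_ok p5 (get f M) (Oct a b c d e f g h) \<and>
     row_ok p6 (get g M) (Oct a b c d e f g h) \<and> row_ok p7 (get h M) (Oct a b c d e f g h)"

lemma adj_arrow: "adj (arrow u v M) x y \<longleftrightarrow> x = u \<and> y = v \<or> adj M x y"
  by (auto simp: adj_def arrow_def get_put)

lemma row_ok_iff: "row_ok vs r f \<longleftrightarrow> (\<forall>v\<in>set vs. get (get v f) r)"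
  by (induction vs) auto

lemma placed_iff: "placed P f M \<longleftrightarrow> (\<forall>u v. adj (matrix P) u v \<longrightarrow> adj M (get u f) (get v f))"
  unfolding adj_matrix
  by (cases P; cases f) (simp add: row_ok_iff adj_def all_vtx[where P = "\<lambda>u. \<forall>v. v \<in> set (get u _) \<longrightarrow> _ u v"] Ball_def)

text \<open>
  Refuting a pattern and reducing it to the representatives are treated alike: a pattern that no
  critical tournament contains is resolved for want of an occurrence.
\<close>

definition resolves :: "shape \<Rightarrow> bool" where
  "resolves s \<longleftrightarrow> (\<forall>t. critical t \<longrightarrow> occurs (pat s) t \<longrightarrow> (\<exists>i j. occurs (rep i j) t))"

text \<open>
  A decision tree for a pattern \<open>s\<close> asks for the direction of arcs that \<open>s\<close> leaves open. The
  matrix collects the arcs known so far. At a leaf the known arcs must contain a copy of a pattern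
  that is already resolved, with \<open>a\<close>, ..., \<open>h\<close> in the places of \<open>V0\<close>, ..., \<open>V7\<close>; that all entries
  of the row of \<open>[a, ..., h]\<close> are \<open>True\<close> says that these vertices are distinct.
\<close>

primrec decides :: "tree \<Rightarrow> bool oct oct \<Rightarrow> bool" where
  "decides (Hit s a b c d e f g h) M \<longleftrightarrow>
     resolves s \<and> row [a, b, c, d, e, f, g, h] = Oct True True True True True True True True \<and>
     placed (pat s) (Oct a b c d e f g h) M"
| "decides (Ask u v S T) M \<longleftrightarrow>
     u \<noteq> v \<and> decides S (arrow u v M) \<and> decides T (arrow v u M)"

text \<open>
  The arcs recorded in the matrix stay a subset of the arcs of the tournament, seen through the
  bijection \<open>f\<close>: at a question the tournament itself selects the branch in which this remains
  true.
\<close>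

lemma decides_sound:
  assumes "decides T M" "critical t" "inj f" "\<And>u v. adj M u v \<Longrightarrow> t (f u) (f v)"
  shows "\<exists>i j. occurs (rep i j) t"
  using assms
proof (induction T arbitrary: M)
  case (Hit s a b c d e f' g h)
  let ?F = "Oct a b c d e f' g h"
  have "get v (row [a, b, c, d, e, f', g, h])" for v
    using Hit.prems(1) by (cases v) simp_all
  then have "v \<in> set [a, b, c, d, e, f', g, h]" for v by (simp only: get_row)
  then have "surj (\<lambda>v. get v ?F)" unfolding range_get by auto
  then have "inj (\<lambda>v. get v ?F)" by (rule finite_UNIV_surj_inj[OF finite])
  then have "inj (f \<circ> (\<lambda>v. get v ?F))" using Hit.prems(3) by (rule inj_compose[rotated])
  moreover have "placed (pat s) ?F M" and "resolves s"
    using Hit.prems(1) by (simp_all only: decides.simps)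
  then have "t (f (get u ?F)) (f (get v ?F))" if "adj (matrix (pat s)) u v" for u v
    using Hit.prems(4) that unfolding placed_iff by blast
  ultimately have "occurs (pat s) t"
    unfolding occurs_def by (intro exI[of _ "f \<circ> (\<lambda>v. get v ?F)"]) simp
  then show ?case using \<open>resolves s\<close> Hit.prems(2) unfolding resolves_def by blast
next
  case (Ask u v S T)
  have "f u \<noteq> f v" using Ask.prems(1,3) by (auto dest: injD)
  then consider "t (f u) (f v)" | "t (f v) (f u)"
    using Ask.prems(2) unfolding critical_def oriented_def by blast
  then show ?case
  proof cases
    case 1
    then show ?thesis using Ask.IH(1)[of "arrow u v M"] Ask.prems by (auto simp: adj_arrow)
  next
    case 2
    then show ?thesis using Ask.IH(2)[of "arrow v u M"] Ask.prems by (auto simp: adj_arrow)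
  qed
qed

lemma resolvesI: "decides T (matrix (pat s)) \<Longrightarrow> resolves s"
  unfolding resolves_def occurs_def[of "pat s"] using decides_sound by blast

named_theorems resolved

lemma resolves_Rep [resolved]: "resolves (Rep i j)"
  unfolding resolves_def by auto

text \<open>
  A triangle in a transitively ordered list cannot use the first vertex, since nothing in the list
  dominates it.
\<close>

lemma triangle_free_set:
  assumes "oriented t" "sorted_wrt t vs"
  shows "triangle_free t (set vs)"
  using assms(2)
proof (induction vs)
  case (Cons v vs)
  have asym: "\<not> (t x y \<and> t y x)" for x y using assms(1) unfolding oriented_def by blast
  have "\<not> (t x y \<and> t y z \<and> t z x)" if "x \<in> set (v # vs)" "y \<in> set (v # vs)" "z \<in> set (v # vs)" for x y z
  proof (cases "v \<in> {x, y, z}")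
    case True
    have "\<not> t w v" if "w \<in> set (v # vs)" for w
      using that Cons.prems asym by auto
    then show ?thesis using True that by auto
  next
    case False
    then show ?thesis using that Cons unfolding triangle_free_def by auto
  qed
  then show ?case unfolding triangle_free_def by blast
qed (simp add: triangle_free_def)

lemma resolves_split:
  assumes vs: "set xs \<union> set ys = UNIV"
    and arcs: "sorted_wrt (adj (matrix (pat s))) xs" "sorted_wrt (adj (matrix (pat s))) ys"
  shows "resolves s"
  unfolding resolves_def
proof (intro allI impI)
  fix t assume t: "critical t" and "occurs (pat s) t"
  then obtain f where f: "inj f" "\<And>u v. adj (matrix (pat s)) u v \<Longrightarrow> t (f u) (f v)"
    unfolding occurs_def by blast
  have "sorted_wrt t (map f xs)" "sorted_wrt t (map f ys)"
    unfolding sorted_wrt_map using arcs f(2) by (auto elim: sorted_wrt_mono_rel[rotated])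
  moreover have "oriented t" using t unfolding critical_def by blast
  ultimately have "triangle_free t (f ` set xs)" "triangle_free t (f ` set ys)"
    using triangle_free_set by (metis set_map)+
  moreover have "surj f" using f(1) by (rule finite_UNIV_inj_surj[OF finite])
  then have "UNIV \<subseteq> f ` set xs \<union> f ` set ys" using vs by (metis image_Un subset_refl)
  ultimately have "splittable t UNIV" unfolding splittable_def by blast
  then show "\<exists>i j. occurs (rep i j) t" using t unfolding critical_def by blast
qed

text \<open>
  In a critical tournament the deletion of the vertex in the place of \<open>v\<close> leaves a splittable
  tournament, and fewer arcs make splitting only easier.
\<close>

lemma resolves_unsplittable:
  assumes "\<not> splittable (adj (matrix (pat s))) (- {v})"
  shows "resolves s"
  unfolding resolves_def
proof (intro allI impI)
  fix t assume t: "critical t" and "occurs (pat s) t"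
  then obtain f where f: "inj f" "\<And>x y. adj (matrix (pat s)) x y \<Longrightarrow> t (f x) (f y)"
    unfolding occurs_def by blast
  have "splittable t (- {f v})" using t unfolding critical_def by blast
  then have "splittable (adj (matrix (pat s))) (- {v})"
    by (rule splittable_image[where f = f]) (use f in \<open>auto dest: injD\<close>)
  then show "\<exists>i j. occurs (rep i j) t" using assms by blast
qed

lemma resolves_Halves [resolved]: "resolves Halves"
  by (rule resolves_split[where xs = "[V0, V1, V2, V3]" and ys = "[V4, V5, V6, V7]"])
     (auto simp: adj_def UNIV_vtx)

lemma resolves_FiveThree [resolved]: "resolves FiveThree"
  by (rule resolves_split[where xs = "[V0, V1, V2, V3, V4]" and ys = "[V5, V6, V7]"])
     (auto simp: adj_def UNIV_vtx)

section \<open>Search for splittings\<close>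

text \<open>
  Conditionals instead of conjunctions make the simplifier, used with a weak congruence rule for
  \<open>if\<close>, evaluate the search below lazily: a branch is entered only when it is needed.
\<close>

primrec all_in :: "('a \<Rightarrow> bool) \<Rightarrow> 'a list \<Rightarrow> bool" where
  "all_in P [] = True"
| "all_in P (x # xs) = (if P x then all_in P xs else False)"

lemma all_in_iff: "all_in P xs \<longleftrightarrow> (\<forall>x\<in>set xs. P x)"
  by (induction xs) auto

definition closes_no_triangle :: "vtx \<Rightarrow> vtx list \<Rightarrow> bool oct oct \<Rightarrow> bool" where
  "closes_no_triangle v A M \<longleftrightarrow>
     all_in (\<lambda>a. all_in (\<lambda>b. \<not> get b (get a M)) (filter (\<lambda>b. get v (get b M)) A))
       (filter (\<lambda>a. get a (get v M)) A)"

text \<open>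
  Backtracking search for a splitting: \<open>A\<close> and \<open>B\<close> are the parts built so far, both triangle-free.
\<close>

primrec splits :: "vtx list \<Rightarrow> vtx list \<Rightarrow> vtx list \<Rightarrow> bool oct oct \<Rightarrow> bool" where
  "splits [] A B M \<longleftrightarrow> True"
| "splits (v # vs) A B M \<longleftrightarrow>
     (if (if closes_no_triangle v A M then splits vs (v # A) B M else False) then True
      else if closes_no_triangle v B M then splits vs A (v # B) M else False)"

lemma closes_no_triangle_iff:
  "closes_no_triangle v A M \<longleftrightarrow>
    (\<forall>a\<in>set A. \<forall>b\<in>set A. \<not> (adj M v a \<and> adj M a b \<and> adj M b v))"
  unfolding closes_no_triangle_def all_in_iff adj_def by simp blast

lemma triangle_free_insert:
  assumes "\<And>u. \<not> adj M u u" "triangle_free (adj M) (set A)"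
  shows "triangle_free (adj M) (insert v (set A)) \<longleftrightarrow> closes_no_triangle v A M"
proof
  assume *: "closes_no_triangle v A M"
  show "triangle_free (adj M) (insert v (set A))"
    unfolding triangle_free_def
  proof (intro ballI)
    fix x y z assume "x \<in> insert v (set A)" "y \<in> insert v (set A)" "z \<in> insert v (set A)"
    then show "\<not> (adj M x y \<and> adj M y z \<and> adj M z x)"
      using assms * unfolding triangle_free_def closes_no_triangle_iff by (metis insert_iff)
  qed
next
  assume "triangle_free (adj M) (insert v (set A))"
  then show "closes_no_triangle v A M"
    unfolding closes_no_triangle_iff triangle_free_def by (meson insertI1 insertI2)
qed

lemma splits_iff:
  assumes "\<And>u. \<not> adj M u u" "triangle_free (adj M) (set A)" "triangle_free (adj M) (set B)"
  shows "splits vs A B M \<longleftrightarrow>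
    (\<exists>X Y. set vs \<subseteq> X \<union> Y \<and> triangle_free (adj M) (set A \<union> X) \<and> triangle_free (adj M) (set B \<union> Y))"
  using assms(2,3)
proof (induction vs arbitrary: A B)
  case Nil
  then show ?case by (auto intro!: exI[of _ "{}"])
next
  case (Cons v vs)
  let ?E = "\<lambda>vs A B. \<exists>X Y. set vs \<subseteq> X \<union> Y \<and> triangle_free (adj M) (A \<union> X) \<and> triangle_free (adj M) (B \<union> Y)"
  have A: "closes_no_triangle v A M \<longleftrightarrow> triangle_free (adj M) (set (v # A))"
    and B: "closes_no_triangle v B M \<longleftrightarrow> triangle_free (adj M) (set (v # B))"
    using triangle_free_insert[OF assms(1)] Cons.prems by auto
  have "splits (v # vs) A B M \<longleftrightarrow>
      triangle_free (adj M) (set (v # A)) \<and> ?E vs (set (v # A)) (set B) \<or>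
      triangle_free (adj M) (set (v # B)) \<and> ?E vs (set A) (set (v # B))"
    using Cons.IH[of "v # A" B] Cons.IH[of A "v # B"] Cons.prems by (auto simp: A B)
  also have "\<dots> \<longleftrightarrow> ?E (v # vs) (set A) (set B)" (is "?L \<longleftrightarrow> ?R")
  proof
    assume ?L
    then show ?R
    proof (elim disjE conjE exE)
      fix X Y assume "set vs \<subseteq> X \<union> Y" "triangle_free (adj M) (set (v # A) \<union> X)" "triangle_free (adj M) (set B \<union> Y)"
      then show ?R by (intro exI[of _ "insert v X"] exI[of _ Y]) auto
    next
      fix X Y assume "set vs \<subseteq> X \<union> Y" "triangle_free (adj M) (set A \<union> X)" "triangle_free (adj M) (set (v # B) \<union> Y)"
      then show ?R by (intro exI[of _ X] exI[of _ "insert v Y"]) auto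
    qed
  next
    assume ?R
    then obtain X Y where XY: "set vs \<subseteq> X \<union> Y" "v \<in> X \<or> v \<in> Y"
      "triangle_free (adj M) (set A \<union> X)" "triangle_free (adj M) (set B \<union> Y)" by auto
    from XY(2) show ?L
    proof
      assume v: "v \<in> X"
      have "set (v # A) \<union> X = set A \<union> X" using v by auto
      moreover have "triangle_free (adj M) (set (v # A))"
        using XY(3) by (rule triangle_free_mono) (use v in auto)
      ultimately show ?L using XY by metis
    next
      assume v: "v \<in> Y"
      have "set (v # B) \<union> Y = set B \<union> Y" using v by auto
      moreover have "triangle_free (adj M) (set (v # B))"
        using XY(4) by (rule triangle_free_mono) (use v in auto)
      ultimately show ?L using XY by metis
    qed
  qed
  finally show ?case .
qed

text \<open>
  The two parts are interchangeable, so the first vertex may be put into the first part.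
\<close>

primrec splits_list :: "vtx list \<Rightarrow> bool oct oct \<Rightarrow> bool" where
  "splits_list [] M \<longleftrightarrow> True"
| "splits_list (v # vs) M \<longleftrightarrow> splits vs [v] [] M"

lemma splittable_iff_splits_list:
  assumes "\<And>u. \<not> adj M u u"
  shows "splittable (adj M) (set vs) \<longleftrightarrow> splits_list vs M"
proof (cases vs)
  case Nil
  then show ?thesis by (auto simp: splittable_def triangle_free_def)
next
  case (Cons v us)
  have "splits us [v] [] M \<longleftrightarrow> (\<exists>X Y. set us \<subseteq> X \<union> Y \<and>
      triangle_free (adj M) (insert v X) \<and> triangle_free (adj M) Y)"
    using splits_iff[OF assms, of "[v]" "[]" us] assms by (simp add: triangle_free_def)
  also have "\<dots> \<longleftrightarrow> splittable (adj M) (insert v (set us))"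
  proof
    assume "\<exists>X Y. set us \<subseteq> X \<union> Y \<and> triangle_free (adj M) (insert v X) \<and> triangle_free (adj M) Y"
    then show "splittable (adj M) (insert v (set us))"
      unfolding splittable_def by (metis Un_insert_left insert_mono)
  next
    assume "splittable (adj M) (insert v (set us))"
    then obtain X Y where "insert v (set us) \<subseteq> X \<union> Y" "triangle_free (adj M) X" "triangle_free (adj M) Y"
      unfolding splittable_def by blast
    then show "\<exists>X Y. set us \<subseteq> X \<union> Y \<and> triangle_free (adj M) (insert v X) \<and> triangle_free (adj M) Y"
      by (metis Un_commute Un_iff insert_absorb insert_subset)
  qed
  finally show ?thesis using Cons by simp
qed

text \<open>
  Starting with \<open>V7\<close> keeps the searches short, since \<open>V0\<close> to \<open>V3\<close> are in transitive order
  in all the representatives.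
\<close>

definition vertices :: "vtx list" where
  "vertices = [V7, V6, V5, V4, V3, V2, V1, V0]"

lemma set_vertices: "set vertices = UNIV"
  by (auto simp: vertices_def UNIV_vtx)

lemmas split_simps = splits_list.simps splits.simps all_in.simps filter.simps closes_no_triangle_def
  get.simps if_True if_False simp_thms

lemmas matrix_simps = matrix.simps row.simps get.simps put.simps pat.simps rep_def reps_def

lemma resolves_Seven [resolved]: "resolves Seven1" "resolves Seven2" "resolves Seven3" "resolves Seven4"
proof -
  have *: "resolves s" if "\<not> splits_list [V0, V1, V2, V3, V4, V5, V6] (matrix (pat s))"
    "\<forall>u. \<not> adj (matrix (pat s)) u u" for s
  proof (rule resolves_unsplittable)
    have "- {V7} = set [V0, V1, V2, V3, V4, V5, V6]" using UNIV_vtx by auto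
    then show "\<not> splittable (adj (matrix (pat s))) (- {V7})"
      using that splittable_iff_splits_list[of "matrix (pat s)"] by metis
  qed
  show "resolves Seven1" "resolves Seven2" "resolves Seven3" "resolves Seven4"
    by (rule *, simp only: matrix_simps split_simps cong: if_weak_cong, simp add: all_vtx adj_def)+
qed

definition critical_matrix :: "bool oct oct \<Rightarrow> bool" where
  "critical_matrix M \<longleftrightarrow>
     all_in (\<lambda>u. all_in (\<lambda>v. get v (get u M) = (if u = v then False else \<not> get u (get v M))) vertices) vertices \<and>
     \<not> splits_list vertices M \<and> all_in (\<lambda>v. splits_list (remove1 v vertices) M) vertices"

lemma critical_matrixI:
  assumes "critical_matrix M"
  shows "critical (adj M)"
proof -
  have M: "get v (get u M) = (if u = v then False else \<not> get u (get v M))"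
    "\<not> splits_list vertices M" "splits_list (remove1 v vertices) M" for u v
    using assms unfolding critical_matrix_def all_in_iff set_vertices by blast+
  have o: "oriented (adj M)"
    unfolding oriented_def adj_def using M(1) by metis
  then have irr: "\<not> adj M u u" for u unfolding oriented_def by blast
  have "distinct vertices" by (simp add: vertices_def)
  then have "set (remove1 v vertices) = - {v}" for v
    by (simp add: set_vertices Compl_eq_Diff_UNIV)
  then have "splittable (adj M) (- {v})" for v
    using M(3) splittable_iff_splits_list[OF irr] by metis
  moreover have "\<not> splittable (adj M) UNIV"
    using M(2) splittable_iff_splits_list[OF irr, of vertices] unfolding set_vertices by blast
  ultimately show ?thesis unfolding critical_def using o by blast
qed

lemma rep_critical: "critical (adj (matrix (rep i j)))"
proof (rule critical_matrixI)
  show "critical_matrix (matrix (rep i j))"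
    by (cases i; cases j)
      (simp_all only: matrix_simps critical_matrix_def vertices_def remove1.simps split_simps
         vtx.distinct cong: if_weak_cong)
qed

section \<open>The decision trees of the patterns\<close>

text \<open>
  The patterns are treated in decreasing order of their numbers, so that the leaves of a tree refer to
  patterns already known to be resolved.
\<close>

lemmas decision_simps = decides.simps matrix_simps arrow_def row_ok.simps placed.simps get.simps
  simp_thms vtx.distinct


lemma resolves_S17 [resolved]: "resolves S17"
  by (rule resolvesI[where T = "
    Ask V2 V4 (Ask V3 V4 (Ask V1 V4 (Hit FiveThree V0 V1 V2 V3 V4 V5 V6 V7) (Ask V1 V7 (Ask V1 V5
    (Ask V1 V6 (Hit Halves V0 V2 V3 V4 V1 V5 V6 V7) (Ask V3 V7 (Ask V3 V5 (Ask V0 V6 (Ask V2 V6 (Hit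
    Halves V0 V2 V4 V6 V1 V3 V5 V7) (Ask V0 V7 (Hit FiveThree V0 V6 V1 V7 V2 V3 V4 V5) (Ask V2 V5
    (Hit Seven2 V6 V1 V7 V2 V4 V5 V0 V3) (Ask V3 V6 (Hit Halves V0 V3 V4 V6 V1 V5 V7 V2) (Hit (Rep
    V1 V6) V0 V6 V1 V2 V3 V4 V5 V7))))) (Ask V0 V7 (Ask V2 V6 (Ask V2 V5 (Hit Halves V0 V1 V3 V7 V2
    V4 V5 V6) (Ask V3 V6 (Hit Halves V0 V1 V7 V2 V3 V4 V5 V6) (Hit (Rep V1 V5) V6 V0 V1 V3 V7 V2 V4
    V5))) (Hit FiveThree V6 V0 V1 V7 V2 V3 V4 V5)) (Ask V3 V6 (Ask V2 V5 (Ask V2 V6 (Hit Seven3 V2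
    V4 V5 V6 V7 V0 V1 V3) (Hit (Rep V7 V7) V1 V2 V3 V5 V6 V7 V0 V4)) (Ask V2 V6 (Hit (Rep V7 V5) V5
    V7 V0 V2 V3 V4 V6 V1) (Hit (Rep V4 V7) V5 V6 V7 V0 V2 V3 V4 V1))) (Hit Seven2 V1 V3 V5 V7 V0 V4
    V6 V2)))) (Ask V2 V6 (Ask V0 V6 (Hit Halves V0 V2 V4 V6 V1 V5 V3 V7) (Ask V0 V7 (Ask V2 V5 (Hit
    Halves V0 V1 V3 V7 V2 V4 V5 V6) (Ask V3 V6 (Hit (Rep V0 V3) V5 V0 V3 V7 V2 V4 V6 V1) (Hit (Rep
    V0 V1) V6 V0 V1 V3 V7 V2 V4 V5))) (Ask V2 V5 (Hit Seven3 V2 V4 V5 V6 V7 V0 V1 V3) (Ask V3 V6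
    (Hit (Rep V6 V4) V5 V7 V0 V2 V3 V4 V6 V1) (Hit (Rep V2 V5) V5 V2 V6 V3 V7 V0 V4 V1))))) (Ask V3
    V6 (Ask V2 V5 (Hit Seven2 V5 V3 V6 V7 V2 V4 V1 V0) (Ask V0 V6 (Hit Halves V0 V3 V4 V6 V1 V5 V7
    V2) (Ask V0 V7 (Hit (Rep V0 V1) V6 V0 V1 V7 V2 V3 V4 V5) (Hit (Rep V2 V2) V5 V6 V7 V0 V2 V3 V4
    V1)))) (Ask V2 V5 (Ask V0 V6 (Ask V0 V7 (Hit FiveThree V0 V6 V1 V3 V7 V2 V4 V5) (Hit Seven2 V6
    V1 V7 V2 V4 V5 V0 V3)) (Ask V0 V7 (Hit FiveThree V6 V0 V1 V3 V7 V2 V4 V5) (Hit (Rep V2 V7) V6 V0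
    V1 V2 V3 V7 V4 V5))) (Hit Seven1 V1 V5 V2 V3 V7 V4 V6 V0))))) (Ask V0 V7 (Hit FiveThree V0 V1 V7
    V2 V3 V4 V5 V6) (Ask V2 V5 (Ask V2 V6 (Ask V0 V6 (Ask V3 V5 (Ask V3 V6 (Hit FiveThree V0 V2 V3
    V4 V6 V1 V5 V7) (Hit Seven2 V6 V1 V7 V3 V4 V5 V0 V2)) (Hit Halves V0 V2 V4 V6 V1 V5 V7 V3)) (Hit
    Seven3 V2 V4 V5 V6 V7 V0 V1 V3)) (Ask V0 V6 (Hit Seven2 V6 V1 V7 V2 V4 V5 V0 V3) (Ask V3 V6 (Ask
    V3 V5 (Hit Seven3 V3 V4 V5 V6 V7 V0 V1 V2) (Hit (Rep V5 V5) V7 V0 V2 V3 V4 V6 V1 V5)) (Hit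
    FiveThree V6 V7 V0 V2 V3 V4 V1 V5)))) (Ask V3 V5 (Ask V3 V6 (Ask V0 V6 (Hit Halves V0 V3 V4 V6
    V1 V5 V7 V2) (Hit Seven3 V3 V4 V5 V6 V7 V0 V1 V2)) (Ask V0 V6 (Hit Seven2 V6 V1 V7 V3 V4 V5 V0
    V2) (Ask V2 V6 (Hit (Rep V5 V6) V7 V0 V2 V3 V4 V5 V6 V1) (Hit FiveThree V6 V7 V0 V2 V3 V4 V1
    V5)))) (Hit FiveThree V5 V7 V0 V2 V3 V4 V6 V1)))))) (Ask V1 V6 (Hit Halves V0 V2 V3 V4 V5 V1 V6
    V7) (Hit Halves V0 V2 V3 V4 V5 V6 V1 V7))) (Ask V0 V7 (Ask V3 V7 (Ask V1 V5 (Ask V3 V5 (Ask V3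
    V6 (Hit Halves V0 V7 V1 V2 V3 V4 V5 V6) (Ask V1 V6 (Ask V2 V5 (Ask V2 V6 (Hit Halves V0 V3 V7 V4
    V1 V2 V5 V6) (Hit Seven2 V2 V3 V4 V5 V6 V7 V1 V0)) (Ask V2 V6 (Hit Halves V0 V3 V7 V4 V1 V5 V2
    V6) (Hit Halves V0 V3 V7 V4 V1 V5 V6 V2))) (Ask V0 V6 (Ask V2 V5 (Hit Halves V0 V6 V7 V1 V2 V3
    V4 V5) (Ask V2 V6 (Hit Seven4 V1 V2 V3 V4 V5 V6 V7 V0) (Hit FiveThree V0 V6 V7 V1 V2 V3 V4 V5)))
    (Ask V2 V5 (Hit Halves V2 V3 V4 V5 V6 V0 V7 V1) (Ask V2 V6 (Hit Seven4 V1 V2 V3 V4 V5 V6 V7 V0)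
    (Hit FiveThree V6 V0 V7 V1 V2 V3 V4 V5)))))) (Ask V3 V6 (Ask V1 V6 (Hit Halves V0 V7 V2 V4 V1 V5
    V3 V6) (Ask V2 V5 (Ask V2 V6 (Hit Halves V0 V7 V4 V1 V2 V5 V3 V6) (Hit Seven3 V1 V2 V5 V3 V6 V7
    V4 V0)) (Ask V2 V6 (Hit Halves V0 V7 V4 V1 V5 V2 V3 V6) (Hit Seven2 V6 V7 V1 V2 V3 V4 V5 V0))))
    (Ask V1 V6 (Hit Halves V0 V7 V2 V4 V1 V5 V6 V3) (Ask V2 V5 (Ask V2 V6 (Hit Halves V0 V7 V4 V1 V2
    V5 V6 V3) (Hit Seven2 V1 V2 V5 V3 V7 V4 V6 V0)) (Ask V2 V6 (Hit Halves V0 V7 V4 V1 V5 V2 V6 V3)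
    (Hit Halves V0 V7 V4 V1 V5 V6 V2 V3)))))) (Ask V1 V6 (Ask V3 V6 (Ask V3 V5 (Hit Halves V0 V7 V1
    V2 V3 V4 V5 V6) (Hit Halves V0 V7 V2 V4 V5 V1 V3 V6)) (Ask V3 V5 (Ask V2 V6 (Ask V2 V5 (Hit
    Seven2 V4 V5 V1 V6 V3 V7 V2 V0) (Hit Halves V0 V3 V7 V4 V5 V1 V2 V6)) (Ask V2 V5 (Hit Seven3 V1
    V6 V2 V3 V4 V5 V7 V0) (Hit Halves V0 V3 V7 V4 V5 V1 V6 V2))) (Hit Halves V0 V7 V2 V4 V5 V1 V6
    V3))) (Hit Halves V0 V2 V3 V4 V5 V6 V7 V1))) (Hit FiveThree V0 V7 V1 V2 V3 V4 V5 V6)) (Ask V3 V7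
    (Ask V1 V5 (Ask V3 V5 (Ask V3 V6 (Hit Halves V3 V4 V5 V6 V7 V0 V1 V2) (Ask V1 V6 (Ask V0 V6 (Ask
    V2 V6 (Ask V2 V5 (Hit (Rep V3 V6) V0 V1 V2 V6 V3 V7 V4 V5) (Hit (Rep V2 V4) V0 V1 V2 V6 V3 V7 V4
    V5)) (Ask V2 V5 (Hit Seven2 V2 V3 V4 V5 V6 V7 V1 V0) (Hit (Rep V1 V2) V0 V1 V6 V2 V3 V4 V5 V7)))
    (Hit Seven3 V4 V1 V5 V6 V7 V0 V3 V2)) (Ask V2 V5 (Ask V0 V6 (Ask V2 V6 (Hit (Rep V6 V6) V0 V4 V6
    V1 V2 V3 V5 V7) (Hit (Rep V7 V1) V0 V6 V1 V2 V3 V4 V5 V7)) (Hit Halves V2 V3 V4 V5 V6 V7 V0 V1))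
    (Ask V2 V6 (Hit Seven4 V1 V2 V3 V4 V5 V6 V7 V0) (Ask V0 V6 (Hit (Rep V1 V7) V0 V6 V1 V2 V3 V4 V5
    V7) (Hit FiveThree V6 V7 V0 V1 V2 V3 V4 V5)))))) (Ask V3 V6 (Ask V1 V6 (Hit Halves V1 V5 V3 V6
    V7 V0 V2 V4) (Ask V2 V6 (Ask V2 V5 (Hit Halves V2 V5 V3 V6 V7 V0 V4 V1) (Hit Halves V5 V2 V3 V6
    V7 V0 V4 V1)) (Ask V2 V5 (Hit Seven3 V1 V2 V5 V3 V6 V7 V4 V0) (Hit Seven2 V6 V7 V1 V2 V3 V4 V5
    V0)))) (Ask V1 V6 (Hit Halves V1 V5 V6 V3 V7 V0 V2 V4) (Ask V2 V5 (Ask V2 V6 (Hit Halves V2 V5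
    V6 V3 V7 V0 V4 V1) (Hit Seven2 V1 V2 V5 V3 V7 V4 V6 V0)) (Ask V2 V6 (Hit Halves V5 V2 V6 V3 V7
    V0 V4 V1) (Hit Halves V5 V6 V2 V3 V7 V0 V4 V1)))))) (Ask V1 V6 (Ask V3 V6 (Ask V3 V5 (Hit Halves
    V3 V4 V5 V6 V7 V0 V1 V2) (Hit Halves V5 V1 V3 V6 V7 V0 V2 V4)) (Ask V3 V5 (Ask V0 V6 (Ask V2 V6
    (Ask V2 V5 (Hit Seven2 V4 V5 V1 V6 V3 V7 V2 V0) (Hit FiveThree V5 V0 V1 V2 V6 V3 V7 V4)) (Ask V2
    V5 (Hit Seven3 V1 V6 V2 V3 V4 V5 V7 V0) (Hit FiveThree V5 V0 V1 V6 V2 V3 V7 V4))) (Hit Seven2 V7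
    V0 V4 V1 V6 V3 V5 V2)) (Hit Halves V5 V1 V6 V3 V7 V0 V2 V4))) (Hit Halves V0 V2 V3 V4 V5 V6 V7
    V1))) (Hit FiveThree V7 V0 V1 V2 V3 V4 V5 V6))))) (Ask V1 V4 (Hit FiveThree V0 V1 V2 V4 V3 V5 V6
    V7) (Ask V1 V7 (Ask V1 V6 (Ask V1 V5 (Hit Halves V0 V2 V4 V3 V1 V5 V6 V7) (Hit Halves V0 V2 V4
    V3 V5 V1 V6 V7)) (Ask V1 V5 (Ask V0 V7 (Ask V3 V7 (Ask V3 V6 (Ask V3 V5 (Hit Halves V0 V1 V7 V2
    V4 V3 V5 V6) (Hit Halves V0 V1 V7 V2 V4 V5 V3 V6)) (Ask V2 V5 (Ask V0 V6 (Hit FiveThree V0 V6 V1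
    V3 V7 V2 V4 V5) (Hit FiveThree V6 V0 V1 V3 V7 V2 V4 V5)) (Hit Halves V4 V6 V1 V3 V5 V0 V7 V2)))
    (Hit FiveThree V0 V1 V7 V2 V3 V4 V5 V6)) (Ask V2 V5 (Ask V0 V6 (Ask V2 V6 (Ask V3 V6 (Hit
    FiveThree V0 V2 V4 V3 V6 V1 V5 V7) (Hit FiveThree V0 V2 V4 V6 V3 V1 V5 V7)) (Hit Seven2 V6 V1 V7
    V2 V4 V5 V0 V3)) (Ask V2 V6 (Hit Seven3 V2 V4 V5 V6 V7 V0 V1 V3) (Ask V3 V5 (Hit Halves V4 V1 V3
    V5 V6 V7 V0 V2) (Hit Halves V4 V1 V5 V3 V6 V7 V0 V2)))) (Ask V3 V6 (Ask V0 V6 (Hit Halves V0 V4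
    V3 V6 V1 V5 V7 V2) (Ask V2 V6 (Ask V3 V7 (Ask V3 V5 (Hit (Rep V7 V7) V1 V3 V5 V7 V0 V2 V4 V6)
    (Hit (Rep V1 V1) V1 V5 V2 V3 V6 V7 V0 V4)) (Ask V3 V5 (Hit (Rep V4 V7) V7 V0 V2 V4 V3 V5 V6 V1)
    (Hit FiveThree V5 V7 V0 V2 V3 V4 V6 V1))) (Hit Halves V0 V4 V1 V3 V5 V6 V7 V2))) (Hit Halves V4
    V6 V1 V3 V5 V7 V0 V2)))) (Hit Halves V0 V2 V4 V3 V5 V6 V1 V7))) (Ask V0 V7 (Ask V3 V7 (Ask V3 V6
    (Ask V3 V5 (Hit Halves V0 V7 V1 V2 V4 V3 V5 V6) (Hit Halves V0 V7 V1 V2 V4 V5 V3 V6)) (Ask V3 V5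
    (Ask V1 V6 (Ask V2 V5 (Ask V2 V6 (Ask V1 V5 (Hit Seven1 V1 V2 V3 V5 V6 V7 V4 V0) (Hit Halves V2
    V4 V6 V3 V5 V0 V7 V1)) (Ask V1 V5 (Ask V0 V6 (Hit Halves V0 V6 V7 V2 V4 V1 V3 V5) (Hit Halves V4
    V1 V3 V5 V6 V0 V7 V2)) (Hit Seven2 V1 V6 V2 V3 V5 V7 V4 V0))) (Hit Halves V4 V1 V6 V3 V5 V0 V7
    V2)) (Ask V2 V5 (Ask V0 V6 (Hit Halves V0 V6 V7 V1 V2 V4 V3 V5) (Hit Halves V2 V4 V3 V5 V6 V0 V7
    V1)) (Hit Halves V4 V6 V1 V3 V5 V0 V7 V2))) (Hit Halves V0 V7 V1 V2 V4 V5 V6 V3))) (Hit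
    FiveThree V0 V7 V1 V2 V3 V4 V5 V6)) (Ask V3 V7 (Ask V3 V6 (Ask V3 V5 (Hit Halves V4 V3 V5 V6 V7
    V0 V1 V2) (Hit Halves V4 V5 V3 V6 V7 V0 V1 V2)) (Ask V3 V5 (Ask V1 V6 (Ask V2 V5 (Ask V1 V5 (Ask
    V2 V6 (Hit Seven1 V1 V2 V3 V5 V6 V7 V4 V0) (Ask V0 V6 (Hit (Rep V4 V5) V0 V1 V6 V2 V3 V5 V7 V4)
    (Hit Halves V4 V1 V3 V5 V6 V7 V0 V2))) (Ask V2 V6 (Hit Halves V2 V4 V6 V3 V5 V7 V0 V1) (Hit
    Seven2 V1 V6 V2 V3 V5 V7 V4 V0))) (Hit Halves V4 V1 V6 V3 V5 V7 V0 V2)) (Ask V2 V5 (Ask V0 V6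
    (Ask V1 V5 (Ask V2 V6 (Hit (Rep V4 V5) V0 V4 V6 V1 V3 V5 V7 V2) (Hit (Rep V4 V4) V0 V6 V1 V2 V3
    V5 V7 V4)) (Hit Halves V0 V2 V4 V3 V5 V6 V7 V1)) (Hit Halves V2 V4 V3 V5 V6 V7 V0 V1)) (Hit
    Halves V4 V6 V1 V3 V5 V7 V0 V2))) (Hit Halves V4 V5 V6 V3 V7 V0 V1 V2))) (Hit FiveThree V7 V0 V1
    V2 V3 V4 V5 V6)))))) (Ask V1 V4 (Ask V3 V4 (Ask V3 V7 (Ask V3 V6 (Ask V3 V5 (Hit Halves V0 V1 V4
    V2 V3 V5 V6 V7) (Hit Halves V0 V1 V4 V2 V5 V3 V6 V7)) (Ask V3 V5 (Ask V2 V6 (Ask V0 V6 (Ask V1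
    V6 (Hit FiveThree V0 V1 V4 V2 V6 V3 V5 V7) (Ask V1 V7 (Ask V2 V5 (Ask V0 V7 (Hit Halves V0 V1 V3
    V7 V4 V2 V5 V6) (Ask V1 V5 (Hit Halves V0 V4 V2 V6 V1 V3 V5 V7) (Hit (Rep V6 V3) V6 V1 V3 V7 V0
    V4 V2 V5))) (Hit Halves V1 V3 V7 V4 V5 V0 V2 V6)) (Ask V2 V5 (Ask V1 V5 (Ask V0 V7 (Hit Halves
    V0 V6 V3 V7 V1 V4 V2 V5) (Hit (Rep V6 V7) V7 V0 V1 V4 V2 V5 V6 V3)) (Hit Seven3 V4 V2 V5 V6 V7
    V1 V3 V0)) (Ask V1 V5 (Ask V0 V7 (Hit Halves V0 V6 V3 V7 V1 V4 V5 V2) (Hit (Rep V1 V3) V7 V0 V1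
    V4 V2 V6 V3 V5)) (Hit Seven2 V7 V1 V4 V2 V6 V3 V5 V0))))) (Ask V2 V5 (Ask V0 V7 (Ask V1 V7 (Hit
    Halves V0 V1 V3 V7 V4 V2 V5 V6) (Ask V1 V5 (Hit Halves V1 V4 V2 V5 V6 V0 V3 V7) (Ask V1 V6 (Hit
    (Rep V6 V2) V0 V7 V1 V4 V2 V5 V6 V3) (Hit Seven3 V4 V2 V5 V6 V7 V1 V3 V0)))) (Hit Seven3 V4 V2
    V5 V6 V7 V0 V3 V1)) (Ask V0 V7 (Ask V1 V7 (Hit Halves V0 V1 V3 V7 V4 V5 V2 V6) (Ask V1 V5 (Hit
    Halves V1 V4 V5 V2 V6 V0 V3 V7) (Ask V1 V6 (Hit Halves V0 V3 V7 V4 V5 V1 V2 V6) (Hit Seven2 V7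
    V1 V4 V2 V6 V3 V5 V0)))) (Hit Seven2 V7 V0 V4 V2 V6 V3 V5 V1)))) (Ask V2 V5 (Ask V0 V6 (Ask V1
    V6 (Hit FiveThree V0 V1 V4 V6 V2 V3 V5 V7) (Ask V1 V7 (Ask V0 V7 (Hit FiveThree V0 V6 V1 V3 V7
    V4 V2 V5) (Ask V1 V5 (Hit Halves V0 V4 V6 V2 V1 V3 V5 V7) (Hit (Rep V4 V1) V0 V6 V1 V2 V3 V5 V7
    V4))) (Ask V0 V7 (Hit FiveThree V0 V6 V7 V1 V2 V3 V4 V5) (Ask V1 V5 (Hit (Rep V3 V1) V7 V0 V1 V4
    V2 V3 V5 V6) (Hit (Rep V3 V7) V7 V0 V1 V4 V2 V3 V5 V6))))) (Ask V0 V7 (Ask V1 V5 (Hit Halves V1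
    V3 V4 V5 V6 V0 V7 V2) (Ask V1 V7 (Ask V1 V6 (Hit (Rep V0 V0) V0 V1 V7 V4 V2 V3 V5 V6) (Hit
    FiveThree V6 V0 V1 V3 V7 V4 V2 V5)) (Ask V1 V6 (Hit (Rep V2 V6) V0 V7 V1 V4 V2 V3 V5 V6) (Hit
    FiveThree V6 V0 V7 V1 V2 V3 V4 V5)))) (Ask V1 V5 (Hit Halves V1 V3 V4 V5 V6 V7 V0 V2) (Ask V1 V6
    (Ask V1 V7 (Hit (Rep V3 V2) V1 V4 V6 V2 V3 V5 V7 V0) (Hit (Rep V5 V7) V7 V0 V1 V4 V2 V3 V5 V6))
    (Ask V1 V7 (Hit (Rep V3 V6) V6 V0 V1 V2 V3 V5 V7 V4) (Hit FiveThree V6 V7 V0 V1 V2 V3 V4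
    V5)))))) (Hit Halves V0 V1 V3 V4 V5 V6 V7 V2))) (Hit Halves V0 V1 V4 V2 V5 V6 V3 V7))) (Ask V1
    V7 (Ask V0 V7 (Hit FiveThree V0 V1 V7 V2 V3 V4 V5 V6) (Ask V2 V6 (Ask V1 V6 (Ask V1 V5 (Hit
    Halves V1 V4 V5 V6 V7 V0 V2 V3) (Ask V2 V5 (Ask V3 V5 (Hit Seven1 V0 V1 V2 V3 V4 V5 V7 V6) (Hit
    Halves V1 V4 V2 V6 V5 V7 V0 V3)) (Hit Halves V5 V1 V2 V6 V7 V0 V3 V4))) (Ask V0 V6 (Ask V2 V5
    (Ask V3 V5 (Ask V1 V5 (Ask V3 V6 (Hit (Rep V0 V6) V0 V1 V2 V3 V4 V5 V6 V7) (Hit (Rep V0 V3) V0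
    V1 V2 V3 V4 V5 V6 V7)) (Hit Seven1 V0 V1 V2 V3 V4 V5 V7 V6)) (Ask V3 V6 (Hit Halves V1 V7 V4 V2
    V5 V0 V3 V6) (Hit Halves V0 V1 V4 V2 V5 V6 V7 V3))) (Hit Halves V1 V7 V3 V4 V5 V0 V2 V6)) (Ask
    V3 V6 (Hit Seven1 V0 V1 V2 V3 V4 V6 V7 V5) (Ask V3 V5 (Ask V2 V5 (Ask V1 V5 (Hit Halves V1 V4 V2
    V5 V6 V7 V0 V3) (Hit Seven1 V0 V1 V2 V3 V4 V5 V7 V6)) (Ask V1 V5 (Hit Halves V1 V4 V5 V2 V6 V7
    V0 V3) (Hit (Rep V0 V5) V0 V1 V2 V3 V4 V5 V6 V7))) (Hit Halves V0 V1 V4 V2 V5 V6 V7 V3))))) (Ask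
    V2 V5 (Ask V3 V5 (Ask V1 V5 (Ask V0 V6 (Ask V1 V6 (Hit Halves V1 V4 V5 V6 V7 V0 V2 V3) (Ask V3
    V6 (Hit (Rep V0 V3) V0 V1 V4 V2 V3 V5 V6 V7) (Hit (Rep V0 V1) V6 V1 V7 V2 V3 V4 V5 V0))) (Hit
    Halves V1 V3 V4 V5 V6 V7 V0 V2)) (Hit Seven1 V0 V1 V2 V3 V4 V5 V7 V6)) (Ask V3 V6 (Ask V0 V6
    (Hit Halves V1 V7 V4 V2 V5 V0 V3 V6) (Ask V1 V6 (Hit Halves V1 V4 V6 V2 V5 V7 V0 V3) (Ask V1 V5
    (Hit (Rep V0 V2) V1 V7 V2 V3 V4 V5 V6 V0) (Hit (Rep V0 V4) V0 V1 V2 V3 V4 V5 V6 V7)))) (Hit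
    Halves V0 V1 V4 V2 V5 V6 V7 V3))) (Hit Halves V0 V1 V3 V4 V5 V6 V7 V2)))) (Ask V0 V7 (Hit
    FiveThree V0 V7 V1 V2 V3 V4 V5 V6) (Hit FiveThree V7 V0 V1 V2 V3 V4 V5 V6)))) (Hit FiveThree V0
    V1 V4 V2 V3 V5 V6 V7)) (Ask V3 V4 (Ask V3 V7 (Ask V3 V5 (Ask V3 V6 (Hit Halves V0 V4 V1 V2 V3 V5
    V6 V7) (Ask V2 V6 (Ask V0 V6 (Ask V1 V6 (Hit FiveThree V0 V4 V1 V2 V6 V3 V5 V7) (Ask V1 V5 (Ask
    V1 V7 (Hit Halves V0 V4 V2 V6 V1 V3 V5 V7) (Ask V0 V7 (Ask V2 V5 (Hit Halves V0 V6 V3 V7 V4 V1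
    V2 V5) (Hit Halves V0 V6 V3 V7 V4 V1 V5 V2)) (Ask V2 V5 (Hit (Rep V7 V2) V7 V0 V4 V1 V2 V3 V5
    V6) (Hit (Rep V1 V5) V7 V0 V4 V1 V2 V6 V3 V5)))) (Ask V2 V5 (Ask V1 V7 (Ask V0 V7 (Hit Halves V0
    V1 V3 V7 V4 V2 V5 V6) (Hit (Rep V6 V5) V6 V1 V3 V7 V0 V4 V2 V5)) (Hit Seven2 V5 V6 V7 V1 V2 V3
    V4 V0)) (Ask V0 V7 (Hit Halves V0 V6 V3 V7 V4 V5 V1 V2) (Ask V1 V7 (Hit (Rep V0 V3) V5 V0 V1 V2
    V6 V3 V7 V4) (Hit (Rep V0 V1) V7 V0 V4 V1 V2 V6 V3 V5)))))) (Ask V2 V5 (Ask V0 V7 (Ask V1 V5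
    (Hit Halves V4 V1 V2 V5 V6 V0 V3 V7) (Ask V1 V7 (Hit Halves V0 V1 V3 V7 V4 V2 V5 V6) (Ask V1 V6
    (Hit (Rep V6 V0) V0 V7 V4 V1 V2 V6 V3 V5) (Hit Seven2 V5 V6 V7 V1 V2 V3 V4 V0)))) (Hit Seven3 V4
    V2 V5 V6 V7 V0 V3 V1)) (Ask V0 V7 (Ask V1 V5 (Hit Halves V4 V1 V5 V2 V6 V0 V3 V7) (Hit Halves V4
    V5 V1 V2 V6 V0 V3 V7)) (Hit Seven2 V7 V0 V4 V2 V6 V3 V5 V1)))) (Ask V1 V6 (Ask V0 V6 (Hit
    FiveThree V0 V4 V1 V6 V2 V3 V5 V7) (Ask V1 V5 (Ask V0 V7 (Ask V2 V5 (Hit Halves V4 V1 V2 V5 V6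
    V0 V3 V7) (Hit Halves V0 V3 V7 V4 V1 V5 V6 V2)) (Ask V1 V7 (Ask V2 V5 (Hit (Rep V1 V0) V4 V1 V6
    V2 V3 V5 V7 V0) (Hit FiveThree V1 V5 V6 V7 V2 V0 V3 V4)) (Hit Seven3 V4 V1 V5 V6 V7 V0 V3 V2)))
    (Ask V0 V7 (Ask V2 V5 (Ask V1 V7 (Hit (Rep V0 V2) V0 V1 V7 V2 V3 V4 V5 V6) (Hit (Rep V2 V1) V0
    V7 V4 V1 V2 V3 V5 V6)) (Hit Halves V0 V3 V7 V4 V5 V1 V6 V2)) (Ask V1 V7 (Ask V2 V5 (Hit (Rep V5
    V1) V4 V1 V6 V2 V3 V5 V7 V0) (Hit FiveThree V5 V1 V6 V7 V2 V0 V3 V4)) (Hit Seven2 V7 V0 V4 V1 V6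
    V3 V5 V2))))) (Ask V0 V6 (Hit FiveThree V0 V4 V6 V1 V2 V3 V5 V7) (Ask V1 V7 (Ask V0 V7 (Hit
    FiveThree V6 V0 V1 V7 V2 V3 V4 V5) (Ask V1 V5 (Hit Seven2 V1 V3 V5 V7 V0 V4 V6 V2) (Ask V2 V5
    (Hit (Rep V2 V4) V6 V0 V1 V2 V3 V5 V7 V4) (Hit FiveThree V5 V6 V0 V1 V2 V3 V7 V4)))) (Ask V0 V7
    (Hit FiveThree V6 V0 V7 V1 V2 V3 V4 V5) (Hit FiveThree V6 V7 V0 V1 V2 V3 V4 V5))))))) (Ask V3 V6
    (Hit Halves V0 V4 V1 V2 V5 V3 V6 V7) (Hit Halves V0 V4 V1 V2 V5 V6 V3 V7))) (Ask V0 V7 (Ask V1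
    V7 (Hit FiveThree V0 V1 V7 V2 V3 V4 V5 V6) (Hit FiveThree V0 V7 V1 V2 V3 V4 V5 V6)) (Ask V1 V7
    (Ask V1 V5 (Ask V1 V6 (Hit Halves V4 V1 V5 V6 V7 V0 V2 V3) (Ask V3 V5 (Ask V3 V6 (Ask V0 V6 (Ask
    V2 V5 (Ask V2 V6 (Hit (Rep V3 V0) V0 V1 V2 V3 V4 V5 V6 V7) (Hit (Rep V1 V4) V0 V4 V6 V1 V2 V3 V5
    V7)) (Hit Halves V0 V3 V4 V6 V1 V5 V7 V2)) (Hit Seven3 V3 V4 V5 V6 V7 V0 V1 V2)) (Ask V0 V6 (Hit
    Seven2 V6 V1 V7 V3 V4 V5 V0 V2) (Ask V2 V5 (Hit Halves V4 V1 V2 V5 V6 V7 V0 V3) (Hit Halves V4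
    V1 V5 V2 V6 V7 V0 V3)))) (Ask V2 V6 (Ask V0 V6 (Hit Halves V0 V4 V2 V6 V1 V5 V7 V3) (Ask V3 V6
    (Ask V2 V5 (Hit (Rep V5 V0) V1 V7 V2 V3 V4 V5 V6 V0) (Hit FiveThree V5 V7 V0 V2 V3 V4 V6 V1))
    (Hit Halves V0 V4 V1 V2 V5 V6 V7 V3))) (Hit Halves V4 V6 V1 V2 V5 V7 V0 V3)))) (Ask V1 V6 (Hit
    Halves V4 V5 V1 V6 V7 V0 V2 V3) (Hit Halves V4 V5 V6 V1 V7 V0 V2 V3))) (Hit FiveThree V7 V0 V1
    V2 V3 V4 V5 V6)))) (Hit FiveThree V0 V4 V1 V2 V3 V5 V6 V7)))"]) (simp only: resolved decision_simps)


lemma resolves_S16 [resolved]: "resolves S16"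
  by (rule resolvesI[where T = "
    Ask V2 V7 (Ask V1 V4 (Ask V3 V4 (Ask V2 V5 (Ask V2 V6 (Hit Halves V0 V1 V3 V4 V2 V5 V6 V7) (Ask
    V3 V7 (Ask V3 V6 (Ask V3 V5 (Hit Halves V0 V1 V4 V2 V3 V5 V6 V7) (Hit Halves V0 V1 V4 V2 V5 V3
    V6 V7)) (Ask V3 V5 (Ask V0 V6 (Ask V1 V6 (Hit Halves V0 V1 V4 V6 V2 V3 V5 V7) (Ask V1 V5 (Ask V0
    V7 (Hit Halves V0 V6 V2 V7 V1 V3 V4 V5) (Ask V1 V7 (Hit Halves V0 V4 V6 V2 V1 V3 V5 V7) (Hit
    (Rep V7 V3) V0 V6 V1 V2 V3 V5 V7 V4))) (Ask V1 V7 (Ask V0 V7 (Hit FiveThree V0 V1 V2 V3 V7 V4 V5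
    V6) (Hit (Rep V4 V3) V6 V1 V2 V3 V7 V0 V4 V5)) (Hit Seven2 V2 V3 V5 V7 V1 V4 V6 V0)))) (Ask V0
    V7 (Ask V1 V5 (Hit Halves V1 V3 V4 V5 V6 V0 V2 V7) (Ask V1 V7 (Hit FiveThree V0 V1 V2 V3 V7 V4
    V5 V6) (Ask V1 V6 (Hit (Rep V2 V0) V6 V0 V2 V3 V7 V1 V4 V5) (Hit Seven2 V2 V3 V5 V7 V1 V4 V6
    V0)))) (Hit Seven2 V2 V3 V5 V7 V0 V4 V6 V1))) (Hit Halves V0 V1 V4 V2 V5 V6 V3 V7))) (Ask V3 V6
    (Ask V3 V5 (Hit S17 V0 V1 V4 V2 V3 V5 V6 V7) (Ask V0 V7 (Ask V1 V7 (Hit FiveThree V0 V1 V2 V7 V3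
    V4 V5 V6) (Ask V1 V6 (Hit Halves V1 V4 V6 V2 V5 V0 V7 V3) (Hit S17 V0 V7 V1 V4 V2 V5 V3 V6)))
    (Ask V1 V6 (Hit Halves V1 V4 V6 V2 V5 V7 V0 V3) (Ask V1 V5 (Ask V1 V7 (Ask V0 V6 (Hit Halves V0
    V3 V4 V6 V1 V2 V5 V7) (Hit S17 V1 V7 V3 V4 V5 V6 V0 V2)) (Hit Seven2 V2 V5 V7 V3 V4 V6 V1 V0))
    (Ask V1 V7 (Ask V0 V6 (Hit Halves V0 V4 V6 V2 V5 V1 V7 V3) (Hit (Rep V3 V3) V5 V0 V1 V3 V4 V6 V2
    V7)) (Hit FiveThree V5 V7 V0 V1 V3 V4 V6 V2)))))) (Ask V3 V5 (Ask V0 V7 (Ask V0 V6 (Ask V1 V5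
    (Hit Halves V0 V6 V2 V7 V1 V3 V4 V5) (Ask V1 V7 (Hit FiveThree V0 V1 V2 V7 V3 V4 V5 V6) (Ask V1
    V6 (Hit Seven2 V6 V2 V7 V3 V4 V5 V1 V0) (Hit FiveThree V0 V6 V7 V1 V3 V4 V2 V5)))) (Ask V1 V5
    (Hit Halves V1 V3 V4 V5 V6 V0 V2 V7) (Ask V1 V7 (Hit FiveThree V0 V1 V2 V7 V3 V4 V5 V6) (Ask V1
    V6 (Hit Seven2 V6 V2 V7 V3 V4 V5 V1 V0) (Hit FiveThree V6 V0 V7 V1 V3 V4 V2 V5))))) (Ask V0 V6
    (Hit Seven2 V6 V2 V7 V3 V4 V5 V0 V1) (Ask V1 V5 (Hit Halves V1 V4 V2 V5 V6 V7 V0 V3) (Ask V1 V6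
    (Ask V1 V7 (Hit (Rep V4 V0) V1 V6 V2 V7 V3 V4 V5 V0) (Hit Seven2 V6 V2 V7 V3 V4 V5 V1 V0)) (Hit
    S17 V6 V7 V0 V3 V1 V4 V2 V5))))) (Hit Halves V0 V1 V4 V2 V5 V6 V7 V3))))) (Ask V2 V6 (Hit Halves
    V0 V1 V3 V4 V5 V2 V6 V7) (Hit Halves V0 V1 V3 V4 V5 V6 V2 V7))) (Hit FiveThree V0 V1 V4 V2 V3 V5
    V6 V7)) (Ask V3 V4 (Ask V3 V7 (Ask V3 V5 (Ask V3 V6 (Hit Halves V0 V4 V1 V2 V3 V5 V6 V7) (Ask V2
    V5 (Ask V1 V6 (Ask V0 V6 (Hit Halves V0 V4 V1 V6 V2 V3 V5 V7) (Ask V0 V7 (Ask V1 V5 (Hit Halves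
    V0 V2 V3 V7 V4 V1 V5 V6) (Hit Halves V0 V2 V3 V7 V4 V5 V1 V6)) (Ask V2 V6 (Ask V1 V7 (Ask V1 V5
    (Hit FiveThree V1 V2 V5 V6 V7 V0 V3 V4) (Hit (Rep V6 V1) V1 V2 V6 V3 V7 V0 V4 V5)) (Ask V1 V5
    (Hit Seven3 V4 V1 V5 V6 V7 V0 V3 V2) (Hit Seven2 V7 V0 V4 V1 V6 V3 V5 V2))) (Hit Seven2 V2 V3 V5
    V7 V0 V4 V6 V1)))) (Ask V0 V6 (Hit Halves V0 V4 V6 V1 V2 V3 V5 V7) (Ask V0 V7 (Ask V1 V5 (Hit
    Halves V4 V1 V2 V5 V6 V0 V3 V7) (Hit Halves V0 V2 V3 V7 V4 V5 V6 V1)) (Ask V2 V6 (Ask V1 V7 (Ask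
    V1 V5 (Hit Seven2 V1 V3 V5 V7 V0 V4 V6 V2) (Hit (Rep V5 V3) V6 V1 V3 V7 V0 V4 V2 V5)) (Ask V1 V5
    (Hit (Rep V7 V6) V1 V2 V3 V5 V6 V7 V0 V4) (Hit (Rep V4 V6) V5 V6 V7 V0 V1 V2 V3 V4))) (Hit
    Seven2 V2 V3 V5 V7 V0 V4 V6 V1))))) (Ask V1 V5 (Ask V0 V6 (Ask V2 V6 (Ask V1 V6 (Hit FiveThree
    V0 V4 V1 V2 V6 V3 V5 V7) (Ask V1 V7 (Hit Halves V0 V4 V2 V6 V1 V3 V5 V7) (Hit S17 V0 V6 V1 V3 V4
    V5 V2 V7))) (Ask V1 V6 (Hit FiveThree V0 V4 V1 V6 V2 V3 V5 V7) (Hit FiveThree V0 V4 V6 V1 V2 V3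
    V5 V7))) (Ask V0 V7 (Hit Halves V4 V1 V5 V2 V6 V0 V3 V7) (Ask V1 V7 (Ask V1 V6 (Hit S17 V1 V5 V2
    V7 V6 V0 V3 V4) (Hit Seven2 V1 V3 V5 V7 V0 V4 V6 V2)) (Ask V1 V6 (Hit Seven3 V4 V1 V5 V6 V7 V0
    V3 V2) (Ask V2 V6 (Hit (Rep V7 V4) V2 V6 V3 V7 V0 V4 V1 V5) (Hit S17 V6 V0 V2 V3 V7 V4 V1
    V5)))))) (Hit S17 V5 V0 V1 V2 V6 V3 V7 V4)))) (Ask V3 V6 (Hit Halves V0 V4 V1 V2 V5 V3 V6 V7)
    (Hit Halves V0 V4 V1 V2 V5 V6 V3 V7))) (Ask V0 V7 (Ask V1 V7 (Hit FiveThree V0 V1 V2 V7 V3 V4 V5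
    V6) (Ask V2 V6 (Ask V2 V5 (Hit Halves V0 V7 V1 V3 V4 V2 V5 V6) (Hit Halves V0 V7 V1 V3 V4 V5 V2
    V6)) (Ask V2 V5 (Ask V1 V6 (Ask V1 V5 (Hit Halves V0 V2 V7 V3 V4 V1 V5 V6) (Hit Halves V0 V2 V7
    V3 V4 V5 V1 V6)) (Ask V3 V5 (Ask V3 V6 (Hit S17 V0 V4 V1 V2 V3 V5 V6 V7) (Ask V0 V6 (Hit
    FiveThree V0 V6 V7 V1 V3 V4 V2 V5) (Hit FiveThree V6 V0 V7 V1 V3 V4 V2 V5))) (Hit Halves V4 V6
    V1 V2 V5 V0 V7 V3))) (Hit Halves V0 V7 V1 V3 V4 V5 V6 V2)))) (Ask V3 V5 (Ask V1 V7 (Ask V1 V5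
    (Ask V2 V5 (Ask V3 V6 (Ask V2 V6 (Hit S17 V2 V3 V5 V6 V7 V0 V4 V1) (Ask V0 V6 (Hit Halves V0 V3
    V4 V6 V1 V2 V5 V7) (Hit Seven3 V3 V4 V5 V6 V7 V0 V2 V1))) (Ask V0 V6 (Hit S17 V1 V2 V3 V5 V7 V0
    V4 V6) (Hit Halves V4 V1 V2 V5 V6 V7 V0 V3))) (Ask V2 V6 (Ask V1 V6 (Hit Halves V1 V5 V2 V6 V7
    V0 V3 V4) (Ask V3 V6 (Ask V0 V6 (Hit Halves V0 V3 V4 V6 V1 V5 V2 V7) (Hit Seven2 V1 V2 V7 V3 V4
    V6 V0 V5)) (Ask V0 V6 (Hit Seven2 V6 V1 V7 V3 V4 V5 V0 V2) (Hit Halves V4 V1 V5 V2 V6 V7 V0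
    V3)))) (Ask V1 V6 (Hit Halves V1 V5 V6 V2 V7 V0 V3 V4) (Ask V3 V6 (Ask V0 V6 (Hit Halves V0 V3
    V4 V6 V1 V5 V2 V7) (Hit Seven3 V3 V4 V5 V6 V7 V0 V1 V2)) (Ask V0 V6 (Hit Seven2 V6 V1 V7 V3 V4
    V5 V0 V2) (Hit Halves V4 V1 V5 V2 V6 V7 V0 V3)))))) (Ask V2 V5 (Hit Seven2 V1 V2 V7 V3 V4 V5 V0
    V6) (Ask V1 V6 (Ask V2 V6 (Hit Halves V5 V1 V2 V6 V7 V0 V3 V4) (Hit Halves V5 V1 V6 V2 V7 V0 V3
    V4)) (Ask V2 V6 (Ask V3 V6 (Hit S17 V5 V0 V1 V2 V7 V3 V4 V6) (Ask V0 V6 (Hit (Rep V0 V7) V0 V1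
    V2 V3 V4 V5 V6 V7) (Hit Halves V4 V5 V1 V2 V6 V7 V0 V3))) (Hit Halves V5 V6 V1 V2 V7 V0 V3
    V4))))) (Ask V3 V6 (Hit S17 V0 V4 V1 V2 V3 V5 V6 V7) (Ask V2 V5 (Ask V2 V6 (Hit Halves V4 V2 V5
    V6 V7 V0 V1 V3) (Ask V0 V6 (Hit Seven2 V6 V2 V7 V3 V4 V5 V0 V1) (Ask V1 V5 (Hit Halves V4 V1 V2
    V5 V6 V7 V0 V3) (Ask V1 V6 (Hit (Rep V5 V3) V0 V1 V2 V3 V4 V5 V6 V7) (Hit FiveThree V6 V7 V0 V1
    V3 V4 V2 V5))))) (Ask V2 V6 (Hit Halves V4 V5 V2 V6 V7 V0 V1 V3) (Hit Halves V4 V5 V6 V2 V7 V0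
    V1 V3))))) (Ask V3 V6 (Ask V2 V6 (Ask V1 V6 (Hit Halves V4 V1 V2 V6 V5 V7 V0 V3) (Ask V2 V5 (Ask
    V1 V7 (Hit S17 V2 V5 V3 V6 V7 V0 V4 V1) (Hit Halves V2 V5 V3 V6 V7 V0 V4 V1)) (Ask V1 V7 (Ask V0
    V6 (Hit Halves V0 V4 V6 V1 V5 V2 V7 V3) (Hit Seven2 V1 V2 V7 V3 V4 V6 V0 V5)) (Hit Halves V4 V5
    V2 V6 V7 V0 V1 V3)))) (Ask V1 V6 (Hit Halves V4 V1 V6 V2 V5 V7 V0 V3) (Hit Halves V4 V6 V1 V2 V5
    V7 V0 V3))) (Hit Halves V0 V4 V1 V2 V5 V6 V7 V3))))) (Hit FiveThree V0 V4 V1 V2 V3 V5 V6 V7)))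
    (Hit S17 V0 V1 V2 V3 V4 V5 V6 V7)"]) (simp only: resolved decision_simps)


lemma resolves_S15 [resolved]: "resolves S15"
  by (rule resolvesI[where T = "
    Ask V2 V4 (Ask V2 V7 (Ask V3 V4 (Ask V1 V4 (Hit FiveThree V0 V1 V2 V3 V4 V5 V6 V7) (Ask V1 V6
    (Ask V1 V5 (Ask V1 V7 (Hit Halves V0 V2 V3 V4 V1 V5 V6 V7) (Hit S16 V0 V2 V3 V4 V1 V5 V6 V7))
    (Ask V3 V7 (Ask V0 V7 (Hit Halves V0 V2 V3 V7 V4 V5 V1 V6) (Ask V0 V6 (Hit Halves V2 V3 V7 V4 V5
    V0 V1 V6) (Ask V1 V7 (Hit Halves V0 V2 V3 V4 V5 V1 V6 V7) (Ask V3 V6 (Ask V2 V6 (Hit Halves V2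
    V3 V4 V6 V5 V7 V0 V1) (Hit Seven2 V2 V3 V7 V4 V1 V6 V0 V5)) (Ask V3 V5 (Hit Seven2 V7 V0 V4 V1
    V6 V3 V5 V2) (Ask V2 V5 (Ask V2 V6 (Hit Halves V2 V5 V6 V3 V7 V0 V4 V1) (Hit Seven2 V7 V0 V4 V1
    V6 V2 V5 V3)) (Hit S16 V5 V2 V3 V7 V0 V4 V1 V6))))))) (Ask V0 V7 (Hit Halves V0 V2 V7 V3 V4 V5
    V1 V6) (Ask V1 V7 (Hit Halves V0 V2 V3 V4 V5 V1 V6 V7) (Ask V2 V6 (Ask V2 V5 (Hit Halves V2 V4
    V5 V6 V7 V0 V1 V3) (Hit Halves V5 V1 V2 V6 V7 V0 V3 V4)) (Ask V2 V5 (Ask V0 V6 (Hit Halves V2 V7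
    V3 V4 V5 V0 V1 V6) (Hit Seven2 V7 V0 V4 V1 V6 V2 V5 V3)) (Hit Halves V5 V1 V6 V2 V7 V0 V3
    V4))))))) (Ask V3 V7 (Ask V1 V5 (Ask V2 V5 (Ask V0 V6 (Hit S16 V2 V3 V7 V4 V5 V0 V6 V1) (Ask V2
    V6 (Ask V3 V6 (Ask V3 V5 (Hit FiveThree V2 V3 V5 V6 V7 V0 V4 V1) (Hit FiveThree V2 V5 V3 V6 V7
    V0 V4 V1)) (Ask V1 V7 (Hit S16 V6 V1 V3 V7 V0 V2 V4 V5) (Ask V3 V5 (Ask V0 V7 (Hit Halves V2 V3
    V4 V5 V6 V0 V7 V1) (Hit Halves V2 V3 V4 V5 V6 V7 V0 V1)) (Hit FiveThree V2 V5 V6 V3 V7 V0 V4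
    V1)))) (Hit S16 V2 V3 V7 V4 V5 V6 V0 V1))) (Ask V0 V7 (Ask V2 V6 (Hit S17 V0 V3 V7 V4 V1 V5 V2
    V6) (Ask V3 V6 (Ask V3 V5 (Ask V1 V7 (Hit Halves V0 V1 V2 V7 V3 V4 V5 V6) (Hit Seven2 V5 V6 V2
    V7 V4 V1 V3 V0)) (Hit FiveThree V5 V0 V2 V3 V7 V4 V6 V1)) (Ask V0 V6 (Hit FiveThree V0 V6 V2 V3
    V7 V4 V1 V5) (Hit FiveThree V6 V0 V2 V3 V7 V4 V1 V5)))) (Ask V3 V5 (Ask V1 V7 (Ask V0 V6 (Ask V2
    V6 (Hit Halves V0 V2 V4 V6 V1 V3 V5 V7) (Ask V3 V6 (Hit Halves V0 V3 V4 V6 V1 V5 V2 V7) (Hit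
    (Rep V4 V2) V6 V1 V2 V3 V7 V0 V4 V5))) (Ask V3 V6 (Ask V2 V6 (Hit (Rep V5 V2) V2 V3 V6 V7 V0 V4
    V1 V5) (Hit S16 V6 V1 V2 V7 V0 V3 V4 V5)) (Hit Seven2 V1 V3 V5 V7 V0 V4 V6 V2))) (Hit Seven2 V2
    V3 V7 V4 V1 V5 V0 V6)) (Ask V0 V6 (Hit Halves V0 V4 V6 V1 V5 V2 V3 V7) (Ask V2 V6 (Ask V3 V6
    (Hit FiveThree V5 V2 V3 V6 V7 V0 V4 V1) (Hit FiveThree V5 V2 V6 V3 V7 V0 V4 V1)) (Ask V3 V6 (Ask
    V1 V7 (Hit (Rep V3 V4) V1 V5 V2 V3 V7 V0 V4 V6) (Hit (Rep V7 V0) V5 V6 V0 V2 V3 V7 V4 V1)) (Hit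
    FiveThree V5 V6 V2 V3 V7 V0 V4 V1))))))) (Ask V0 V6 (Hit Halves V2 V3 V7 V4 V5 V0 V6 V1) (Hit
    Halves V2 V3 V7 V4 V5 V6 V0 V1))) (Ask V1 V7 (Ask V1 V5 (Ask V0 V7 (Hit FiveThree V0 V1 V2 V7 V3
    V4 V5 V6) (Ask V0 V6 (Ask V2 V5 (Hit S17 V2 V7 V3 V4 V5 V0 V6 V1) (Ask V3 V5 (Ask V3 V6 (Hit
    Halves V0 V3 V4 V6 V1 V5 V2 V7) (Hit Seven2 V6 V1 V7 V3 V4 V5 V0 V2)) (Hit Halves V0 V4 V6 V1 V5
    V2 V7 V3))) (Ask V3 V6 (Ask V3 V5 (Hit Seven3 V3 V4 V5 V6 V7 V0 V1 V2) (Ask V2 V6 (Ask V2 V5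
    (Hit S16 V2 V5 V3 V6 V7 V0 V4 V1) (Hit (Rep V2 V3) V1 V5 V2 V7 V3 V4 V6 V0)) (Ask V2 V5 (Hit
    Seven2 V1 V2 V5 V7 V0 V4 V6 V3) (Hit (Rep V3 V5) V1 V5 V2 V7 V3 V4 V6 V0)))) (Ask V2 V6 (Ask V2
    V5 (Hit S17 V6 V1 V7 V3 V0 V2 V4 V5) (Ask V3 V5 (Hit (Rep V5 V4) V1 V2 V7 V3 V4 V5 V6 V0) (Hit
    FiveThree V5 V2 V6 V7 V3 V0 V4 V1))) (Hit S17 V6 V2 V7 V3 V0 V4 V1 V5))))) (Hit Halves V0 V2 V3
    V4 V5 V6 V1 V7)) (Ask V1 V5 (Ask V2 V5 (Ask V0 V6 (Hit S17 V2 V7 V3 V4 V5 V0 V6 V1) (Ask V2 V6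
    (Ask V0 V7 (Hit Halves V0 V7 V1 V3 V2 V4 V5 V6) (Hit Halves V2 V4 V5 V6 V7 V0 V1 V3)) (Hit S17
    V2 V7 V3 V4 V5 V6 V0 V1))) (Ask V2 V6 (Ask V0 V7 (Hit S16 V0 V7 V3 V4 V1 V5 V2 V6) (Hit S16 V7
    V0 V3 V4 V1 V5 V2 V6)) (Ask V0 V7 (Hit S16 V0 V7 V1 V3 V4 V5 V6 V2) (Hit S16 V7 V0 V1 V3 V4 V5
    V6 V2)))) (Hit Halves V0 V2 V3 V4 V5 V6 V7 V1)))))) (Ask V1 V4 (Hit FiveThree V0 V1 V2 V4 V3 V5
    V6 V7) (Ask V2 V6 (Ask V2 V5 (Hit Halves V0 V4 V1 V3 V2 V5 V6 V7) (Hit Halves V0 V4 V1 V3 V5 V2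
    V6 V7)) (Ask V2 V5 (Ask V1 V6 (Ask V1 V5 (Ask V1 V7 (Hit Halves V0 V2 V4 V3 V1 V5 V6 V7) (Hit
    S17 V0 V2 V4 V3 V1 V5 V6 V7)) (Ask V3 V7 (Ask V3 V5 (Ask V0 V6 (Hit Halves V0 V4 V1 V6 V2 V3 V5
    V7) (Ask V0 V7 (Hit Halves V0 V2 V3 V7 V4 V5 V1 V6) (Ask V1 V7 (Hit Halves V0 V2 V4 V3 V5 V1 V6
    V7) (Hit Seven2 V7 V0 V4 V1 V6 V2 V5 V3)))) (Hit S17 V5 V0 V1 V3 V6 V2 V7 V4)) (Ask V0 V7 (Hit
    Halves V0 V2 V7 V3 V4 V5 V1 V6) (Ask V0 V6 (Hit Halves V2 V7 V4 V3 V5 V0 V1 V6) (Ask V1 V7 (Hit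
    Halves V0 V2 V4 V3 V5 V1 V6 V7) (Hit Seven2 V7 V0 V4 V1 V6 V2 V5 V3)))))) (Ask V1 V7 (Ask V1 V5
    (Ask V0 V6 (Ask V3 V6 (Hit Halves V0 V4 V3 V6 V1 V2 V5 V7) (Hit Halves V0 V4 V6 V3 V1 V2 V5 V7))
    (Ask V0 V7 (Ask V3 V5 (Hit Halves V2 V4 V3 V5 V6 V0 V1 V7) (Hit Halves V2 V4 V5 V3 V6 V0 V1 V7))
    (Hit Seven2 V1 V2 V5 V7 V0 V4 V6 V3))) (Hit Halves V0 V2 V4 V3 V5 V6 V1 V7)) (Ask V0 V6 (Ask V3
    V5 (Ask V1 V5 (Ask V0 V7 (Hit Halves V0 V6 V2 V7 V4 V1 V3 V5) (Ask V3 V7 (Hit Halves V0 V4 V6 V1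
    V2 V3 V5 V7) (Ask V3 V6 (Hit (Rep V2 V3) V7 V0 V4 V1 V3 V5 V6 V2) (Hit FiveThree V0 V4 V6 V1 V3
    V2 V5 V7)))) (Hit Halves V0 V2 V4 V3 V5 V6 V7 V1)) (Ask V3 V7 (Hit Halves V0 V4 V6 V1 V2 V5 V3
    V7) (Hit Halves V0 V4 V6 V1 V2 V5 V7 V3))) (Ask V3 V5 (Ask V0 V7 (Hit Halves V2 V4 V3 V5 V6 V0
    V7 V1) (Hit Halves V2 V4 V3 V5 V6 V7 V0 V1)) (Ask V1 V5 (Ask V0 V7 (Hit Halves V2 V4 V5 V3 V6 V0
    V7 V1) (Hit Halves V2 V4 V5 V3 V6 V7 V0 V1)) (Hit Halves V0 V2 V4 V3 V5 V6 V7 V1)))))) (Hit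
    Halves V0 V4 V1 V3 V5 V6 V2 V7))))) (Hit S17 V0 V1 V2 V3 V4 V5 V6 V7)) (Hit S16 V0 V1 V2 V3 V4
    V5 V6 V7)"]) (simp only: resolved decision_simps)


lemma resolves_S14 [resolved]: "resolves S14"
  by (rule resolvesI[where T = "
    Ask V0 V5 (Ask V1 V4 (Ask V3 V4 (Ask V3 V7 (Ask V3 V5 (Ask V3 V6 (Hit Halves V0 V1 V4 V2 V3 V5
    V6 V7) (Ask V2 V5 (Ask V1 V5 (Hit FiveThree V0 V1 V4 V2 V5 V6 V3 V7) (Ask V1 V6 (Ask V1 V7 (Hit
    Halves V0 V4 V2 V5 V1 V6 V3 V7) (Ask V0 V6 (Ask V2 V6 (Hit FiveThree V0 V1 V4 V2 V6 V3 V5 V7)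
    (Hit FiveThree V0 V1 V4 V6 V2 V3 V5 V7)) (Hit S15 V0 V4 V2 V5 V1 V6 V3 V7))) (Ask V1 V7 (Hit
    Halves V0 V4 V2 V5 V6 V1 V3 V7) (Ask V2 V7 (Ask V2 V6 (Hit Halves V0 V1 V3 V4 V2 V5 V6 V7) (Hit
    Seven2 V2 V3 V5 V7 V1 V4 V6 V0)) (Ask V2 V6 (Hit Seven3 V4 V2 V5 V6 V7 V1 V3 V0) (Hit Halves V0
    V3 V4 V5 V6 V7 V1 V2)))))) (Ask V1 V5 (Hit FiveThree V0 V1 V4 V5 V2 V6 V3 V7) (Ask V2 V6 (Ask V2
    V7 (Hit Halves V0 V1 V3 V4 V5 V2 V6 V7) (Ask V1 V7 (Ask V0 V6 (Hit Halves V0 V5 V2 V6 V1 V3 V7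
    V4) (Hit S15 V5 V1 V7 V2 V6 V0 V3 V4)) (Ask V1 V6 (Ask V0 V6 (Hit FiveThree V0 V1 V4 V2 V6 V3 V5
    V7) (Hit S15 V0 V4 V5 V2 V1 V6 V3 V7)) (Hit Seven2 V7 V1 V4 V2 V6 V3 V5 V0)))) (Ask V2 V7 (Hit
    Halves V0 V1 V3 V4 V5 V6 V2 V7) (Hit Halves V0 V1 V3 V4 V5 V6 V7 V2)))))) (Ask V3 V6 (Hit Halves
    V0 V1 V4 V2 V5 V3 V6 V7) (Hit Halves V0 V1 V4 V2 V5 V6 V3 V7))) (Ask V2 V7 (Ask V2 V6 (Ask V2 V5
    (Hit Halves V0 V1 V3 V4 V2 V5 V6 V7) (Hit Halves V0 V1 V3 V4 V5 V2 V6 V7)) (Ask V2 V5 (Ask V3 V5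
    (Ask V1 V5 (Hit FiveThree V0 V1 V3 V4 V5 V6 V2 V7) (Ask V0 V6 (Ask V1 V7 (Hit Halves V0 V4 V5 V6
    V1 V2 V7 V3) (Ask V3 V6 (Ask V1 V6 (Hit FiveThree V0 V1 V3 V4 V6 V2 V5 V7) (Hit Seven3 V3 V4 V5
    V6 V7 V1 V2 V0)) (Ask V1 V6 (Hit Seven2 V6 V2 V7 V3 V4 V5 V1 V0) (Hit Halves V0 V4 V2 V5 V6 V7
    V1 V3)))) (Ask V3 V6 (Ask V1 V6 (Ask V1 V7 (Hit Halves V0 V3 V4 V5 V1 V6 V2 V7) (Hit S15 V0 V3
    V4 V5 V1 V6 V2 V7)) (Hit S15 V6 V0 V1 V2 V7 V3 V4 V5)) (Hit S15 V0 V1 V4 V2 V5 V6 V7 V3)))) (Ask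
    V3 V6 (Ask V0 V6 (Ask V1 V6 (Hit Halves V0 V1 V4 V6 V2 V5 V7 V3) (Ask V1 V7 (Hit Halves V0 V4 V5
    V6 V1 V2 V7 V3) (Ask V1 V5 (Hit Seven2 V2 V5 V7 V3 V4 V6 V1 V0) (Hit Halves V0 V4 V6 V2 V5 V7 V1
    V3)))) (Ask V1 V5 (Hit S15 V0 V1 V5 V3 V4 V6 V2 V7) (Hit S15 V0 V5 V1 V3 V4 V6 V2 V7))) (Hit
    Halves V0 V1 V4 V2 V5 V6 V7 V3))) (Hit Halves V0 V1 V3 V4 V5 V6 V2 V7))) (Ask V1 V7 (Ask V0 V6
    (Hit Halves V0 V4 V5 V6 V1 V7 V2 V3) (Ask V0 V7 (Hit FiveThree V0 V1 V7 V2 V3 V4 V5 V6) (Ask V2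
    V5 (Ask V1 V6 (Ask V3 V6 (Hit S15 V1 V3 V4 V6 V7 V0 V2 V5) (Hit Halves V0 V4 V2 V5 V1 V6 V7 V3))
    (Ask V3 V6 (Ask V2 V6 (Hit Seven1 V0 V1 V2 V3 V4 V6 V7 V5) (Hit S15 V0 V1 V3 V4 V5 V6 V7 V2))
    (Hit Halves V0 V4 V2 V5 V6 V1 V7 V3))) (Ask V2 V6 (Ask V1 V6 (Ask V3 V6 (Hit S15 V1 V2 V3 V6 V7
    V0 V4 V5) (Hit Halves V0 V4 V5 V2 V1 V6 V7 V3)) (Ask V3 V6 (Hit Seven1 V0 V1 V2 V3 V4 V6 V7 V5)
    (Hit Halves V0 V4 V5 V2 V6 V1 V7 V3))) (Hit Halves V0 V1 V3 V4 V5 V6 V7 V2))))) (Ask V0 V7 (Hit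
    FiveThree V0 V7 V1 V2 V3 V4 V5 V6) (Hit FiveThree V7 V0 V1 V2 V3 V4 V5 V6))))) (Hit FiveThree V0
    V1 V4 V2 V3 V5 V6 V7)) (Ask V3 V4 (Ask V3 V7 (Ask V3 V6 (Ask V3 V5 (Hit Halves V0 V4 V1 V2 V3 V5
    V6 V7) (Hit Halves V0 V4 V1 V2 V5 V3 V6 V7)) (Ask V3 V5 (Ask V1 V5 (Ask V2 V5 (Hit FiveThree V0
    V4 V1 V2 V5 V6 V3 V7) (Hit FiveThree V0 V4 V1 V5 V2 V6 V3 V7)) (Ask V2 V5 (Ask V1 V6 (Ask V1 V7
    (Hit Halves V0 V4 V2 V5 V1 V6 V3 V7) (Ask V0 V6 (Ask V2 V6 (Hit FiveThree V0 V4 V1 V2 V6 V3 V5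
    V7) (Hit FiveThree V0 V4 V1 V6 V2 V3 V5 V7)) (Hit S15 V0 V4 V2 V5 V1 V6 V3 V7))) (Ask V0 V6 (Ask
    V2 V7 (Hit Halves V0 V4 V6 V1 V2 V3 V5 V7) (Ask V2 V6 (Ask V1 V7 (Hit Halves V0 V4 V2 V5 V6 V1
    V3 V7) (Hit Seven2 V5 V6 V7 V1 V2 V3 V4 V0)) (Hit FiveThree V0 V4 V6 V1 V2 V3 V5 V7))) (Ask V2
    V7 (Ask V2 V6 (Hit Halves V0 V4 V5 V1 V2 V6 V3 V7) (Hit Halves V0 V4 V5 V1 V6 V2 V3 V7)) (Hit
    S15 V6 V0 V1 V3 V7 V4 V2 V5)))) (Hit FiveThree V0 V4 V5 V1 V2 V6 V3 V7))) (Hit Halves V0 V4 V1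
    V2 V5 V6 V3 V7))) (Ask V1 V7 (Ask V2 V7 (Ask V0 V6 (Hit Halves V0 V4 V5 V6 V1 V2 V7 V3) (Ask V0
    V7 (Hit FiveThree V0 V1 V2 V7 V3 V4 V5 V6) (Ask V3 V6 (Ask V2 V5 (Ask V3 V5 (Ask V2 V6 (Hit S15
    V2 V3 V5 V6 V7 V0 V4 V1) (Ask V1 V6 (Hit Halves V0 V3 V4 V5 V1 V6 V2 V7) (Hit Halves V0 V3 V4 V5
    V6 V1 V2 V7))) (Ask V2 V6 (Hit S15 V2 V5 V3 V6 V7 V0 V4 V1) (Hit Seven2 V2 V5 V7 V3 V4 V6 V0
    V1))) (Ask V1 V5 (Hit S15 V4 V1 V5 V2 V6 V7 V0 V3) (Hit S15 V4 V5 V1 V2 V6 V7 V0 V3))) (Ask V3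
    V5 (Hit S15 V0 V4 V1 V2 V5 V6 V7 V3) (Hit Halves V0 V4 V1 V2 V5 V6 V7 V3))))) (Ask V0 V7 (Hit
    FiveThree V0 V1 V7 V2 V3 V4 V5 V6) (Ask V0 V6 (Hit Halves V0 V4 V5 V6 V1 V7 V2 V3) (Ask V1 V5
    (Ask V3 V6 (Ask V2 V5 (Hit S15 V4 V1 V2 V5 V6 V7 V0 V3) (Hit S15 V4 V1 V5 V2 V6 V7 V0 V3)) (Ask
    V2 V5 (Hit Halves V4 V1 V2 V5 V6 V7 V0 V3) (Hit Halves V4 V1 V5 V2 V6 V7 V0 V3))) (Ask V1 V6
    (Hit Halves V4 V5 V1 V6 V7 V0 V2 V3) (Hit Halves V4 V5 V6 V1 V7 V0 V2 V3)))))) (Ask V0 V7 (Ask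
    V2 V7 (Ask V2 V6 (Ask V2 V5 (Hit Halves V0 V7 V1 V3 V4 V2 V5 V6) (Hit Halves V0 V7 V1 V3 V4 V5
    V2 V6)) (Ask V1 V5 (Ask V0 V6 (Ask V1 V6 (Hit Halves V0 V2 V7 V3 V4 V1 V5 V6) (Ask V2 V5 (Ask V3
    V6 (Ask V3 V5 (Hit Seven2 V1 V2 V3 V5 V6 V7 V4 V0) (Hit Halves V0 V4 V6 V1 V2 V5 V7 V3)) (Hit
    Halves V0 V4 V1 V5 V6 V2 V7 V3)) (Hit Halves V0 V7 V1 V3 V4 V5 V6 V2))) (Ask V3 V5 (Hit S15 V0
    V1 V3 V5 V4 V6 V2 V7) (Hit S15 V0 V1 V5 V3 V4 V6 V2 V7))) (Ask V1 V6 (Hit Halves V0 V2 V7 V3 V4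
    V5 V1 V6) (Hit Halves V0 V2 V7 V3 V4 V5 V6 V1)))) (Hit FiveThree V0 V7 V1 V2 V3 V4 V5 V6)) (Ask
    V2 V7 (Ask V2 V5 (Ask V2 V6 (Hit Halves V4 V2 V5 V6 V7 V0 V1 V3) (Ask V1 V5 (Ask V3 V6 (Ask V0
    V6 (Ask V1 V6 (Hit FiveThree V0 V4 V1 V5 V6 V2 V7 V3) (Hit S15 V0 V4 V2 V5 V6 V7 V1 V3)) (Hit
    S15 V4 V1 V2 V5 V6 V7 V0 V3)) (Hit Halves V0 V4 V1 V5 V6 V2 V7 V3)) (Ask V0 V6 (Ask V1 V6 (Hit
    FiveThree V0 V4 V5 V1 V6 V2 V7 V3) (Hit FiveThree V0 V4 V5 V6 V1 V2 V7 V3)) (Ask V3 V5 (Ask V3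
    V6 (Ask V1 V6 (Hit S15 V0 V3 V4 V5 V1 V6 V2 V7) (Hit S15 V6 V0 V1 V2 V7 V3 V4 V5)) (Hit Halves
    V0 V4 V5 V1 V6 V2 V7 V3)) (Hit S15 V0 V5 V1 V3 V4 V6 V2 V7))))) (Ask V2 V6 (Hit Halves V4 V5 V2
    V6 V7 V0 V1 V3) (Hit Halves V4 V5 V6 V2 V7 V0 V1 V3))) (Hit FiveThree V7 V0 V1 V2 V3 V4 V5
    V6))))) (Hit FiveThree V0 V4 V1 V2 V3 V5 V6 V7))) (Hit S15 V0 V1 V2 V3 V4 V5 V6 V7)"]) (simp only: resolved decision_simps)


lemma resolves_S13 [resolved]: "resolves S13"
  by (rule resolvesI[where T = "
    Ask V2 V4 (Ask V3 V4 (Hit FiveThree V0 V1 V2 V3 V4 V5 V6 V7) (Hit FiveThree V0 V1 V2 V4 V3 V5 V6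
    V7)) (Hit S14 V0 V1 V2 V3 V4 V5 V6 V7)"]) (simp only: resolved decision_simps)


lemma resolves_S12 [resolved]: "resolves S12"
  by (rule resolvesI[where T = "
    Ask V0 V5 (Ask V2 V4 (Ask V1 V4 (Hit S13 V0 V1 V2 V3 V4 V5 V6 V7) (Ask V1 V7 (Ask V1 V6 (Ask V3
    V4 (Ask V1 V5 (Hit Halves V0 V2 V3 V4 V1 V5 V6 V7) (Hit Halves V0 V2 V3 V4 V5 V1 V6 V7)) (Ask V1
    V5 (Hit Halves V0 V2 V4 V3 V1 V5 V6 V7) (Hit Halves V0 V2 V4 V3 V5 V1 V6 V7))) (Ask V3 V5 (Ask
    V2 V5 (Hit S13 V0 V2 V3 V5 V4 V6 V1 V7) (Ask V3 V4 (Ask V1 V5 (Ask V2 V7 (Ask V2 V6 (Ask V3 V7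
    (Ask V0 V6 (Hit Halves V0 V2 V4 V6 V1 V3 V5 V7) (Hit S14 V2 V3 V7 V4 V6 V0 V1 V5)) (Ask V0 V6
    (Hit Halves V0 V4 V5 V6 V1 V2 V7 V3) (Hit S15 V2 V7 V3 V4 V6 V0 V1 V5))) (Hit Halves V0 V3 V4 V5
    V6 V1 V2 V7)) (Ask V2 V6 (Ask V0 V7 (Hit S13 V0 V1 V3 V5 V7 V2 V4 V6) (Ask V0 V6 (Ask V3 V6 (Hit
    Halves V0 V3 V4 V6 V1 V5 V7 V2) (Hit S13 V0 V2 V6 V3 V4 V1 V5 V7)) (Hit Seven2 V1 V5 V7 V2 V4 V6
    V0 V3))) (Hit Halves V0 V3 V4 V5 V6 V1 V7 V2))) (Hit Halves V0 V2 V3 V4 V5 V6 V1 V7)) (Ask V1 V5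
    (Ask V2 V7 (Ask V2 V6 (Hit Halves V0 V4 V1 V3 V5 V2 V6 V7) (Hit Halves V0 V4 V1 V3 V5 V6 V2 V7))
    (Ask V2 V6 (Ask V3 V6 (Ask V0 V6 (Hit Halves V0 V4 V3 V6 V1 V5 V7 V2) (Ask V0 V7 (Hit Halves V0
    V1 V5 V7 V2 V4 V3 V6) (Hit Seven2 V1 V5 V7 V2 V4 V6 V0 V3))) (Ask V0 V6 (Hit Halves V0 V4 V6 V3
    V1 V5 V7 V2) (Ask V0 V7 (Hit Halves V0 V1 V5 V7 V2 V4 V6 V3) (Hit Seven2 V1 V5 V7 V2 V4 V6 V0
    V3)))) (Hit Halves V0 V4 V1 V3 V5 V6 V7 V2))) (Hit Halves V0 V2 V4 V3 V5 V6 V1 V7)))) (Ask V2 V5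
    (Hit S13 V0 V2 V5 V3 V4 V6 V1 V7) (Ask V0 V6 (Ask V2 V7 (Ask V3 V7 (Hit Halves V0 V4 V5 V6 V1 V2
    V3 V7) (Hit Halves V0 V4 V5 V6 V1 V2 V7 V3)) (Ask V3 V6 (Hit S14 V0 V5 V3 V6 V1 V7 V2 V4) (Ask
    V1 V5 (Ask V0 V7 (Ask V3 V7 (Ask V2 V6 (Hit Halves V0 V2 V4 V6 V1 V5 V3 V7) (Ask V3 V4 (Hit
    Seven1 V1 V5 V2 V3 V7 V4 V6 V0) (Hit Halves V0 V1 V7 V2 V4 V5 V6 V3))) (Hit Halves V0 V4 V5 V6
    V1 V7 V2 V3)) (Hit S13 V1 V5 V2 V3 V7 V0 V4 V6)) (Hit FiveThree V0 V5 V6 V1 V3 V7 V2 V4)))) (Hit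
    S15 V0 V5 V2 V3 V4 V6 V1 V7))))) (Ask V3 V4 (Ask V1 V6 (Ask V1 V5 (Hit S14 V0 V2 V3 V4 V1 V5 V6
    V7) (Ask V2 V7 (Ask V3 V7 (Ask V0 V6 (Hit Halves V0 V5 V1 V6 V2 V3 V7 V4) (Ask V0 V7 (Hit Halves
    V0 V2 V3 V7 V4 V5 V1 V6) (Ask V3 V6 (Ask V2 V6 (Hit Halves V0 V4 V5 V1 V2 V3 V6 V7) (Hit Seven2
    V2 V3 V7 V4 V1 V6 V0 V5)) (Ask V2 V6 (Hit Halves V0 V4 V5 V1 V2 V6 V3 V7) (Hit Halves V0 V4 V5
    V1 V6 V2 V3 V7))))) (Ask V0 V6 (Hit Halves V0 V5 V1 V6 V2 V7 V3 V4) (Ask V0 V7 (Hit Halves V0 V2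
    V7 V3 V4 V5 V1 V6) (Ask V2 V6 (Ask V2 V5 (Hit Halves V2 V4 V5 V6 V7 V0 V1 V3) (Hit Halves V5 V1
    V2 V6 V7 V0 V3 V4)) (Ask V3 V5 (Hit S15 V0 V3 V4 V5 V1 V6 V2 V7) (Hit S15 V5 V7 V1 V3 V6 V0 V2
    V4)))))) (Ask V0 V7 (Ask V3 V7 (Ask V0 V6 (Hit S13 V0 V5 V6 V7 V1 V2 V3 V4) (Ask V3 V5 (Ask V2
    V6 (Hit S13 V0 V3 V4 V5 V7 V1 V2 V6) (Hit S13 V0 V3 V5 V7 V4 V1 V6 V2)) (Ask V3 V6 (Hit Halves
    V0 V7 V2 V4 V5 V1 V3 V6) (Hit Halves V0 V7 V2 V4 V5 V1 V6 V3)))) (Hit Halves V0 V7 V2 V3 V4 V5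
    V1 V6)) (Ask V3 V7 (Ask V3 V6 (Ask V3 V5 (Hit Halves V3 V4 V5 V6 V7 V0 V1 V2) (Hit Halves V5 V1
    V3 V6 V7 V0 V2 V4)) (Ask V3 V5 (Ask V0 V6 (Ask V2 V5 (Ask V2 V6 (Hit Seven2 V4 V5 V1 V6 V3 V7 V2
    V0) (Hit Seven3 V1 V6 V2 V3 V4 V5 V7 V0)) (Hit S13 V0 V5 V1 V2 V6 V3 V7 V4)) (Ask V2 V5 (Hit S15
    V0 V2 V4 V5 V1 V6 V3 V7) (Hit S15 V5 V7 V1 V2 V6 V0 V3 V4))) (Hit Halves V5 V1 V6 V3 V7 V0 V2
    V4))) (Hit Halves V4 V5 V1 V6 V7 V0 V2 V3))))) (Ask V1 V5 (Ask V3 V5 (Ask V2 V5 (Hit FiveThree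
    V0 V2 V3 V4 V5 V6 V7 V1) (Ask V0 V6 (Ask V2 V7 (Ask V3 V7 (Hit S13 V0 V4 V5 V6 V1 V2 V3 V7) (Hit
    S13 V0 V4 V6 V1 V5 V2 V7 V3)) (Ask V3 V6 (Hit FiveThree V0 V3 V4 V5 V6 V7 V1 V2) (Ask V0 V7 (Ask
    V2 V6 (Ask V3 V7 (Hit Seven4 V1 V2 V3 V4 V5 V6 V7 V0) (Hit Halves V0 V4 V5 V6 V7 V1 V2 V3)) (Hit
    Halves V0 V3 V4 V5 V6 V7 V1 V2)) (Hit S15 V0 V6 V1 V3 V5 V7 V2 V4)))) (Hit S15 V0 V2 V3 V4 V5 V6
    V7 V1))) (Hit S14 V0 V2 V3 V4 V5 V6 V7 V1)) (Hit Halves V0 V2 V3 V4 V5 V6 V7 V1))) (Ask V2 V7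
    (Ask V2 V6 (Ask V2 V5 (Hit Halves V0 V4 V1 V3 V2 V5 V6 V7) (Hit Halves V0 V4 V1 V3 V5 V2 V6 V7))
    (Ask V3 V5 (Ask V1 V6 (Hit S13 V0 V4 V3 V5 V1 V6 V2 V7) (Ask V2 V5 (Hit FiveThree V0 V2 V4 V3 V5
    V6 V7 V1) (Hit Halves V0 V4 V1 V3 V5 V6 V2 V7))) (Ask V1 V5 (Hit FiveThree V0 V4 V1 V5 V3 V6 V2
    V7) (Hit FiveThree V0 V4 V5 V1 V3 V6 V2 V7)))) (Ask V0 V7 (Ask V3 V7 (Ask V3 V5 (Ask V3 V6 (Hit
    Halves V0 V7 V1 V2 V4 V3 V5 V6) (Ask V2 V5 (Ask V1 V6 (Ask V2 V6 (Ask V1 V5 (Hit Seven1 V1 V2 V3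
    V5 V6 V7 V4 V0) (Hit Halves V0 V5 V7 V1 V2 V4 V6 V3)) (Hit S13 V0 V4 V1 V3 V5 V6 V7 V2)) (Hit
    FiveThree V0 V2 V4 V3 V5 V6 V7 V1)) (Ask V1 V5 (Hit S14 V0 V1 V5 V2 V4 V6 V3 V7) (Hit FiveThree
    V0 V5 V7 V1 V2 V4 V6 V3)))) (Ask V3 V6 (Hit Halves V0 V7 V1 V2 V4 V5 V3 V6) (Hit Halves V0 V7 V1
    V2 V4 V5 V6 V3))) (Hit FiveThree V0 V7 V1 V2 V3 V4 V5 V6)) (Ask V3 V7 (Ask V3 V5 (Ask V3 V6 (Hit
    Halves V4 V3 V5 V6 V7 V0 V1 V2) (Ask V1 V5 (Ask V2 V5 (Ask V2 V6 (Ask V1 V6 (Hit Seven1 V1 V2 V3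
    V5 V6 V7 V4 V0) (Hit FiveThree V0 V2 V4 V3 V5 V6 V7 V1)) (Hit FiveThree V0 V4 V1 V3 V5 V6 V7
    V2)) (Hit S14 V0 V1 V5 V2 V4 V6 V3 V7)) (Ask V2 V5 (Ask V2 V6 (Hit S14 V0 V4 V5 V1 V2 V6 V3 V7)
    (Hit S13 V0 V4 V1 V3 V5 V6 V7 V2)) (Hit S14 V0 V5 V1 V2 V4 V6 V3 V7)))) (Ask V3 V6 (Hit Halves
    V4 V5 V3 V6 V7 V0 V1 V2) (Hit Halves V4 V5 V6 V3 V7 V0 V1 V2))) (Hit FiveThree V7 V0 V1 V2 V3 V4
    V5 V6))))))) (Hit S14 V0 V1 V2 V3 V4 V5 V6 V7)) (Hit S15 V0 V1 V2 V3 V4 V5 V6 V7)"]) (simp only: resolved decision_simps)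


lemma resolves_S11 [resolved]: "resolves S11"
  by (rule resolvesI[where T = "
    Ask V0 V4 (Hit S12 V0 V1 V2 V3 V4 V5 V6 V7) (Ask V0 V7 (Ask V3 V7 (Ask V3 V6 (Ask V3 V5 (Ask V3
    V4 (Hit Halves V0 V7 V1 V2 V3 V4 V5 V6) (Hit Halves V0 V7 V1 V2 V4 V3 V5 V6)) (Ask V3 V4 (Ask V2
    V4 (Ask V0 V5 (Ask V1 V4 (Ask V0 V6 (Hit Halves V0 V5 V3 V6 V7 V1 V2 V4) (Ask V1 V5 (Ask V2 V5
    (Hit S12 V1 V2 V5 V3 V4 V6 V0 V7) (Hit S12 V1 V5 V2 V3 V4 V6 V0 V7)) (Ask V2 V6 (Hit Halves V0
    V5 V7 V1 V2 V3 V4 V6) (Hit S12 V0 V5 V7 V1 V2 V3 V4 V6)))) (Ask V1 V6 (Ask V2 V5 (Hit S12 V0 V2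
    V5 V3 V7 V4 V1 V6) (Hit S12 V0 V5 V2 V3 V7 V4 V1 V6)) (Ask V2 V5 (Ask V2 V6 (Hit S12 V0 V5 V3 V7
    V2 V4 V6 V1) (Ask V0 V6 (Hit S12 V0 V5 V6 V7 V1 V2 V3 V4) (Hit Seven2 V5 V3 V6 V7 V2 V4 V0 V1)))
    (Hit S12 V0 V5 V7 V2 V3 V4 V6 V1)))) (Ask V1 V4 (Hit S12 V5 V3 V6 V7 V0 V1 V2 V4) (Ask V1 V5
    (Ask V2 V5 (Hit Seven2 V1 V2 V5 V3 V7 V4 V0 V6) (Ask V1 V6 (Hit S12 V5 V0 V2 V3 V7 V4 V1 V6)
    (Hit S12 V5 V0 V7 V2 V3 V4 V6 V1))) (Ask V1 V6 (Hit S12 V5 V1 V3 V6 V0 V7 V2 V4) (Hit S12 V5 V6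
    V7 V1 V0 V2 V3 V4))))) (Ask V1 V4 (Ask V0 V5 (Ask V0 V6 (Hit Halves V0 V5 V3 V6 V7 V1 V4 V2)
    (Ask V1 V5 (Ask V2 V5 (Hit S12 V1 V2 V5 V3 V4 V6 V0 V7) (Hit S12 V1 V5 V2 V3 V4 V6 V0 V7)) (Ask
    V2 V6 (Hit S12 V0 V5 V1 V3 V7 V4 V2 V6) (Hit S12 V0 V5 V7 V1 V3 V4 V6 V2)))) (Ask V0 V6 (Hit
    Halves V5 V0 V3 V6 V7 V1 V4 V2) (Ask V2 V6 (Ask V1 V6 (Hit Halves V1 V4 V2 V6 V5 V0 V3 V7) (Ask
    V1 V5 (Ask V2 V5 (Hit S12 V1 V2 V5 V3 V4 V6 V0 V7) (Hit S12 V1 V5 V2 V3 V4 V6 V0 V7)) (Hit S12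
    V5 V0 V1 V3 V7 V4 V2 V6))) (Ask V2 V5 (Ask V1 V5 (Hit S12 V1 V2 V5 V3 V4 V6 V0 V7) (Hit S12 V5
    V0 V7 V1 V3 V4 V6 V2)) (Hit FiveThree V5 V6 V0 V7 V2 V1 V3 V4))))) (Hit Halves V4 V0 V1 V2 V5 V3
    V6 V7))) (Hit Halves V0 V7 V1 V2 V4 V5 V3 V6))) (Ask V3 V4 (Ask V3 V5 (Hit S12 V0 V7 V1 V2 V3 V4
    V5 V6) (Ask V2 V4 (Ask V0 V5 (Ask V1 V4 (Ask V0 V6 (Hit Halves V0 V5 V6 V3 V7 V1 V2 V4) (Ask V1
    V6 (Ask V2 V6 (Hit Halves V0 V5 V3 V7 V1 V2 V4 V6) (Hit S12 V1 V6 V2 V3 V4 V0 V5 V7)) (Ask V2 V5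
    (Hit S12 V6 V0 V1 V3 V7 V2 V4 V5) (Ask V2 V6 (Hit S12 V0 V5 V3 V7 V1 V2 V4 V6) (Hit Seven1 V0 V5
    V2 V3 V7 V4 V6 V1))))) (Ask V0 V6 (Hit S12 V0 V5 V6 V7 V1 V2 V3 V4) (Ask V1 V6 (Ask V2 V5 (Hit
    S12 V0 V2 V5 V3 V7 V4 V1 V6) (Hit S12 V0 V5 V2 V3 V7 V4 V1 V6)) (Ask V2 V6 (Hit S12 V0 V5 V3 V7
    V2 V4 V6 V1) (Ask V2 V5 (Hit S12 V6 V0 V1 V3 V7 V2 V4 V5) (Hit Seven1 V0 V5 V2 V3 V7 V4 V6
    V1)))))) (Ask V1 V4 (Hit S12 V5 V6 V3 V7 V0 V1 V2 V4) (Ask V1 V6 (Ask V2 V5 (Ask V1 V5 (Hit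
    Seven2 V1 V2 V5 V3 V7 V4 V0 V6) (Hit S12 V5 V1 V6 V3 V0 V7 V2 V4)) (Hit S12 V5 V0 V2 V3 V7 V4 V1
    V6)) (Ask V1 V5 (Ask V2 V5 (Hit Seven2 V1 V2 V5 V3 V7 V4 V0 V6) (Ask V2 V6 (Hit S12 V5 V0 V3 V7
    V2 V4 V6 V1) (Ask V0 V6 (Hit FiveThree V5 V0 V6 V2 V3 V7 V4 V1) (Hit FiveThree V5 V6 V0 V2 V3 V7
    V4 V1)))) (Hit S12 V5 V6 V1 V3 V0 V7 V2 V4))))) (Ask V1 V4 (Ask V0 V5 (Ask V0 V6 (Hit Halves V0
    V5 V6 V3 V7 V1 V4 V2) (Ask V1 V6 (Ask V2 V6 (Hit Halves V0 V5 V3 V7 V1 V4 V2 V6) (Hit Halves V0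
    V5 V3 V7 V1 V4 V6 V2)) (Ask V1 V5 (Ask V2 V5 (Hit Halves V1 V4 V2 V5 V6 V0 V3 V7) (Hit Halves V1
    V4 V5 V2 V6 V0 V3 V7)) (Hit Seven1 V0 V5 V1 V3 V7 V4 V6 V2)))) (Ask V0 V6 (Hit Halves V5 V0 V6
    V3 V7 V1 V4 V2) (Hit Halves V5 V6 V0 V3 V7 V1 V4 V2))) (Hit Halves V4 V0 V1 V2 V5 V6 V3 V7))))
    (Ask V3 V5 (Ask V1 V4 (Ask V0 V6 (Ask V1 V5 (Ask V2 V6 (Hit S12 V0 V2 V6 V3 V7 V1 V4 V5) (Hit
    Halves V0 V6 V7 V2 V1 V4 V3 V5)) (Ask V2 V5 (Hit S12 V4 V0 V6 V3 V5 V7 V1 V2) (Hit Halves V4 V0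
    V6 V3 V5 V7 V1 V2))) (Ask V1 V5 (Ask V2 V6 (Ask V1 V6 (Hit S12 V1 V4 V3 V5 V6 V0 V7 V2) (Ask V2
    V5 (Hit S12 V1 V2 V3 V5 V4 V6 V0 V7) (Ask V2 V4 (Ask V0 V5 (Hit S12 V0 V1 V3 V5 V7 V2 V4 V6)
    (Hit Halves V1 V2 V4 V3 V5 V6 V0 V7)) (Hit Halves V1 V4 V5 V2 V6 V0 V3 V7)))) (Hit Halves V1 V4
    V3 V5 V6 V0 V7 V2)) (Ask V2 V5 (Hit S12 V4 V6 V0 V3 V5 V7 V1 V2) (Hit Halves V4 V6 V0 V3 V5 V7
    V1 V2)))) (Ask V2 V4 (Ask V2 V5 (Ask V1 V6 (Ask V0 V5 (Hit S12 V0 V2 V3 V5 V7 V4 V1 V6) (Hit S12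
    V4 V1 V6 V3 V5 V0 V7 V2)) (Ask V0 V6 (Hit Halves V0 V6 V7 V1 V2 V4 V3 V5) (Hit Halves V2 V4 V3
    V5 V6 V0 V7 V1))) (Ask V0 V6 (Ask V1 V6 (Hit FiveThree V4 V0 V1 V6 V3 V5 V7 V2) (Hit FiveThree
    V4 V0 V6 V1 V3 V5 V7 V2)) (Ask V1 V6 (Ask V0 V5 (Hit Halves V0 V5 V7 V2 V4 V1 V6 V3) (Hit Halves
    V4 V1 V6 V3 V5 V0 V7 V2)) (Hit FiveThree V4 V6 V0 V1 V3 V5 V7 V2)))) (Hit FiveThree V4 V0 V1 V2
    V3 V5 V6 V7))) (Hit Halves V0 V7 V1 V2 V4 V5 V6 V3)))) (Hit FiveThree V0 V7 V1 V2 V3 V4 V5 V6))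
    (Ask V3 V7 (Ask V3 V4 (Ask V3 V5 (Ask V3 V6 (Hit Halves V3 V4 V5 V6 V7 V0 V1 V2) (Ask V0 V5 (Ask
    V1 V6 (Ask V2 V5 (Ask V1 V5 (Ask V2 V6 (Hit S12 V1 V2 V5 V6 V3 V7 V4 V0) (Ask V0 V6 (Hit S12 V0
    V1 V2 V5 V6 V3 V7 V4) (Ask V1 V4 (Hit Halves V1 V3 V4 V5 V6 V7 V0 V2) (Hit S12 V6 V0 V2 V3 V7 V4
    V1 V5)))) (Ask V1 V4 (Ask V0 V6 (Ask V2 V6 (Hit S12 V0 V2 V6 V3 V5 V7 V1 V4) (Hit S12 V0 V6 V2
    V3 V5 V7 V1 V4)) (Hit Seven4 V0 V1 V3 V4 V5 V6 V7 V2)) (Ask V2 V4 (Ask V2 V6 (Hit Seven2 V4 V5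
    V1 V6 V3 V7 V2 V0) (Hit Seven3 V1 V6 V2 V3 V4 V5 V7 V0)) (Hit S12 V4 V0 V2 V5 V1 V6 V3 V7))))
    (Ask V1 V5 (Ask V2 V6 (Hit S12 V1 V5 V2 V6 V3 V7 V4 V0) (Hit S12 V1 V5 V6 V2 V3 V7 V4 V0)) (Ask
    V0 V6 (Hit S12 V0 V5 V1 V2 V6 V3 V7 V4) (Ask V1 V4 (Hit Seven4 V0 V1 V3 V4 V5 V6 V7 V2) (Ask V2
    V4 (Ask V2 V6 (Hit Seven4 V0 V2 V3 V4 V5 V6 V7 V1) (Hit S12 V6 V7 V0 V2 V3 V4 V5 V1)) (Hit
    FiveThree V4 V0 V5 V1 V2 V6 V3 V7)))))) (Ask V2 V6 (Ask V2 V5 (Ask V0 V6 (Ask V1 V4 (Hit S12 V0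
    V2 V3 V5 V6 V7 V1 V4) (Hit S12 V0 V2 V5 V6 V3 V7 V4 V1)) (Ask V2 V4 (Hit Halves V2 V3 V4 V5 V6
    V7 V0 V1) (Hit S12 V6 V0 V1 V3 V7 V4 V2 V5))) (Ask V0 V6 (Ask V1 V5 (Hit S12 V0 V1 V5 V2 V6 V3
    V7 V4) (Hit S12 V0 V5 V1 V2 V6 V3 V7 V4)) (Ask V2 V4 (Hit Seven4 V0 V2 V3 V4 V5 V6 V7 V1) (Hit
    S12 V6 V7 V0 V1 V3 V4 V5 V2)))) (Hit S12 V6 V1 V2 V3 V7 V4 V0 V5))) (Ask V2 V5 (Ask V2 V6 (Ask
    V2 V4 (Ask V0 V6 (Hit Seven2 V4 V5 V0 V6 V3 V7 V2 V1) (Ask V1 V6 (Hit S12 V2 V3 V4 V5 V6 V7 V0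
    V1) (Hit Halves V2 V3 V4 V5 V6 V7 V0 V1))) (Ask V0 V6 (Ask V1 V6 (Ask V1 V4 (Hit S12 V1 V4 V2 V6
    V3 V5 V7 V0) (Hit FiveThree V4 V0 V1 V2 V6 V3 V5 V7)) (Ask V1 V4 (Ask V1 V5 (Hit Seven3 V0 V6 V1
    V3 V4 V5 V7 V2) (Hit Seven3 V4 V2 V5 V6 V7 V1 V3 V0)) (Hit S12 V4 V0 V6 V1 V2 V3 V5 V7))) (Hit
    Seven2 V5 V6 V7 V0 V2 V3 V4 V1))) (Ask V1 V6 (Ask V2 V4 (Ask V1 V5 (Ask V0 V6 (Hit Seven3 V0 V6
    V2 V3 V4 V5 V7 V1) (Ask V1 V4 (Hit Halves V1 V2 V3 V4 V5 V6 V7 V0) (Hit Seven2 V2 V3 V4 V5 V6 V7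
    V1 V0))) (Hit S12 V5 V7 V0 V1 V6 V2 V3 V4)) (Ask V1 V4 (Hit S12 V1 V4 V6 V2 V3 V5 V7 V0) (Ask V0
    V6 (Hit FiveThree V4 V0 V1 V6 V2 V3 V5 V7) (Ask V1 V5 (Hit Seven2 V5 V6 V7 V0 V1 V3 V4 V2) (Hit
    S12 V6 V7 V0 V2 V3 V4 V5 V1))))) (Hit S12 V6 V7 V1 V2 V3 V4 V5 V0))) (Ask V1 V5 (Ask V1 V6 (Ask
    V2 V6 (Hit S12 V1 V5 V2 V6 V3 V7 V4 V0) (Hit S12 V1 V5 V6 V2 V3 V7 V4 V0)) (Ask V1 V4 (Hit S12
    V5 V7 V0 V2 V6 V1 V3 V4) (Ask V2 V6 (Ask V2 V4 (Hit Seven4 V1 V2 V3 V4 V5 V6 V7 V0) (Ask V0 V6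
    (Hit S12 V4 V0 V2 V6 V1 V3 V5 V7) (Hit S12 V6 V7 V0 V1 V3 V4 V5 V2))) (Hit S12 V6 V7 V1 V2 V3 V4
    V5 V0)))) (Hit S12 V5 V0 V1 V2 V6 V3 V7 V4))))) (Ask V3 V6 (Ask V1 V4 (Ask V2 V4 (Ask V0 V5 (Ask
    V0 V6 (Hit Halves V0 V5 V3 V6 V7 V1 V2 V4) (Hit S12 V7 V1 V2 V4 V0 V5 V3 V6)) (Hit S12 V5 V3 V6
    V7 V0 V1 V2 V4)) (Ask V1 V5 (Ask V1 V6 (Hit Halves V1 V5 V3 V6 V7 V4 V0 V2) (Hit S12 V7 V4 V0 V2
    V1 V5 V3 V6)) (Ask V0 V5 (Ask V0 V6 (Hit Halves V0 V5 V3 V6 V7 V1 V4 V2) (Hit S12 V7 V1 V4 V2 V0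
    V5 V3 V6)) (Ask V2 V6 (Hit S12 V5 V0 V1 V3 V7 V4 V2 V6) (Hit S12 V5 V7 V0 V1 V3 V4 V6 V2)))))
    (Ask V2 V4 (Ask V2 V6 (Ask V2 V5 (Hit Halves V2 V5 V3 V6 V7 V4 V0 V1) (Hit Halves V5 V2 V3 V6 V7
    V4 V0 V1)) (Ask V2 V5 (Hit S12 V7 V4 V0 V1 V2 V5 V3 V6) (Ask V0 V5 (Ask V0 V6 (Hit S12 V0 V5 V6
    V2 V3 V7 V4 V1) (Hit Seven2 V6 V7 V0 V2 V3 V4 V5 V1)) (Ask V1 V6 (Hit S12 V5 V0 V2 V3 V7 V4 V1
    V6) (Hit S12 V5 V7 V0 V2 V3 V4 V6 V1))))) (Hit Halves V4 V0 V1 V2 V5 V3 V6 V7))) (Hit S12 V7 V0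
    V1 V2 V4 V5 V6 V3))) (Ask V3 V5 (Ask V3 V6 (Hit Halves V4 V3 V5 V6 V7 V0 V1 V2) (Ask V2 V5 (Ask
    V0 V6 (Ask V1 V5 (Ask V2 V4 (Ask V0 V5 (Ask V2 V6 (Hit Seven1 V0 V2 V3 V5 V6 V7 V4 V1) (Hit S12
    V0 V1 V3 V5 V6 V7 V2 V4)) (Ask V2 V6 (Hit S12 V2 V4 V6 V3 V5 V7 V0 V1) (Hit Seven2 V0 V6 V2 V3
    V5 V7 V4 V1))) (Ask V1 V4 (Ask V1 V6 (Ask V0 V5 (Hit Seven1 V0 V1 V3 V5 V6 V7 V4 V2) (Hit S12 V1
    V4 V6 V3 V5 V7 V0 V2)) (Hit S12 V4 V0 V2 V3 V5 V6 V7 V1)) (Hit FiveThree V4 V0 V1 V2 V3 V5 V6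
    V7))) (Hit S12 V4 V0 V6 V3 V5 V7 V1 V2)) (Ask V1 V5 (Ask V1 V4 (Ask V2 V4 (Hit FiveThree V1 V2
    V4 V3 V5 V6 V7 V0) (Hit FiveThree V1 V4 V2 V3 V5 V6 V7 V0)) (Ask V2 V6 (Hit S12 V4 V1 V3 V5 V6
    V7 V0 V2) (Hit Halves V4 V1 V3 V5 V6 V7 V0 V2))) (Hit S12 V4 V6 V0 V3 V5 V7 V1 V2))) (Ask V0 V6
    (Ask V1 V5 (Ask V1 V6 (Ask V1 V4 (Ask V0 V5 (Hit Seven1 V0 V1 V3 V5 V6 V7 V4 V2) (Hit Halves V1
    V4 V6 V3 V5 V7 V0 V2)) (Hit FiveThree V4 V0 V1 V6 V3 V5 V7 V2)) (Ask V2 V4 (Ask V0 V5 (Hit S12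
    V0 V6 V1 V3 V5 V7 V2 V4) (Ask V1 V4 (Hit Seven2 V0 V6 V1 V3 V5 V7 V4 V2) (Hit Halves V4 V6 V1 V3
    V5 V7 V0 V2))) (Hit S12 V4 V0 V2 V3 V5 V6 V7 V1))) (Hit Halves V4 V0 V6 V3 V5 V7 V1 V2)) (Ask V1
    V5 (Ask V1 V4 (Ask V2 V6 (Ask V1 V6 (Hit S12 V1 V4 V3 V5 V6 V7 V0 V2) (Ask V0 V5 (Hit S12 V4 V0
    V3 V5 V6 V7 V1 V2) (Ask V2 V4 (Hit Halves V1 V2 V4 V3 V5 V6 V7 V0) (Hit Halves V1 V4 V2 V3 V5 V6
    V7 V0)))) (Hit Halves V1 V4 V3 V5 V6 V7 V0 V2)) (Ask V2 V6 (Hit S12 V4 V1 V3 V5 V6 V7 V0 V2)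
    (Hit Halves V4 V0 V1 V3 V5 V6 V7 V2))) (Hit Halves V4 V6 V0 V3 V5 V7 V1 V2))))) (Ask V3 V6 (Hit
    Halves V4 V5 V3 V6 V7 V0 V1 V2) (Hit Halves V4 V5 V6 V3 V7 V0 V1 V2)))) (Hit FiveThree V7 V0 V1
    V2 V3 V4 V5 V6)))"]) (simp only: resolved decision_simps)


lemma resolves_S10 [resolved]: "resolves S10"
  by (rule resolvesI[where T = "
    Ask V0 V4 (Hit S12 V0 V1 V2 V3 V4 V5 V6 V7) (Ask V1 V7 (Ask V3 V7 (Ask V2 V4 (Ask V3 V6 (Ask V3
    V5 (Ask V1 V4 (Hit S11 V3 V5 V6 V7 V0 V1 V2 V4) (Ask V3 V4 (Hit S12 V3 V5 V6 V7 V4 V0 V1 V2)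
    (Ask V2 V5 (Ask V2 V6 (Hit S11 V3 V5 V6 V7 V4 V0 V1 V2) (Hit S12 V4 V0 V1 V3 V5 V6 V7 V2)) (Ask
    V1 V6 (Ask V0 V7 (Hit Halves V0 V1 V7 V2 V4 V3 V5 V6) (Ask V2 V6 (Ask V1 V5 (Hit FiveThree V4 V1
    V3 V5 V6 V7 V0 V2) (Hit S12 V5 V1 V2 V6 V7 V4 V0 V3)) (Hit Halves V4 V0 V1 V3 V5 V6 V7 V2)))
    (Ask V0 V6 (Hit S12 V4 V0 V6 V1 V3 V5 V7 V2) (Hit S12 V4 V6 V0 V1 V3 V5 V7 V2)))))) (Ask V1 V4
    (Ask V0 V5 (Ask V0 V6 (Hit Halves V0 V5 V3 V6 V1 V7 V2 V4) (Ask V2 V6 (Ask V1 V5 (Hit S11 V1 V5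
    V3 V7 V2 V4 V6 V0) (Hit S11 V5 V1 V3 V7 V2 V4 V6 V0)) (Hit S11 V1 V7 V2 V4 V0 V5 V3 V6))) (Hit
    S12 V5 V3 V6 V7 V0 V1 V2 V4)) (Ask V2 V6 (Hit S11 V5 V3 V6 V7 V4 V0 V1 V2) (Ask V0 V5 (Ask V1 V5
    (Hit S11 V0 V1 V5 V3 V6 V7 V2 V4) (Hit S11 V0 V5 V1 V3 V6 V7 V2 V4)) (Ask V3 V4 (Ask V1 V6 (Hit
    S11 V1 V6 V7 V2 V4 V5 V0 V3) (Ask V0 V6 (Hit S11 V0 V6 V1 V2 V5 V3 V7 V4) (Hit S11 V6 V0 V1 V2
    V5 V3 V7 V4))) (Ask V2 V5 (Hit S12 V4 V0 V1 V3 V5 V6 V7 V2) (Hit Halves V4 V0 V1 V3 V5 V6 V7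
    V2))))))) (Ask V1 V6 (Ask V2 V5 (Ask V0 V5 (Ask V2 V6 (Ask V0 V7 (Hit Halves V0 V1 V3 V7 V2 V4
    V5 V6) (Hit S12 V1 V2 V6 V3 V7 V4 V0 V5)) (Ask V0 V7 (Hit S12 V0 V1 V3 V7 V2 V4 V5 V6) (Hit S12
    V1 V6 V2 V3 V7 V4 V0 V5))) (Hit S12 V1 V6 V3 V7 V2 V4 V5 V0)) (Ask V0 V5 (Ask V2 V6 (Hit S11 V1
    V6 V3 V7 V4 V0 V5 V2) (Ask V1 V4 (Hit S12 V1 V6 V3 V7 V4 V0 V5 V2) (Ask V3 V4 (Ask V0 V7 (Ask V1
    V5 (Hit S11 V0 V1 V5 V2 V6 V3 V7 V4) (Hit S11 V0 V5 V1 V2 V6 V3 V7 V4)) (Hit S11 V1 V6 V2 V3 V7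
    V4 V0 V5)) (Hit Halves V4 V0 V1 V3 V5 V6 V7 V2)))) (Ask V3 V4 (Ask V1 V5 (Hit S11 V1 V5 V6 V7 V0
    V2 V3 V4) (Hit S12 V5 V0 V1 V2 V6 V3 V7 V4)) (Ask V1 V4 (Hit S12 V1 V6 V3 V7 V4 V5 V0 V2) (Ask
    V0 V7 (Hit Halves V4 V1 V6 V3 V5 V0 V7 V2) (Hit Halves V4 V1 V6 V3 V5 V7 V0 V2)))))) (Ask V0 V6
    (Ask V2 V5 (Ask V0 V7 (Hit FiveThree V0 V6 V1 V3 V7 V2 V4 V5) (Ask V0 V5 (Ask V3 V5 (Ask V1 V5
    (Hit S12 V1 V2 V3 V5 V7 V4 V0 V6) (Hit S11 V0 V6 V1 V3 V7 V2 V4 V5)) (Ask V1 V4 (Hit Halves V0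
    V5 V6 V3 V1 V7 V2 V4) (Hit S11 V0 V5 V6 V3 V1 V7 V2 V4))) (Hit S11 V6 V1 V3 V7 V2 V4 V5 V0)))
    (Ask V0 V5 (Hit S12 V0 V6 V1 V3 V5 V7 V2 V4) (Ask V1 V4 (Ask V3 V4 (Ask V1 V5 (Hit S12 V1 V5 V7
    V2 V4 V0 V6 V3) (Hit S12 V5 V0 V1 V2 V6 V3 V7 V4)) (Ask V1 V5 (Hit Halves V1 V5 V7 V2 V4 V0 V6
    V3) (Hit Halves V4 V0 V6 V3 V5 V1 V7 V2))) (Hit S11 V0 V6 V1 V3 V5 V7 V2 V4)))) (Ask V2 V5 (Hit
    S12 V6 V0 V1 V3 V7 V2 V4 V5) (Ask V3 V4 (Ask V1 V4 (Ask V0 V5 (Ask V0 V7 (Ask V3 V5 (Hit S11 V0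
    V1 V7 V2 V3 V4 V5 V6) (Ask V2 V6 (Hit S11 V1 V3 V7 V4 V0 V5 V2 V6) (Hit Seven1 V0 V5 V2 V3 V7 V4
    V6 V1))) (Hit S11 V1 V2 V3 V4 V5 V6 V7 V0)) (Ask V1 V5 (Hit S12 V1 V5 V7 V2 V4 V6 V0 V3) (Hit
    S12 V5 V0 V1 V2 V6 V3 V7 V4))) (Hit S11 V6 V0 V1 V3 V5 V7 V2 V4)) (Ask V1 V5 (Hit Halves V1 V5
    V7 V2 V4 V6 V0 V3) (Hit Halves V4 V6 V0 V3 V5 V1 V7 V2))))))) (Ask V2 V6 (Ask V2 V5 (Ask V0 V7
    (Hit Halves V0 V1 V3 V7 V4 V2 V5 V6) (Hit S12 V4 V2 V5 V6 V0 V1 V3 V7)) (Ask V0 V7 (Hit Halves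
    V0 V1 V3 V7 V4 V5 V2 V6) (Hit S12 V4 V5 V2 V6 V0 V1 V3 V7))) (Ask V0 V7 (Ask V3 V5 (Ask V3 V4
    (Ask V3 V6 (Hit Halves V0 V1 V7 V2 V3 V4 V5 V6) (Hit S12 V0 V1 V7 V2 V3 V4 V5 V6)) (Ask V1 V5
    (Ask V0 V6 (Hit Halves V1 V3 V5 V7 V4 V0 V6 V2) (Hit Halves V1 V3 V5 V7 V4 V6 V0 V2)) (Ask V1 V6
    (Hit Halves V4 V0 V2 V3 V5 V1 V6 V7) (Hit Halves V4 V0 V2 V3 V5 V6 V1 V7)))) (Ask V1 V5 (Ask V0
    V6 (Hit Halves V1 V5 V3 V7 V4 V0 V6 V2) (Hit Halves V1 V5 V3 V7 V4 V6 V0 V2)) (Ask V0 V5 (Hit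
    FiveThree V0 V5 V1 V3 V7 V4 V6 V2) (Hit FiveThree V5 V0 V1 V3 V7 V4 V6 V2)))) (Ask V2 V5 (Ask V3
    V5 (Ask V1 V6 (Ask V0 V5 (Ask V3 V6 (Hit Halves V1 V3 V6 V7 V4 V0 V2 V5) (Hit Halves V1 V6 V3 V7
    V4 V0 V2 V5)) (Ask V3 V4 (Hit S12 V1 V6 V7 V2 V3 V4 V5 V0) (Ask V1 V4 (Hit S12 V1 V4 V6 V2 V3 V5
    V7 V0) (Hit FiveThree V4 V0 V1 V2 V3 V5 V6 V7)))) (Ask V0 V6 (Ask V1 V4 (Ask V1 V5 (Hit Halves
    V1 V3 V5 V7 V4 V0 V6 V2) (Ask V3 V4 (Ask V0 V5 (Hit S12 V0 V2 V3 V5 V6 V1 V7 V4) (Hit Seven2 V7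
    V4 V0 V2 V3 V5 V1 V6)) (Hit Halves V4 V0 V2 V3 V5 V6 V1 V7))) (Hit FiveThree V4 V0 V6 V1 V2 V3
    V5 V7)) (Ask V1 V4 (Ask V1 V5 (Hit Halves V1 V3 V5 V7 V4 V6 V0 V2) (Ask V3 V4 (Hit S12 V6 V7 V0
    V2 V1 V3 V4 V5) (Hit Halves V4 V0 V2 V3 V5 V6 V1 V7))) (Hit FiveThree V4 V6 V0 V1 V2 V3 V5
    V7)))) (Ask V1 V5 (Ask V0 V6 (Hit Halves V1 V5 V3 V7 V4 V0 V6 V2) (Hit Halves V1 V5 V3 V7 V4 V6
    V0 V2)) (Ask V0 V6 (Hit Halves V4 V0 V6 V2 V5 V1 V3 V7) (Hit Halves V4 V6 V0 V2 V5 V1 V3 V7))))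
    (Hit S12 V4 V5 V6 V2 V0 V1 V3 V7))))) (Ask V0 V7 (Hit FiveThree V0 V1 V7 V2 V3 V4 V5 V6) (Ask V0
    V5 (Ask V0 V6 (Hit Halves V1 V7 V2 V3 V4 V0 V5 V6) (Ask V1 V6 (Ask V2 V6 (Ask V3 V6 (Hit S12 V1
    V2 V3 V6 V7 V4 V0 V5) (Hit S12 V1 V2 V6 V3 V7 V4 V0 V5)) (Ask V3 V6 (Ask V1 V5 (Ask V1 V4 (Hit
    Halves V1 V4 V5 V6 V7 V0 V2 V3) (Hit Halves V4 V1 V5 V6 V7 V0 V2 V3)) (Ask V1 V4 (Ask V3 V4 (Ask
    V3 V5 (Hit Seven2 V3 V4 V5 V6 V7 V0 V1 V2) (Hit S12 V1 V6 V7 V2 V4 V0 V5 V3)) (Ask V2 V5 (Hit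
    S12 V1 V4 V3 V6 V7 V0 V2 V5) (Hit Halves V5 V1 V6 V2 V7 V4 V0 V3))) (Hit Halves V4 V5 V1 V6 V7
    V0 V2 V3))) (Hit FiveThree V1 V6 V7 V2 V3 V4 V0 V5))) (Ask V1 V4 (Ask V1 V5 (Ask V2 V4 (Ask V3
    V4 (Hit S11 V1 V2 V3 V4 V5 V6 V7 V0) (Hit S12 V1 V2 V4 V3 V5 V6 V7 V0)) (Ask V2 V5 (Ask V3 V6
    (Hit S12 V4 V0 V2 V5 V6 V1 V7 V3) (Hit Halves V1 V4 V2 V5 V6 V7 V0 V3)) (Ask V3 V6 (Hit S12 V4
    V0 V5 V2 V6 V1 V7 V3) (Hit Halves V1 V4 V5 V2 V6 V7 V0 V3)))) (Hit S12 V7 V0 V2 V3 V4 V5 V6 V1))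
    (Ask V1 V5 (Ask V3 V6 (Ask V2 V6 (Hit S11 V4 V0 V1 V5 V7 V2 V3 V6) (Hit S12 V4 V0 V1 V5 V6 V7 V2
    V3)) (Ask V2 V6 (Ask V2 V4 (Ask V3 V5 (Hit S11 V0 V1 V3 V5 V7 V2 V4 V6) (Hit S12 V1 V5 V7 V3 V2
    V4 V6 V0)) (Ask V2 V5 (Hit Halves V4 V0 V2 V5 V6 V1 V7 V3) (Hit Halves V4 V0 V5 V2 V6 V1 V7
    V3))) (Hit Halves V4 V0 V1 V5 V6 V7 V2 V3))) (Hit Halves V4 V5 V6 V1 V7 V0 V2 V3))))) (Ask V0 V6
    (Hit Halves V1 V7 V2 V3 V4 V5 V0 V6) (Hit Halves V1 V7 V2 V3 V4 V5 V6 V0))))) (Hit S11 V0 V1 V2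
    V3 V4 V5 V6 V7))"]) (simp only: resolved decision_simps)


lemma resolves_S9 [resolved]: "resolves S9"
  by (rule resolvesI[where T = "
    Ask V0 V4 (Hit S12 V0 V1 V2 V3 V4 V5 V6 V7) (Ask V2 V7 (Ask V1 V4 (Ask V3 V5 (Ask V2 V4 (Hit S10
    V3 V5 V6 V7 V0 V1 V2 V4) (Ask V0 V7 (Ask V1 V6 (Ask V1 V5 (Hit Halves V0 V2 V3 V7 V1 V4 V5 V6)
    (Ask V0 V5 (Ask V2 V6 (Hit Halves V0 V3 V5 V7 V1 V4 V2 V6) (Hit Halves V0 V3 V5 V7 V1 V4 V6 V2))
    (Ask V2 V6 (Hit S10 V2 V3 V6 V7 V4 V5 V0 V1) (Ask V3 V4 (Ask V1 V7 (Hit Halves V0 V1 V2 V7 V3 V4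
    V5 V6) (Hit S10 V5 V0 V7 V1 V3 V4 V6 V2)) (Ask V0 V6 (Hit Halves V1 V4 V2 V3 V5 V0 V6 V7) (Hit
    Halves V1 V4 V2 V3 V5 V6 V0 V7)))))) (Ask V1 V5 (Hit S12 V0 V2 V3 V7 V1 V4 V5 V6) (Hit S10 V0 V2
    V3 V7 V4 V5 V6 V1))) (Ask V1 V7 (Ask V3 V4 (Ask V2 V5 (Ask V2 V6 (Hit S10 V2 V5 V6 V7 V0 V1 V3
    V4) (Ask V0 V6 (Ask V0 V5 (Hit Halves V1 V2 V3 V7 V4 V0 V5 V6) (Hit Halves V1 V2 V3 V7 V4 V5 V0
    V6)) (Ask V0 V5 (Hit S10 V1 V3 V7 V4 V6 V0 V2 V5) (Hit Halves V1 V2 V3 V7 V4 V5 V6 V0)))) (Ask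
    V2 V6 (Hit S10 V5 V2 V6 V7 V0 V1 V3 V4) (Hit S10 V5 V6 V2 V7 V0 V1 V3 V4))) (Hit S12 V4 V3 V5 V6
    V0 V1 V2 V7)) (Ask V3 V4 (Hit S12 V3 V4 V5 V6 V7 V0 V1 V2) (Ask V2 V5 (Hit S10 V4 V3 V5 V6 V7 V0
    V1 V2) (Ask V0 V5 (Ask V1 V5 (Hit Seven1 V0 V1 V2 V3 V5 V7 V4 V6) (Hit S10 V0 V5 V1 V2 V4 V3 V6
    V7)) (Ask V1 V6 (Hit S10 V4 V5 V0 V2 V1 V3 V6 V7) (Hit S12 V4 V5 V0 V2 V3 V6 V7 V1)))))))) (Ask
    V2 V4 (Hit S10 V5 V3 V6 V7 V0 V1 V2 V4) (Ask V1 V6 (Ask V0 V7 (Ask V0 V5 (Ask V2 V5 (Hit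
    FiveThree V0 V2 V5 V3 V7 V1 V4 V6) (Hit FiveThree V0 V5 V2 V3 V7 V1 V4 V6)) (Ask V2 V6 (Hit
    Halves V1 V4 V2 V6 V5 V0 V3 V7) (Hit Halves V1 V4 V6 V2 V5 V0 V3 V7))) (Ask V1 V5 (Hit S10 V1 V5
    V3 V6 V7 V4 V0 V2) (Hit S10 V5 V1 V3 V6 V7 V4 V0 V2))) (Ask V2 V5 (Ask V0 V6 (Hit S10 V2 V5 V3
    V7 V4 V0 V6 V1) (Hit S10 V2 V5 V3 V7 V4 V6 V0 V1)) (Ask V0 V6 (Hit S10 V5 V2 V3 V7 V4 V0 V6 V1)
    (Hit S10 V5 V2 V3 V7 V4 V6 V0 V1)))))) (Ask V3 V5 (Ask V2 V4 (Ask V2 V6 (Hit S10 V3 V5 V6 V7 V4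
    V0 V1 V2) (Ask V3 V4 (Hit S12 V3 V5 V6 V7 V4 V0 V1 V2) (Ask V2 V5 (Ask V0 V7 (Ask V1 V7 (Hit
    Halves V0 V1 V2 V7 V4 V3 V5 V6) (Ask V1 V5 (Ask V0 V6 (Hit Halves V0 V6 V2 V7 V4 V1 V3 V5) (Hit
    Halves V4 V1 V3 V5 V6 V0 V2 V7)) (Ask V0 V5 (Hit S10 V0 V5 V7 V1 V2 V4 V3 V6) (Hit S10 V5 V0 V7
    V1 V2 V4 V3 V6)))) (Ask V1 V7 (Hit S12 V4 V3 V5 V6 V0 V1 V2 V7) (Hit S10 V4 V3 V5 V6 V7 V0 V1
    V2))) (Hit Halves V4 V0 V1 V3 V5 V6 V2 V7)))) (Hit Halves V3 V5 V6 V7 V4 V0 V1 V2)) (Ask V2 V4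
    (Ask V2 V6 (Hit S10 V5 V3 V6 V7 V4 V0 V1 V2) (Ask V0 V5 (Ask V1 V5 (Hit S10 V0 V1 V5 V3 V6 V2 V7
    V4) (Hit S10 V0 V5 V1 V3 V6 V2 V7 V4)) (Ask V1 V5 (Ask V1 V7 (Ask V0 V6 (Hit Halves V1 V2 V3 V7
    V4 V5 V0 V6) (Hit Halves V1 V2 V3 V7 V4 V5 V6 V0)) (Ask V0 V6 (Hit S10 V5 V0 V3 V6 V2 V7 V4 V1)
    (Hit S12 V4 V5 V6 V0 V1 V2 V3 V7))) (Hit S10 V5 V0 V1 V3 V6 V2 V7 V4)))) (Hit Halves V4 V0 V1 V2
    V5 V3 V6 V7)))) (Hit S10 V0 V1 V2 V3 V4 V5 V6 V7))"]) (simp only: resolved decision_simps)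


lemma resolves_S8 [resolved]: "resolves S8"
  by (rule resolvesI[where T = "
    Ask V0 V4 (Hit S12 V0 V1 V2 V3 V4 V5 V6 V7) (Ask V2 V7 (Ask V3 V6 (Hit S9 V0 V1 V2 V3 V4 V5 V6
    V7) (Ask V0 V5 (Ask V1 V5 (Ask V1 V4 (Ask V1 V6 (Ask V0 V7 (Hit Halves V0 V2 V3 V7 V1 V4 V5 V6)
    (Hit S9 V1 V4 V5 V6 V0 V2 V3 V7)) (Ask V0 V7 (Hit S10 V0 V2 V3 V7 V1 V4 V5 V6) (Ask V2 V5 (Ask
    V0 V6 (Ask V3 V5 (Hit S10 V1 V2 V3 V5 V7 V4 V0 V6) (Hit S10 V2 V5 V3 V7 V4 V0 V6 V1)) (Ask V3 V5
    (Hit S10 V2 V3 V5 V7 V4 V6 V0 V1) (Hit S10 V2 V5 V3 V7 V4 V6 V0 V1))) (Ask V3 V4 (Hit S10 V0 V1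
    V5 V2 V6 V3 V7 V4) (Hit S9 V0 V1 V5 V2 V4 V6 V3 V7))))) (Ask V2 V6 (Hit Halves V2 V6 V3 V7 V4 V0
    V1 V5) (Hit Halves V4 V0 V1 V5 V6 V2 V3 V7))) (Ask V2 V6 (Ask V1 V4 (Hit S10 V2 V6 V3 V7 V4 V0
    V5 V1) (Hit Halves V2 V6 V3 V7 V4 V0 V5 V1)) (Ask V1 V4 (Hit S10 V6 V2 V3 V7 V4 V0 V5 V1) (Hit
    Halves V4 V0 V5 V1 V6 V2 V3 V7)))) (Ask V1 V4 (Ask V2 V6 (Ask V1 V5 (Hit S10 V2 V6 V3 V7 V1 V4
    V5 V0) (Hit S10 V2 V6 V3 V7 V4 V5 V0 V1)) (Ask V1 V5 (Hit S10 V6 V2 V3 V7 V1 V4 V5 V0) (Hit S10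
    V6 V2 V3 V7 V4 V5 V0 V1))) (Ask V1 V7 (Ask V0 V6 (Hit Halves V1 V2 V3 V7 V4 V5 V0 V6) (Hit
    Halves V1 V2 V3 V7 V4 V5 V6 V0)) (Ask V0 V6 (Hit S9 V4 V5 V0 V6 V1 V2 V3 V7) (Hit S12 V4 V5 V6
    V0 V1 V2 V3 V7)))))) (Hit S10 V0 V1 V2 V3 V4 V5 V6 V7))"]) (simp only: resolved decision_simps)


lemma resolves_S7 [resolved]: "resolves S7"
  by (rule resolvesI[where T = "
    Ask V0 V4 (Hit S12 V0 V1 V2 V3 V4 V5 V6 V7) (Ask V2 V7 (Ask V3 V7 (Hit S8 V0 V1 V2 V3 V4 V5 V6
    V7) (Ask V1 V7 (Ask V0 V7 (Hit FiveThree V0 V1 V2 V7 V3 V4 V5 V6) (Ask V0 V6 (Ask V0 V5 (Hit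
    Halves V1 V2 V7 V3 V4 V0 V5 V6) (Hit Halves V1 V2 V7 V3 V4 V5 V0 V6)) (Ask V0 V5 (Ask V3 V6 (Ask
    V3 V5 (Ask V3 V4 (Hit S8 V3 V4 V5 V6 V0 V1 V2 V7) (Hit S8 V4 V3 V5 V6 V0 V1 V2 V7)) (Ask V3 V4
    (Ask V2 V5 (Ask V1 V5 (Hit FiveThree V1 V2 V5 V7 V3 V4 V6 V0) (Ask V2 V6 (Ask V1 V4 (Hit S8 V1
    V7 V3 V4 V0 V2 V5 V6) (Hit S8 V2 V5 V6 V7 V4 V0 V1 V3)) (Ask V2 V4 (Hit S8 V0 V5 V1 V3 V6 V2 V7
    V4) (Hit Halves V4 V6 V0 V2 V5 V1 V7 V3)))) (Ask V1 V5 (Hit FiveThree V1 V5 V2 V7 V3 V4 V6 V0)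
    (Hit FiveThree V5 V1 V2 V7 V3 V4 V6 V0))) (Hit S8 V4 V5 V3 V6 V0 V1 V2 V7))) (Ask V1 V6 (Ask V2
    V6 (Hit FiveThree V1 V2 V6 V7 V3 V4 V0 V5) (Hit FiveThree V1 V6 V2 V7 V3 V4 V0 V5)) (Ask V2 V6
    (Ask V2 V4 (Ask V1 V5 (Ask V3 V4 (Hit S8 V2 V7 V3 V4 V6 V0 V1 V5) (Hit S12 V2 V7 V4 V3 V6 V0 V1
    V5)) (Ask V1 V4 (Hit S10 V2 V6 V7 V3 V4 V0 V5 V1) (Hit Halves V2 V6 V7 V3 V4 V0 V5 V1))) (Ask V2
    V5 (Hit Halves V4 V0 V2 V5 V6 V1 V7 V3) (Hit Halves V4 V0 V5 V2 V6 V1 V7 V3))) (Hit FiveThree V6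
    V1 V2 V7 V3 V4 V0 V5)))) (Hit Halves V1 V2 V7 V3 V4 V5 V6 V0)))) (Ask V2 V6 (Ask V2 V5 (Ask V2
    V4 (Ask V0 V7 (Hit Halves V0 V7 V1 V3 V2 V4 V5 V6) (Hit Halves V2 V4 V5 V6 V7 V0 V1 V3)) (Ask V0
    V7 (Hit Halves V0 V7 V1 V3 V4 V2 V5 V6) (Hit Halves V4 V2 V5 V6 V7 V0 V1 V3))) (Ask V1 V4 (Ask
    V3 V4 (Hit S8 V5 V2 V6 V7 V0 V1 V3 V4) (Ask V0 V5 (Ask V0 V6 (Hit Halves V0 V5 V2 V6 V7 V1 V4
    V3) (Ask V0 V7 (Ask V1 V6 (Ask V3 V6 (Hit Halves V0 V5 V2 V7 V1 V4 V3 V6) (Hit Halves V0 V5 V2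
    V7 V1 V4 V6 V3)) (Ask V1 V5 (Hit S10 V0 V2 V7 V3 V1 V4 V5 V6) (Ask V3 V6 (Hit S8 V0 V5 V1 V2 V7
    V4 V3 V6) (Ask V2 V4 (Hit Halves V0 V5 V7 V1 V2 V4 V6 V3) (Hit Halves V0 V5 V7 V1 V4 V2 V6
    V3))))) (Hit S12 V7 V1 V4 V3 V0 V5 V2 V6))) (Ask V0 V6 (Hit Halves V5 V0 V2 V6 V7 V1 V4 V3) (Ask
    V0 V7 (Ask V2 V4 (Hit Halves V1 V2 V4 V3 V5 V6 V0 V7) (Hit Halves V0 V7 V1 V3 V4 V5 V2 V6)) (Ask
    V2 V4 (Hit Halves V1 V2 V4 V3 V5 V6 V7 V0) (Hit Halves V1 V4 V2 V3 V5 V6 V7 V0)))))) (Ask V3 V4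
    (Hit S8 V5 V2 V6 V7 V4 V0 V1 V3) (Hit Halves V4 V0 V1 V3 V5 V2 V6 V7)))) (Ask V2 V5 (Ask V2 V4
    (Ask V0 V7 (Hit S12 V0 V7 V1 V3 V2 V4 V5 V6) (Ask V3 V6 (Hit S8 V7 V0 V1 V3 V2 V4 V5 V6) (Ask V1
    V6 (Ask V3 V5 (Ask V3 V4 (Ask V0 V6 (Hit S8 V0 V1 V6 V2 V7 V3 V4 V5) (Ask V1 V4 (Hit S10 V2 V3
    V4 V5 V6 V7 V0 V1) (Ask V1 V5 (Hit S8 V6 V0 V2 V3 V7 V4 V1 V5) (Hit S8 V2 V3 V4 V5 V6 V7 V0
    V1)))) (Ask V0 V6 (Hit S8 V0 V1 V6 V2 V7 V4 V3 V5) (Hit S10 V2 V4 V3 V5 V6 V7 V0 V1))) (Ask V1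
    V5 (Hit S12 V1 V5 V6 V3 V2 V7 V4 V0) (Ask V0 V5 (Ask V0 V6 (Hit FiveThree V0 V5 V1 V6 V3 V2 V7
    V4) (Ask V1 V4 (Hit Seven4 V0 V1 V2 V4 V5 V6 V7 V3) (Hit Halves V4 V0 V5 V1 V6 V2 V7 V3))) (Hit
    S12 V5 V0 V1 V3 V6 V2 V7 V4)))) (Hit S10 V7 V0 V1 V3 V2 V4 V5 V6)))) (Ask V3 V5 (Ask V0 V6 (Ask
    V1 V5 (Hit S8 V4 V0 V6 V2 V7 V1 V3 V5) (Hit S8 V4 V0 V6 V2 V5 V7 V1 V3)) (Ask V1 V5 (Hit S8 V4
    V6 V0 V2 V7 V1 V3 V5) (Hit S8 V4 V6 V0 V2 V5 V7 V1 V3))) (Ask V0 V5 (Ask V1 V5 (Ask V1 V6 (Ask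
    V3 V6 (Hit S8 V4 V0 V2 V5 V7 V1 V3 V6) (Ask V1 V4 (Ask V0 V7 (Hit Halves V0 V2 V7 V3 V1 V4 V5
    V6) (Ask V0 V6 (Hit Seven1 V0 V1 V2 V5 V6 V7 V4 V3) (Hit Halves V1 V4 V2 V5 V6 V7 V0 V3))) (Hit
    Halves V4 V0 V1 V2 V5 V6 V7 V3))) (Ask V3 V6 (Hit S8 V4 V0 V2 V5 V6 V7 V1 V3) (Hit Halves V4 V0
    V2 V5 V6 V7 V1 V3))) (Hit S10 V0 V5 V1 V3 V4 V6 V2 V7)) (Ask V1 V5 (Ask V1 V4 (Ask V0 V6 (Ask V3
    V6 (Hit S8 V5 V0 V3 V6 V7 V1 V4 V2) (Hit S12 V5 V0 V6 V3 V7 V1 V4 V2)) (Ask V3 V4 (Hit S8 V7 V1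
    V3 V4 V5 V6 V0 V2) (Ask V0 V7 (Hit Halves V1 V4 V2 V3 V5 V6 V0 V7) (Hit Halves V1 V4 V2 V3 V5 V6
    V7 V0)))) (Ask V3 V6 (Ask V0 V6 (Hit S8 V5 V0 V3 V6 V7 V4 V1 V2) (Ask V0 V7 (Hit S8 V4 V1 V2 V5
    V6 V0 V7 V3) (Hit S8 V4 V1 V2 V5 V6 V7 V0 V3))) (Hit Halves V4 V0 V1 V2 V5 V6 V7 V3))) (Hit S10
    V5 V0 V1 V3 V4 V6 V2 V7))))) (Ask V1 V4 (Ask V3 V4 (Hit S8 V5 V6 V2 V7 V0 V1 V3 V4) (Ask V0 V7
    (Ask V0 V5 (Ask V1 V6 (Ask V3 V5 (Hit S8 V4 V0 V3 V5 V1 V6 V2 V7) (Hit FiveThree V0 V5 V2 V7 V3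
    V1 V4 V6)) (Ask V1 V5 (Hit S10 V0 V2 V7 V3 V1 V4 V5 V6) (Ask V3 V6 (Hit S10 V0 V5 V1 V2 V7 V4 V3
    V6) (Ask V0 V6 (Hit Halves V0 V5 V6 V2 V7 V1 V4 V3) (Ask V2 V4 (Hit Seven1 V0 V5 V1 V2 V7 V4 V6
    V3) (Hit Halves V0 V5 V7 V1 V4 V6 V2 V3)))))) (Ask V0 V6 (Hit Halves V5 V0 V6 V2 V7 V1 V4 V3)
    (Hit Halves V5 V6 V0 V2 V7 V1 V4 V3))) (Ask V2 V4 (Hit S12 V7 V0 V1 V3 V4 V5 V6 V2) (Hit Halves
    V4 V5 V6 V2 V7 V0 V1 V3)))) (Ask V3 V4 (Hit S8 V5 V6 V2 V7 V4 V0 V1 V3) (Hit Halves V4 V0 V1 V3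
    V5 V6 V2 V7))))))) (Hit S10 V0 V1 V2 V3 V4 V5 V6 V7))"]) (simp only: resolved decision_simps)


lemma resolves_S6 [resolved]: "resolves S6"
  by (rule resolvesI[where T = "
    Ask V1 V4 (Ask V3 V4 (Ask V3 V5 (Ask V3 V6 (Ask V3 V7 (Hit Halves V0 V1 V4 V2 V3 V5 V6 V7) (Hit
    S7 V0 V1 V4 V2 V3 V5 V6 V7)) (Ask V3 V7 (Ask V2 V6 (Ask V2 V5 (Ask V2 V7 (Hit Halves V0 V1 V3 V4
    V2 V5 V6 V7) (Hit S7 V0 V1 V3 V4 V2 V5 V6 V7)) (Ask V1 V6 (Ask V0 V6 (Hit Halves V0 V1 V2 V6 V3
    V4 V5 V7) (Hit S7 V3 V4 V5 V7 V0 V1 V2 V6)) (Ask V2 V7 (Hit Halves V0 V1 V3 V4 V5 V2 V6 V7) (Ask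
    V0 V6 (Hit Halves V0 V6 V1 V3 V4 V5 V7 V2) (Hit Halves V4 V5 V7 V2 V6 V0 V1 V3))))) (Ask V0 V6
    (Ask V1 V6 (Hit Halves V0 V1 V6 V2 V3 V4 V5 V7) (Hit Halves V0 V6 V1 V2 V3 V4 V5 V7)) (Ask V1 V5
    (Ask V1 V7 (Hit Halves V1 V3 V5 V7 V6 V0 V4 V2) (Hit S7 V6 V0 V2 V3 V1 V4 V5 V7)) (Ask V1 V7
    (Ask V2 V5 (Ask V0 V5 (Hit S7 V1 V3 V4 V7 V6 V0 V2 V5) (Hit S7 V1 V3 V4 V7 V5 V6 V0 V2)) (Ask V2
    V7 (Hit Halves V0 V1 V3 V4 V5 V6 V2 V7) (Hit Halves V0 V1 V3 V4 V5 V6 V7 V2))) (Hit S7 V6 V0 V2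
    V3 V4 V5 V7 V1))))) (Hit S7 V0 V1 V4 V2 V5 V6 V7 V3))) (Ask V3 V7 (Ask V3 V6 (Hit Halves V0 V1
    V4 V2 V5 V3 V6 V7) (Hit Halves V0 V1 V4 V2 V5 V6 V3 V7)) (Ask V3 V6 (Ask V2 V6 (Ask V2 V5 (Ask
    V2 V7 (Hit Halves V0 V1 V3 V4 V2 V5 V6 V7) (Hit S7 V0 V1 V3 V4 V2 V5 V6 V7)) (Ask V0 V7 (Ask V1
    V7 (Hit Halves V0 V1 V4 V7 V5 V2 V3 V6) (Hit S7 V0 V7 V1 V3 V4 V5 V2 V6)) (Ask V1 V7 (Hit S7 V5
    V2 V3 V6 V0 V1 V4 V7) (Hit S7 V5 V2 V3 V6 V7 V0 V1 V4)))) (Ask V1 V6 (Ask V0 V6 (Hit FiveThree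
    V0 V1 V6 V4 V2 V5 V7 V3) (Ask V2 V7 (Ask V2 V5 (Hit S7 V4 V2 V5 V7 V0 V1 V3 V6) (Hit Halves V0
    V1 V3 V4 V5 V6 V2 V7)) (Ask V2 V5 (Hit S7 V0 V1 V3 V4 V5 V6 V7 V2) (Hit Halves V0 V1 V3 V4 V5 V6
    V7 V2)))) (Ask V0 V6 (Hit FiveThree V0 V6 V1 V4 V2 V5 V7 V3) (Hit FiveThree V6 V0 V1 V4 V2 V5 V7
    V3)))) (Hit Halves V0 V1 V4 V2 V5 V6 V7 V3)))) (Hit FiveThree V0 V1 V4 V2 V3 V5 V6 V7)) (Ask V3
    V4 (Ask V3 V5 (Ask V3 V6 (Ask V3 V7 (Hit Halves V0 V4 V1 V2 V3 V5 V6 V7) (Hit S7 V0 V4 V1 V2 V3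
    V5 V6 V7)) (Ask V3 V7 (Ask V0 V6 (Ask V1 V6 (Ask V2 V6 (Hit Halves V0 V1 V2 V6 V3 V4 V5 V7) (Hit
    Halves V0 V1 V6 V2 V3 V4 V5 V7)) (Ask V2 V5 (Ask V2 V7 (Hit Halves V0 V6 V1 V3 V4 V2 V5 V7) (Hit
    S7 V0 V6 V4 V1 V2 V3 V5 V7)) (Ask V2 V7 (Hit Halves V0 V6 V1 V3 V4 V5 V2 V7) (Hit Halves V0 V6
    V1 V3 V4 V5 V7 V2)))) (Ask V2 V6 (Ask V1 V6 (Hit S7 V3 V4 V5 V7 V0 V1 V2 V6) (Hit S7 V3 V4 V5 V7
    V6 V0 V1 V2)) (Ask V1 V6 (Ask V0 V5 (Ask V0 V7 (Hit Halves V0 V4 V5 V7 V1 V6 V2 V3) (Hit S7 V1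
    V6 V2 V3 V0 V4 V5 V7)) (Ask V0 V7 (Hit S7 V5 V6 V0 V7 V4 V1 V2 V3) (Hit S7 V1 V6 V2 V3 V4 V5 V7
    V0))) (Hit Halves V3 V4 V5 V7 V6 V0 V1 V2)))) (Hit S7 V0 V4 V1 V2 V5 V6 V7 V3))) (Ask V3 V6 (Ask
    V3 V7 (Hit Halves V0 V4 V1 V2 V5 V3 V6 V7) (Ask V0 V5 (Ask V1 V5 (Ask V2 V5 (Hit FiveThree V0 V1
    V2 V5 V3 V6 V4 V7) (Hit FiveThree V0 V1 V5 V2 V3 V6 V4 V7)) (Ask V2 V5 (Ask V1 V7 (Ask V2 V6
    (Ask V0 V6 (Hit Halves V0 V2 V3 V6 V4 V5 V1 V7) (Hit S7 V4 V5 V1 V7 V0 V2 V3 V6)) (Ask V2 V7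
    (Hit Halves V0 V5 V1 V3 V6 V4 V2 V7) (Hit Halves V0 V5 V1 V3 V6 V4 V7 V2))) (Ask V1 V6 (Hit S7
    V0 V2 V5 V3 V6 V4 V7 V1) (Hit Halves V0 V2 V5 V3 V6 V4 V7 V1))) (Hit FiveThree V0 V5 V1 V2 V3 V6
    V4 V7))) (Ask V0 V6 (Ask V1 V6 (Ask V2 V6 (Hit FiveThree V0 V1 V2 V3 V6 V4 V5 V7) (Hit S7 V0 V1
    V6 V2 V4 V5 V7 V3)) (Ask V2 V6 (Ask V0 V7 (Hit S7 V5 V0 V6 V7 V4 V1 V2 V3) (Hit S7 V5 V7 V0 V3
    V6 V4 V1 V2)) (Hit FiveThree V0 V6 V4 V1 V2 V5 V7 V3))) (Ask V0 V7 (Hit S7 V5 V6 V0 V7 V4 V1 V2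
    V3) (Hit S7 V5 V6 V7 V0 V4 V1 V2 V3))))) (Ask V3 V7 (Hit Halves V0 V4 V1 V2 V5 V6 V3 V7) (Hit
    Halves V0 V4 V1 V2 V5 V6 V7 V3)))) (Hit FiveThree V0 V4 V1 V2 V3 V5 V6 V7))"]) (simp only: resolved decision_simps)


lemma resolves_S5 [resolved]: "resolves S5"
  by (rule resolvesI[where T = "
    Ask V2 V4 (Ask V3 V4 (Ask V1 V4 (Hit FiveThree V0 V1 V2 V3 V4 V5 V6 V7) (Ask V1 V5 (Ask V1 V7
    (Ask V1 V6 (Hit Halves V0 V2 V3 V4 V1 V5 V6 V7) (Hit S6 V0 V2 V3 V4 V1 V5 V6 V7)) (Ask V1 V6
    (Hit S7 V0 V2 V3 V4 V1 V5 V6 V7) (Hit S7 V0 V2 V3 V4 V5 V6 V7 V1))) (Ask V1 V6 (Ask V1 V7 (Hit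
    Halves V0 V2 V3 V4 V5 V1 V6 V7) (Ask V0 V5 (Ask V2 V5 (Ask V3 V5 (Hit S7 V0 V2 V3 V5 V6 V4 V7
    V1) (Hit S7 V0 V2 V5 V3 V6 V4 V7 V1)) (Hit S6 V0 V1 V2 V3 V5 V6 V4 V7)) (Ask V0 V6 (Ask V2 V6
    (Ask V3 V6 (Hit Halves V0 V2 V3 V6 V4 V5 V7 V1) (Hit Halves V0 V2 V6 V3 V4 V5 V7 V1)) (Hit S6 V0
    V1 V2 V3 V6 V4 V5 V7)) (Ask V0 V7 (Hit S7 V5 V6 V0 V7 V1 V2 V3 V4) (Hit S7 V5 V6 V7 V0 V1 V2 V3
    V4))))) (Ask V1 V7 (Hit Halves V0 V2 V3 V4 V5 V6 V1 V7) (Hit Halves V0 V2 V3 V4 V5 V6 V7 V1)))))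
    (Ask V1 V4 (Hit FiveThree V0 V1 V2 V4 V3 V5 V6 V7) (Ask V2 V6 (Ask V2 V5 (Ask V2 V7 (Hit Halves
    V0 V4 V1 V3 V2 V5 V6 V7) (Hit S7 V0 V4 V1 V3 V2 V5 V6 V7)) (Ask V2 V7 (Hit Halves V0 V4 V1 V3 V5
    V2 V6 V7) (Ask V0 V5 (Hit S6 V0 V1 V2 V3 V5 V6 V4 V7) (Ask V1 V6 (Ask V3 V6 (Ask V0 V7 (Hit S7
    V5 V0 V7 V2 V4 V1 V3 V6) (Hit S7 V1 V2 V3 V6 V4 V5 V7 V0)) (Ask V0 V7 (Hit S6 V5 V0 V7 V2 V6 V4
    V1 V3) (Hit S7 V1 V2 V6 V3 V4 V5 V7 V0))) (Ask V1 V7 (Ask V3 V5 (Hit S7 V6 V4 V1 V7 V5 V0 V2 V3)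
    (Hit Halves V5 V0 V2 V3 V6 V4 V1 V7)) (Ask V3 V5 (Hit S7 V6 V4 V7 V1 V5 V0 V2 V3) (Hit Halves V5
    V0 V2 V3 V6 V4 V7 V1))))))) (Ask V0 V6 (Hit S6 V0 V1 V2 V3 V6 V4 V5 V7) (Ask V2 V5 (Ask V2 V7
    (Ask V1 V5 (Ask V3 V5 (Ask V0 V5 (Hit Halves V0 V1 V3 V5 V6 V2 V4 V7) (Hit S7 V6 V2 V4 V7 V0 V1
    V3 V5)) (Ask V0 V5 (Hit Halves V0 V1 V5 V3 V6 V2 V4 V7) (Hit S6 V6 V2 V4 V7 V0 V1 V5 V3))) (Ask
    V1 V7 (Ask V3 V6 (Hit S7 V4 V5 V1 V7 V6 V0 V2 V3) (Hit Halves V4 V5 V1 V7 V6 V0 V2 V3)) (Ask V3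
    V6 (Hit S7 V4 V5 V7 V1 V6 V0 V2 V3) (Hit Halves V4 V5 V7 V1 V6 V0 V2 V3)))) (Hit S7 V0 V4 V1 V3
    V5 V6 V7 V2)) (Ask V2 V7 (Hit Halves V0 V4 V1 V3 V5 V6 V2 V7) (Hit Halves V0 V4 V1 V3 V5 V6 V7
    V2))))))) (Hit S6 V0 V1 V2 V3 V4 V5 V6 V7)"]) (simp only: resolved decision_simps)


lemma resolves_S4 [resolved]: "resolves S4"
  by (rule resolvesI[where T = "
    Ask V0 V4 (Hit S5 V0 V1 V2 V3 V4 V5 V6 V7) (Ask V0 V6 (Hit S5 V0 V1 V2 V3 V6 V4 V5 V7) (Ask V0
    V5 (Hit S5 V0 V1 V2 V3 V5 V6 V4 V7) (Ask V2 V6 (Ask V1 V6 (Ask V3 V6 (Ask V0 V7 (Hit Halves V1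
    V2 V3 V6 V4 V5 V0 V7) (Hit Halves V1 V2 V3 V6 V4 V5 V7 V0)) (Ask V0 V7 (Hit Halves V1 V2 V6 V3
    V4 V5 V0 V7) (Hit Halves V1 V2 V6 V3 V4 V5 V7 V0))) (Ask V0 V7 (Ask V3 V6 (Hit S7 V4 V5 V0 V7 V1
    V2 V3 V6) (Ask V2 V4 (Ask V2 V5 (Ask V1 V4 (Ask V3 V4 (Hit Halves V1 V2 V3 V4 V5 V6 V0 V7) (Hit
    Halves V1 V2 V4 V3 V5 V6 V0 V7)) (Hit S5 V4 V5 V0 V7 V1 V2 V6 V3)) (Ask V2 V7 (Hit S5 V6 V0 V1
    V3 V4 V5 V2 V7) (Hit S7 V6 V0 V1 V3 V4 V5 V7 V2))) (Hit S5 V4 V5 V0 V7 V2 V6 V1 V3))) (Ask V3 V6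
    (Hit S7 V4 V5 V7 V0 V1 V2 V3 V6) (Ask V2 V4 (Ask V1 V4 (Ask V3 V4 (Hit Halves V1 V2 V3 V4 V5 V6
    V7 V0) (Hit Halves V1 V2 V4 V3 V5 V6 V7 V0)) (Hit S5 V4 V5 V7 V0 V1 V2 V6 V3)) (Hit S5 V4 V5 V7
    V0 V2 V6 V1 V3))))) (Ask V1 V5 (Ask V2 V7 (Ask V3 V5 (Ask V2 V4 (Hit S7 V6 V2 V4 V7 V0 V1 V3 V5)
    (Hit S7 V6 V4 V2 V7 V0 V1 V3 V5)) (Ask V2 V4 (Hit S5 V6 V2 V4 V7 V0 V1 V5 V3) (Hit S5 V6 V4 V2
    V7 V0 V1 V5 V3))) (Ask V3 V5 (Ask V0 V7 (Ask V2 V4 (Ask V3 V4 (Ask V1 V4 (Hit Halves V1 V2 V3 V4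
    V5 V6 V0 V7) (Hit S5 V6 V0 V7 V2 V4 V1 V3 V5)) (Ask V1 V4 (Hit Halves V1 V2 V4 V3 V5 V6 V0 V7)
    (Hit Halves V4 V1 V3 V5 V6 V0 V7 V2))) (Hit FiveThree V6 V4 V0 V7 V2 V1 V3 V5)) (Ask V1 V4 (Ask
    V3 V4 (Hit Halves V1 V3 V4 V5 V6 V7 V0 V2) (Hit Halves V1 V4 V3 V5 V6 V7 V0 V2)) (Ask V3 V4 (Hit
    S5 V6 V7 V0 V2 V4 V1 V3 V5) (Hit Halves V4 V1 V3 V5 V6 V7 V0 V2)))) (Ask V0 V7 (Ask V2 V5 (Hit
    Halves V1 V2 V5 V3 V6 V4 V0 V7) (Hit Halves V1 V5 V2 V3 V6 V4 V0 V7)) (Ask V2 V5 (Hit Halves V1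
    V2 V5 V3 V6 V4 V7 V0) (Hit Halves V1 V5 V2 V3 V6 V4 V7 V0))))) (Ask V3 V5 (Ask V0 V7 (Ask V2 V5
    (Hit S7 V6 V4 V0 V7 V1 V2 V3 V5) (Hit S7 V6 V4 V0 V7 V5 V1 V2 V3)) (Ask V2 V5 (Hit S7 V6 V4 V7
    V0 V1 V2 V3 V5) (Hit S7 V6 V4 V7 V0 V5 V1 V2 V3))) (Ask V2 V5 (Ask V0 V7 (Hit S5 V6 V4 V0 V7 V2
    V5 V1 V3) (Hit S5 V6 V4 V7 V0 V2 V5 V1 V3)) (Hit FiveThree V5 V0 V1 V2 V3 V6 V4 V7)))))))"]) (simp only: resolved decision_simps)


lemma resolves_S3 [resolved]: "resolves S3"
  by (rule resolvesI[where T = "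
    Ask V0 V4 (Ask V1 V4 (Ask V3 V4 (Ask V2 V6 (Ask V2 V7 (Hit S4 V0 V1 V3 V4 V2 V7 V5 V6) (Hit
    Halves V0 V1 V3 V4 V7 V5 V2 V6)) (Ask V2 V7 (Hit S7 V0 V1 V3 V4 V7 V5 V6 V2) (Hit Halves V0 V1
    V3 V4 V7 V5 V6 V2))) (Hit FiveThree V0 V1 V4 V2 V3 V7 V5 V6)) (Ask V3 V4 (Ask V3 V6 (Ask V3 V7
    (Ask V3 V5 (Hit Halves V0 V4 V1 V2 V3 V7 V5 V6) (Hit S4 V0 V4 V1 V2 V3 V7 V5 V6)) (Ask V3 V5
    (Hit Halves V0 V4 V1 V2 V7 V3 V5 V6) (Hit Halves V0 V4 V1 V2 V7 V5 V3 V6))) (Ask V3 V7 (Ask V3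
    V5 (Hit S7 V0 V4 V1 V2 V3 V7 V5 V6) (Hit S7 V0 V4 V1 V2 V7 V5 V6 V3)) (Ask V1 V5 (Ask V0 V5 (Hit
    Halves V0 V1 V5 V2 V7 V6 V3 V4) (Hit S4 V7 V6 V3 V4 V0 V1 V5 V2)) (Ask V0 V5 (Hit Halves V0 V5
    V1 V2 V7 V6 V3 V4) (Hit Halves V5 V0 V1 V2 V7 V6 V3 V4))))) (Hit FiveThree V0 V4 V1 V2 V3 V7 V5
    V6))) (Ask V3 V6 (Ask V3 V7 (Ask V3 V5 (Ask V1 V4 (Hit S4 V3 V7 V5 V6 V0 V1 V4 V2) (Hit Halves
    V3 V7 V5 V6 V4 V0 V1 V2)) (Ask V0 V5 (Ask V1 V5 (Hit FiveThree V0 V1 V5 V2 V3 V7 V6 V4) (Hit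
    FiveThree V0 V5 V1 V2 V3 V7 V6 V4)) (Ask V1 V6 (Ask V1 V7 (Hit Halves V1 V3 V7 V6 V4 V5 V0 V2)
    (Hit S4 V4 V5 V0 V2 V1 V3 V7 V6)) (Ask V1 V7 (Hit S7 V4 V5 V0 V2 V1 V3 V7 V6) (Hit S7 V4 V5 V0
    V2 V3 V7 V6 V1))))) (Ask V1 V4 (Ask V3 V5 (Hit S4 V7 V3 V5 V6 V0 V1 V4 V2) (Hit S4 V7 V5 V3 V6
    V0 V1 V4 V2)) (Ask V3 V5 (Hit Halves V4 V0 V1 V2 V7 V3 V5 V6) (Hit Halves V4 V0 V1 V2 V7 V5 V3
    V6)))) (Ask V1 V6 (Ask V2 V6 (Ask V0 V7 (Ask V0 V5 (Hit S4 V1 V2 V6 V3 V0 V7 V4 V5) (Hit S7 V1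
    V2 V6 V3 V7 V4 V5 V0)) (Ask V0 V5 (Hit Halves V1 V2 V6 V3 V7 V4 V0 V5) (Hit Halves V1 V2 V6 V3
    V7 V4 V5 V0))) (Ask V0 V5 (Ask V0 V7 (Hit S4 V1 V6 V2 V3 V0 V7 V4 V5) (Hit Halves V1 V6 V2 V3 V7
    V4 V0 V5)) (Ask V0 V7 (Hit S7 V1 V6 V2 V3 V7 V4 V5 V0) (Hit Halves V1 V6 V2 V3 V7 V4 V5 V0))))
    (Ask V0 V6 (Ask V2 V7 (Hit S7 V0 V6 V1 V3 V7 V4 V5 V2) (Hit Halves V0 V6 V1 V3 V7 V4 V5 V2))
    (Ask V2 V7 (Hit S7 V6 V0 V1 V3 V7 V4 V5 V2) (Hit Halves V6 V0 V1 V3 V7 V4 V5 V2)))))"]) (simp only: resolved decision_simps)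


lemma resolves_S2 [resolved]: "resolves S2"
  by (rule resolvesI[where T = "
    Ask V2 V6 (Ask V2 V5 (Ask V1 V4 (Ask V0 V4 (Ask V3 V4 (Ask V2 V7 (Hit Halves V0 V1 V3 V4 V2 V7
    V5 V6) (Hit Halves V0 V1 V3 V4 V7 V2 V5 V6)) (Hit FiveThree V0 V1 V4 V2 V3 V7 V5 V6)) (Ask V2 V7
    (Ask V3 V4 (Hit S7 V2 V7 V5 V6 V0 V1 V3 V4) (Hit S4 V2 V7 V5 V6 V0 V1 V4 V3)) (Ask V3 V4 (Hit S7
    V7 V2 V5 V6 V0 V1 V3 V4) (Hit S4 V7 V2 V5 V6 V0 V1 V4 V3)))) (Ask V0 V4 (Ask V3 V4 (Ask V3 V5
    (Ask V2 V7 (Hit S3 V2 V7 V5 V6 V3 V4 V1 V0) (Hit S3 V7 V2 V5 V6 V3 V4 V1 V0)) (Ask V3 V6 (Ask V3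
    V7 (Hit S4 V0 V4 V1 V2 V3 V7 V5 V6) (Hit Halves V0 V4 V1 V2 V7 V5 V3 V6)) (Ask V3 V7 (Hit S7 V0
    V4 V1 V2 V7 V5 V6 V3) (Hit Halves V0 V4 V1 V2 V7 V5 V6 V3)))) (Hit FiveThree V0 V4 V1 V2 V3 V7
    V5 V6)) (Ask V3 V4 (Ask V2 V7 (Hit S7 V2 V7 V5 V6 V4 V0 V1 V3) (Hit S7 V7 V2 V5 V6 V4 V0 V1 V3))
    (Hit FiveThree V4 V0 V1 V2 V3 V7 V5 V6)))) (Hit S3 V0 V1 V2 V3 V4 V5 V6 V7)) (Hit S3 V0 V1 V2 V3
    V6 V4 V5 V7)"]) (simp only: resolved decision_simps)


lemma resolves_S1 [resolved]: "resolves S1"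
  by (rule resolvesI[where T = "
    Ask V2 V6 (Ask V2 V5 (Ask V2 V4 (Ask V3 V5 (Ask V1 V5 (Ask V0 V5 (Hit FiveThree V0 V1 V2 V3 V5
    V7 V6 V4) (Ask V2 V7 (Hit S7 V2 V7 V6 V4 V0 V1 V3 V5) (Hit S7 V7 V2 V6 V4 V0 V1 V3 V5))) (Ask V0
    V5 (Ask V2 V7 (Hit S2 V2 V7 V6 V4 V5 V1 V3 V0) (Hit S2 V7 V2 V6 V4 V5 V1 V3 V0)) (Ask V2 V7 (Hit
    S7 V2 V7 V6 V4 V5 V0 V1 V3) (Hit S7 V7 V2 V6 V4 V5 V0 V1 V3)))) (Ask V0 V5 (Ask V1 V5 (Hit
    FiveThree V0 V1 V2 V5 V3 V7 V6 V4) (Ask V2 V7 (Hit Halves V0 V5 V1 V3 V2 V7 V6 V4) (Hit Halves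
    V0 V5 V1 V3 V7 V2 V6 V4))) (Ask V2 V7 (Ask V1 V5 (Hit S4 V2 V7 V6 V4 V0 V1 V5 V3) (Hit Halves V2
    V7 V6 V4 V5 V0 V1 V3)) (Ask V1 V5 (Hit S4 V7 V2 V6 V4 V0 V1 V5 V3) (Hit Halves V5 V0 V1 V3 V7 V2
    V6 V4))))) (Hit S2 V0 V1 V2 V3 V4 V5 V6 V7)) (Hit S2 V0 V1 V2 V3 V5 V6 V4 V7)) (Hit S2 V0 V1 V2
    V3 V6 V4 V5 V7)"]) (simp only: resolved decision_simps)


lemma resolves_S0 [resolved]: "resolves S0"
  by (rule resolvesI[where T = "
    Ask V4 V7 (Ask V6 V7 (Ask V5 V7 (Hit S4 V0 V1 V2 V3 V4 V5 V6 V7) (Hit S7 V0 V1 V2 V3 V6 V4 V7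
    V5)) (Ask V5 V7 (Hit S7 V0 V1 V2 V3 V4 V5 V7 V6) (Hit S7 V0 V1 V2 V3 V4 V7 V5 V6))) (Ask V5 V7
    (Ask V6 V7 (Hit S7 V0 V1 V2 V3 V5 V6 V7 V4) (Hit S7 V0 V1 V2 V3 V5 V7 V6 V4)) (Ask V6 V7 (Hit S7
    V0 V1 V2 V3 V6 V7 V4 V5) (Hit S1 V0 V1 V2 V3 V4 V5 V6 V7)))"]) (simp only: resolved decision_simps)


section \<open>Classification of critical tournaments\<close>

text \<open>
  Insertion into a transitively ordered list: absence of triangles lets every in-neighbour of the new
  vertex dominate every out-neighbour, hence the new vertex fits between them.
\<close>

lemma triangle_free_sorted:
  assumes "oriented t" "finite A" "triangle_free t A"
  shows "\<exists>vs. set vs = A \<and> distinct vs \<and> sorted_wrt t vs"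
  using assms(2,3)
proof (induction A rule: finite_induct)
  case empty
  then show ?case by simp
next
  case (insert v A)
  have "triangle_free t A" using insert.prems by (rule triangle_free_mono) auto
  then obtain vs where vs: "set vs = A" "distinct vs" "sorted_wrt t vs" using insert.IH by blast
  let ?us = "filter (\<lambda>u. t u v) vs @ v # filter (\<lambda>u. \<not> t u v) vs"
  have o: "t x y \<longleftrightarrow> x \<noteq> y \<and> \<not> t y x" for x y using assms(1) unfolding oriented_def by blast
  have after: "t v u" if "u \<in> A" "\<not> t u v" for u using that insert.hyps(2) o by blast
  have across: "t x y" if "x \<in> A" "t x v" "y \<in> A" "\<not> t y v" for x y
    using that after[of y] insert.prems o unfolding triangle_free_def by (metis insertCI)
  have "sorted_wrt t ?us"
    using vs(1,3) after across by (auto simp: sorted_wrt_append sorted_wrt_filter)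
  moreover have "set ?us = insert v A" "distinct ?us" using vs insert.hyps(2) by auto
  ultimately show ?case by blast
qed

text \<open>
  Deleting a vertex leaves seven vertices in two transitive parts, one of which has four vertices or
  more. Four of these form a transitive tournament, and the complementary four vertices cannot be
  transitive too, for this would split the whole tournament; so they contain a cyclic triangle.
\<close>

lemma critical_occurs_S0:
  assumes "critical t"
  shows "occurs (pat S0) t"
proof -
  have t: "oriented t" "\<not> splittable t UNIV" "splittable t (- {V0})"
    using assms unfolding critical_def by blast+
  then obtain A B where AB: "- {V0} \<subseteq> A \<union> B" "triangle_free t A" "triangle_free t B"
    unfolding splittable_def by blast
  have "card (- {V0}) = 7" by (simp add: card_vtx Compl_eq_Diff_UNIV)
  then have "7 \<le> card A + card B"
    using card_mono[OF _ AB(1)] card_Un_le[of A B] by (metis finite le_trans)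
  then have "4 \<le> card A \<or> 4 \<le> card B" by linarith
  then obtain F where F: "card F = 4" "triangle_free t F"
    using AB(2,3) by (meson obtain_subset_with_card_n triangle_free_mono)
  obtain vs where vs: "set vs = F" "distinct vs" "sorted_wrt t vs"
    using triangle_free_sorted[OF t(1) finite F(2)] by blast
  then have "length vs = 4" using F(1) distinct_card by fastforce
  then obtain a b c d where abcd: "vs = [a, b, c, d]"
    by (auto simp: numeral_eq_Suc length_Suc_conv)
  have "\<not> triangle_free t (- F)"
    using t(2) F(2) unfolding splittable_def by (metis Compl_partition subset_refl)
  then obtain x y z where xyz: "x \<notin> F" "y \<notin> F" "z \<notin> F" "t x y" "t y z" "t z x"
    unfolding triangle_free_def by auto
  have ne: "x \<noteq> y" "y \<noteq> z" "z \<noteq> x" using xyz t(1) unfolding oriented_def by metis+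
  have d7: "distinct [a, b, c, d, x, y, z]" using vs abcd xyz ne by auto
  have "\<not> UNIV \<subseteq> set [a, b, c, d, x, y, z]"
    using card_mono[of "set [a, b, c, d, x, y, z]" UNIV] distinct_card[OF d7] by (auto simp: card_vtx)
  then obtain w where "w \<notin> set [a, b, c, d, x, y, z]" by blast
  then have "distinct [a, b, c, d, x, y, z, w]" using d7 by auto
  then have "inj (\<lambda>v. get v (Oct a b c d x y z w))" by (rule inj_get)
  moreover have "t (get u (Oct a b c d x y z w)) (get v (Oct a b c d x y z w))"
    if "adj (matrix (pat S0)) u v" for u v
    using that vs(3) abcd xyz by (cases u; cases v) (auto simp: adj_def)
  ultimately show ?thesis unfolding occurs_def by blast
qed

lemma critical_iso_rep:
  assumes "critical t"
  shows "\<exists>i j f. bij f \<and> (\<forall>u v. adj (matrix (rep i j)) u v \<longleftrightarrow> t (f u) (f v))"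
proof -
  obtain i j f where f: "inj f" "\<And>u v. adj (matrix (rep i j)) u v \<Longrightarrow> t (f u) (f v)"
    using resolves_S0 critical_occurs_S0[OF assms] assms unfolding resolves_def occurs_def[of "rep _ _"] by blast
  have "adj (matrix (rep i j)) u v \<longleftrightarrow> t (f u) (f v)" for u v
  proof -
    have "oriented (adj (matrix (rep i j)))" "oriented t"
      using rep_critical assms unfolding critical_def by blast+
    then show ?thesis using f(2)[of u v] f(2)[of v u] unfolding oriented_def by metis
  qed
  then show ?thesis using f(1) finite_UNIV_inj_surj[OF finite f(1)] unfolding bij_def by blast
qed

section \<open>The representatives are pairwise non-isomorphic\<close>

primrec walks :: "('a :: finite \<Rightarrow> 'a \<Rightarrow> bool) \<Rightarrow> nat \<Rightarrow> 'a \<Rightarrow> nat" where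
  "walks t 0 v = 1"
| "walks t (Suc n) v = (\<Sum>u\<in>UNIV. if t v u then walks t n u else 0)"

text \<open>
  An isomorphism invariant; the length 4 and the exponent 3 are chosen because with them it takes 64
  different values on the representatives.
\<close>

definition walk_cubes :: "('a :: finite \<Rightarrow> 'a \<Rightarrow> bool) \<Rightarrow> nat" where
  "walk_cubes t = (\<Sum>v\<in>UNIV. walks t 4 v ^ 3)"

lemma walk_cubes_iso:
  assumes "bij f" "\<And>u v. s u v \<longleftrightarrow> t (f u) (f v)"
  shows "walk_cubes s = walk_cubes t"
proof -
  have walks: "walks s n v = walks t n (f v)" for n v
  proof (induction n arbitrary: v)
    case (Suc n)
    have "walks s (Suc n) v = (\<Sum>u\<in>UNIV. if t (f v) (f u) then walks t n (f u) else 0)"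
      unfolding walks.simps(2) Suc by (simp only: assms(2))
    also have "\<dots> = walks t (Suc n) (f v)"
      unfolding walks.simps(2) by (rule sum.reindex_bij_betw[OF assms(1)])
    finally show ?case .
  qed simp
  show ?thesis
    using sum.reindex_bij_betw[OF assms(1), of "\<lambda>v. walks t 4 v ^ 3"]
    by (simp add: walk_cubes_def walks)
qed

fun masked_sum :: "nat oct \<Rightarrow> bool oct \<Rightarrow> nat" where
  "masked_sum (Oct x0 x1 x2 x3 x4 x5 x6 x7) (Oct a b c d e f g h) =
     (if a then x0 else 0) + (if b then x1 else 0) + (if c then x2 else 0) + (if d then x3 else 0) +
     (if e then x4 else 0) + (if f then x5 else 0) + (if g then x6 else 0) + (if h then x7 else 0)"

fun step :: "bool oct oct \<Rightarrow> nat oct \<Rightarrow> nat oct" where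
  "step (Oct a b c d e f g h) w =
     Oct (masked_sum w a) (masked_sum w b) (masked_sum w c) (masked_sum w d)
         (masked_sum w e) (masked_sum w f) (masked_sum w g) (masked_sum w h)"

fun cubes :: "nat oct \<Rightarrow> nat" where
  "cubes (Oct a b c d e f g h) =
     a*a*a + b*b*b + c*c*c + d*d*d + e*e*e + f*f*f + g*g*g + h*h*h"

definition fingerprint :: "bool oct oct \<Rightarrow> nat" where
  "fingerprint M = cubes (step M (step M (step M (step M (Oct 1 1 1 1 1 1 1 1)))))"

lemma get_step: "get v (step M w) = (\<Sum>u\<in>UNIV. if adj M v u then get u w else 0)"
proof -
  have "masked_sum w r = (\<Sum>u\<in>UNIV. if get u r then get u w else 0)" for r
    by (cases r; cases w) (simp add: UNIV_vtx)
  moreover have "get v (step M w) = masked_sum w (get v M)"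
    by (cases M; cases v) simp_all
  ultimately show ?thesis unfolding adj_def by simp
qed

lemma walk_cubes_adj: "walk_cubes (adj M) = fingerprint M"
proof -
  define one where "one = Oct (1 :: nat) 1 1 1 1 1 1 1"
  have "walks (adj M) 0 v = get v one" for v
    unfolding one_def by (cases v) simp_all
  then have "walks (adj M) 4 v = get v (step M (step M (step M (step M one))))" for v
    by (simp only: numeral_eq_Suc pred_numeral_simps BitM.simps walks.simps(2) get_step cong: if_cong)
  moreover have "(\<Sum>v\<in>UNIV. get v w ^ 3) = cubes w" for w
    by (cases w) (simp add: UNIV_vtx power3_eq_cube)
  ultimately show ?thesis unfolding walk_cubes_def fingerprint_def one_def by simp
qed

text \<open>
  The values of the invariant, computed once for each representative so that comparing them is a
  matter of numerals only.
\<close>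

definition fingerprints :: "nat oct oct" where
  "fingerprints = Oct
      (Oct 13713956 13725188 15898744 16007320 16060966 16088406 16142278 16206078)
      (Oct 18310370 18329942 18341782 18344374 18354832 18381654 18382480 18385704)
      (Oct 18386764 18397132 18432968 18437198 18449234 18450356 18471104 18471250)
      (Oct 18481802 18487674 18498944 18509666 18518122 18520122 18521718 18530898)
      (Oct 18535030 18555994 18566830 18568144 18583102 18596254 20921464 20965002)
      (Oct 20981922 21028436 21033476 21063608 21069802 21079458 21090588 21108816)
      (Oct 21120580 21128724 21158718 21178206 21192608 21196748 21226330 21236130)
      (Oct 21236816 21243012 21248712 21262680 23935484 23936276 23937002 23937830)"

lemma fingerprint_rep: "fingerprint (matrix (rep i j)) = get j (get i fingerprints)"
  by (cases i; cases j) (simp_all only: matrix_simps fingerprint_def fingerprints_def get.simps step.simps masked_sum.simps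
       cubes.simps if_True if_False add_0 add_0_right mult_1 mult_1_right mult_zero_left
       one_add_one one_plus_numeral numeral_plus_one numeral_plus_numeral numeral_times_numeral
       add_num_simps mult_num_simps cong: if_weak_cong)

lemma distinct_fingerprints:
  "distinct (map (\<lambda>(i, j). get j (get i fingerprints)) (List.product vertices vertices))"
  by (simp add: fingerprints_def vertices_def)

lemma rep_iso_unique:
  assumes "bij f" "\<And>u v. adj (matrix (rep i j)) u v \<longleftrightarrow> adj (matrix (rep k l)) (f u) (f v)"
  shows "i = k \<and> j = l"
proof -
  have "inj (\<lambda>(i, j). fingerprint (matrix (rep i j)))"
    using distinct_fingerprints set_vertices by (simp add: distinct_map fingerprint_rep)
  moreover have "fingerprint (matrix (rep i j)) = fingerprint (matrix (rep k l))"
    using walk_cubes_iso[of f "adj (matrix (rep i j))" "adj (matrix (rep k l))"] assms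
    by (simp only: walk_cubes_adj)
  ultimately show ?thesis by (auto dest: injD[where x = "(i, j)" and y = "(k, l)"])
qed

section \<open>Digraphs and relations on the labelled vertices\<close>

definition represents :: "(vtx \<Rightarrow> 'a) \<Rightarrow> (vtx \<Rightarrow> vtx \<Rightarrow> bool) \<Rightarrow> ('a, 'b) pre_digraph \<Rightarrow> bool" where
  "represents g t T \<longleftrightarrow> bij_betw g UNIV (verts T) \<and> (\<forall>u v. t u v \<longleftrightarrow> g u \<rightarrow>\<^bsub>T\<^esub> g v)"

lemma representsD:
  assumes "represents g t T"
  shows "inj g" "range g = verts T" "t u v \<longleftrightarrow> g u \<rightarrow>\<^bsub>T\<^esub> g v"
  using assms unfolding represents_def bij_betw_def by auto

lemma arcs_imp_dominates: "e \<in> arcs G \<Longrightarrow> tail G e \<rightarrow>\<^bsub>G\<^esub> head G e"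
  by (auto simp: arcs_ends_conv)

lemma ex_represents:
  assumes "card (verts T) = 8"
  shows "\<exists>g. represents g (\<lambda>u v. g u \<rightarrow>\<^bsub>T\<^esub> g v) T"
proof -
  have "finite (verts T)" using assms card.infinite by fastforce
  then obtain g :: "vtx \<Rightarrow> 'a" where "bij_betw g UNIV (verts T)"
    using finite_same_card_bij[OF finite_UNIV, of "verts T"] assms card_vtx by metis
  then show ?thesis unfolding represents_def by blast
qed

lemma minimal_iff_critical:
  assumes "tournament T" "represents g t T"
  shows "minimal_3_dichromatic_8 T \<longleftrightarrow> critical t"
proof -
  interpret T: tournament T by fact
  note g = representsD[OF assms(2)]
  have card: "card (verts T) = 8"
    using card_image[OF g(1)] g(2) by (simp add: card_vtx)
  have orient: "oriented t"
    unfolding oriented_def g(3)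
    using T.dominates_asym T.dominates_total T.adj_not_same g(1,2) by (metis injD rangeI)
  have split: "dichromatic_number T \<le> 2 \<longleftrightarrow> splittable t UNIV"
    unfolding T.dichromatic_number_le_2_iff
  proof
    assume "splittable (dominates T) (verts T)"
    then show "splittable t UNIV"
      by (rule splittable_image[where f = g]) (use g in auto)
  next
    assume "splittable t UNIV"
    then show "splittable (dominates T) (verts T)"
      by (rule splittable_image[where f = "inv g"]) (simp_all add: g(3) g(2)[symmetric] f_inv_into_f)
  qed
  have minus: "verts T - {g v} = g ` (- {v})" for v
    using g(1,2) by (auto dest: injD)
  show ?thesis
  proof
    assume min: "minimal_3_dichromatic_8 T"
    \<comment> \<open>the induced subgraph has dichromatic number at most 3 by monotonicity, hence at most 2\<close>
    have "splittable t (- {v})" for v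
    proof -
      let ?H = "T \<restriction> (verts T - {g v})"
      note H = T.tournament_induce_subgraph[OF Diff_subset[of "verts T" "{g v}"]]
      interpret H: tournament ?H by (rule H(1))
      have "card (verts ?H) = 7"
        using card g(2) by (simp add: card_Diff_singleton_if) blast
      then have "dichromatic_number ?H \<noteq> 3"
        using min H(1,2) unfolding minimal_3_dichromatic_8_def by blast
      moreover have "dichromatic_number ?H \<le> 3"
        using T.dichromatic_number_subgraph[OF H(2,1)] min
        unfolding minimal_3_dichromatic_8_def by simp
      ultimately have "splittable (dominates ?H) (verts ?H)"
        using H.dichromatic_number_le_2_iff by simp
      then show ?thesis
        by (rule splittable_image[where f = g]) (use g H(3) minus in auto)
    qed
    moreover have "\<not> splittable t UNIV"
      using min split unfolding minimal_3_dichromatic_8_def by simp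
    ultimately show "critical t" unfolding critical_def using orient by blast
  next
    assume crit: "critical t"
    then obtain A B where AB: "- {V0} \<subseteq> A \<union> B" "triangle_free t A" "triangle_free t B"
      unfolding critical_def splittable_def by blast
    \<comment> \<open>a third color for the deleted vertex turns the splitting into a coloring\<close>
    define c where "c = (\<lambda>x. if inv g x \<in> A then 1 else if inv g x \<in> B then 2 else 3 :: nat)"
    have c: "c (g v) = (if v \<in> A then 1 else if v \<in> B then 2 else 3)" for v
      unfolding c_def by (simp add: inv_f_f[OF g(1)])
    have "triangle_free (dominates T) {x \<in> verts T. c x = i}" for i
      unfolding triangle_free_def
    proof (intro ballI notI)
      fix x y z
      assume "x \<in> {x \<in> verts T. c x = i}" "y \<in> {x \<in> verts T. c x = i}" "z \<in> {x \<in> verts T. c x = i}"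
      then obtain p q r where pqr: "x = g p" "y = g q" "z = g r" and
        i: "c (g p) = i" "c (g q) = i" "c (g r) = i"
        unfolding g(2)[symmetric] by auto
      assume "x \<rightarrow>\<^bsub>T\<^esub> y \<and> y \<rightarrow>\<^bsub>T\<^esub> z \<and> z \<rightarrow>\<^bsub>T\<^esub> x"
      then have t: "t p q" "t q r" "t r p" using pqr g(3) by auto
      have part: "v \<in> (if i = 1 then A else if i = 2 then B else - (A \<union> B))" if "c (g v) = i" for v
        using that c[of v] by (auto split: if_splits)
      consider "{p, q, r} \<subseteq> A" | "{p, q, r} \<subseteq> B" | "{p, q, r} \<inter> (A \<union> B) = {}"
        using i[THEN part] by (cases "i = 1"; cases "i = 2") auto
      then show False
      proof cases
        case 3
        then have "p = V0" "q = V0" using AB(1) by auto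
        then show False using t(1) orient unfolding oriented_def by blast
      qed (use t AB(2,3) in \<open>auto simp: triangle_free_def\<close>)
    qed
    moreover have "c ` verts T \<subseteq> {1..3}" unfolding c_def by auto
    ultimately have "dichromatic_number T \<le> 3"
      unfolding T.dichromatic_number_le_iff T.acyclic_coloring_iff by blast
    moreover have "\<not> dichromatic_number T \<le> 2"
      using crit split unfolding critical_def by blast
    ultimately have "dichromatic_number T = 3" by simp
    moreover have "dichromatic_number H \<noteq> 3"
      if H: "subgraph H T" "tournament H" "card (verts H) = 7" for H
    proof -
      interpret H: tournament H by fact
      have sub: "verts H \<subseteq> verts T" using H(1) by (rule subgraphE)
      moreover have "verts H \<noteq> verts T" using H(3) card by auto
      ultimately obtain x where "x \<in> verts T" "x \<notin> verts H" by blast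
      then obtain v where v: "g v \<notin> verts H" using g(2) by (metis imageE)
      have inv: "g (inv g x) = x" if "x \<in> verts H" for x
        using that sub g(2) by (metis f_inv_into_f subsetD)
      have "splittable t (- {v})" using crit unfolding critical_def by blast
      then have "splittable (dominates H) (verts H)"
      proof (rule splittable_image[where f = "inv g"])
        show "inv g x \<in> - {v}" if "x \<in> verts H" for x
          using v inv[OF that] that by auto
        show "t (inv g x) (inv g y)" if "x \<in> verts H" "y \<in> verts H" "x \<rightarrow>\<^bsub>H\<^esub> y" for x y
          unfolding g(3) inv[OF that(1)] inv[OF that(2)]
          using that(3) arcs_ends_mono[OF H(1)] by blast
      qed
      then show ?thesis using H.dichromatic_number_le_2_iff by simp
    qed
    ultimately show "minimal_3_dichromatic_8 T"
      unfolding minimal_3_dichromatic_8_def using assms(1) card by blast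
  qed
qed

lemma represents_iso:
  assumes "tournament T" "tournament T'" "represents g t T" "represents g' t' T'"
    and f: "bij f" "\<And>u v. t u v \<longleftrightarrow> t' (f u) (f v)"
  shows "digraph_iso T T'"
proof -
  interpret T: tournament T by fact
  interpret T': tournament T' by fact
  note g = representsD[OF assms(3)] and g' = representsD[OF assms(4)]
  define h where "h = g' \<circ> f \<circ> inv g"
  have h_g: "h (g v) = g' (f v)" for v unfolding h_def using g(1) by simp
  have bij_h: "bij_betw h (verts T) (verts T')"
    unfolding h_def
  proof (rule bij_betw_trans)
    show "bij_betw (inv g) (verts T) UNIV"
      using assms(3) unfolding represents_def by (blast intro: bij_betw_inv_into)
    show "bij_betw (g' \<circ> f) UNIV (verts T')"
      using f(1) assms(4) unfolding represents_def by (blast intro: bij_betw_trans)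
  qed
  have dom: "x \<rightarrow>\<^bsub>T\<^esub> y \<longleftrightarrow> h x \<rightarrow>\<^bsub>T'\<^esub> h y" if xy: "x \<in> verts T" "y \<in> verts T" for x y
  proof -
    obtain u v where "x = g u" "y = g v" using xy g(2) by (metis imageE)
    then show ?thesis using h_g f(2) g(3) g'(3) by simp
  qed
  have "\<exists>e'. e' \<in> arcs T' \<and> tail T' e' = h (tail T e) \<and> head T' e' = h (head T e)"
    if "e \<in> arcs T" for e
  proof -
    have "tail T e \<rightarrow>\<^bsub>T\<^esub> head T e" using that by (rule arcs_imp_dominates)
    then have "h (tail T e) \<rightarrow>\<^bsub>T'\<^esub> h (head T e)" using dom that by simp
    then show ?thesis by (meson reachableE)
  qed
  then obtain k where k: "\<And>e. e \<in> arcs T \<Longrightarrow>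
    k e \<in> arcs T' \<and> tail T' (k e) = h (tail T e) \<and> head T' (k e) = h (head T e)"
    by metis
  have inj_h: "h x = h y \<longleftrightarrow> x = y" if "x \<in> verts T" "y \<in> verts T" for x y
    using bij_h that by (auto simp: bij_betw_def inj_on_def)
  have inj_k: "inj_on k (arcs T)"
  proof (rule inj_onI)
    fix d e assume de: "d \<in> arcs T" "e \<in> arcs T" "k d = k e"
    then have "arc_to_ends T d = arc_to_ends T e"
      unfolding arc_to_ends_def using k inj_h by (metis T.wellformed)
    then show "d = e" using T.no_multi_arcs de by blast
  qed
  have "k ` arcs T = arcs T'"
  proof
    show "arcs T' \<subseteq> k ` arcs T"
    proof
      fix e' assume e': "e' \<in> arcs T'"
      then obtain x y where xy: "x \<in> verts T" "y \<in> verts T" "h x = tail T' e'" "h y = head T' e'"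
        using bij_h unfolding bij_betw_def by (metis T'.wellformed imageE)
      then have "h x \<rightarrow>\<^bsub>T'\<^esub> h y" using e' by (simp add: arcs_imp_dominates)
      then have "x \<rightarrow>\<^bsub>T\<^esub> y" using dom xy by blast
      then obtain e where e: "e \<in> arcs T" "tail T e = x" "head T e = y" by (meson reachableE)
      then have "arc_to_ends T' (k e) = arc_to_ends T' e'"
        unfolding arc_to_ends_def using k xy by simp
      then show "e' \<in> k ` arcs T" using T'.no_multi_arcs[of "k e" e'] k e e' by blast
    qed
  qed (use k in auto)
  then have "T' = app_iso \<lparr>iso_verts = h, iso_arcs = k, iso_head = head T', iso_tail = tail T'\<rparr> T"
    using bij_h unfolding app_iso_def bij_betw_def by simp
  moreover have "pre_digraph.digraph_isomorphism T
      \<lparr>iso_verts = h, iso_arcs = k, iso_head = head T', iso_tail = tail T'\<rparr>"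
    unfolding pre_digraph.digraph_isomorphism_def
    using bij_h inj_k k T.wf_digraph by (auto simp: bij_betw_def)
  ultimately show ?thesis unfolding digraph_iso_def by blast
qed

text \<open>
  An isomorphism maps arcs to arcs; that non-arcs go to non-arcs follows from orientedness of both
  sides.
\<close>

lemma iso_represents:
  assumes "tournament T" "digraph_iso T T'" "represents g t T" "represents g' t' T'"
    and "oriented t" "oriented t'"
  shows "\<exists>f. bij f \<and> (\<forall>u v. t u v \<longleftrightarrow> t' (f u) (f v))"
proof -
  interpret T: tournament T by fact
  note g = representsD[OF assms(3)] and g' = representsD[OF assms(4)]
  obtain m where m: "T.digraph_isomorphism m" "T' = app_iso m T"
    using assms(2) unfolding digraph_iso_def by blast
  define f where "f = inv g' \<circ> iso_verts m \<circ> g"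
  have img: "verts T' = iso_verts m ` verts T" using m(2) by simp
  have g'_f: "g' (f u) = iso_verts m (g u)" for u
    unfolding f_def using img g(2) g'(2) by (simp add: f_inv_into_f[where f = g'] rangeI) (metis f_inv_into_f imageI rangeI)
  have "inj f"
  proof (rule injI)
    fix u v assume "f u = f v"
    then have "iso_verts m (g u) = iso_verts m (g v)" using g'_f by metis
    then show "u = v" using T.digraph_isomorphism_inj_on_verts[OF m(1)] g(1,2)
      by (metis injD inj_onD rangeI)
  qed
  moreover have fwd: "t' (f u) (f v)" if arc: "t u v" for u v
  proof -
    obtain e where e: "e \<in> arcs T" "tail T e = g u" "head T e = g v"
      using arc unfolding g(3) by (meson reachableE)
    then have "iso_arcs m e \<in> arcs T'" "tail T' (iso_arcs m e) = g' (f u)"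
      "head T' (iso_arcs m e) = g' (f v)"
      using m g'_f unfolding T.digraph_isomorphism_def by auto
    then show ?thesis unfolding g'(3) by (metis arcs_imp_dominates)
  qed
  have "t u v \<longleftrightarrow> t' (f u) (f v)" for u v
    using fwd[of u v] fwd[of v u] assms(5,6) \<open>inj f\<close> unfolding oriented_def by (metis injD)
  ultimately show ?thesis using finite_UNIV_inj_surj[OF finite \<open>inj f\<close>] unfolding bij_def by blast
qed

text \<open>
  The representatives as digraphs, whose arcs are the pairs of numbers that they join.
\<close>

definition label :: "vtx \<Rightarrow> nat" where
  "label v = get v (Oct 0 1 2 3 4 5 6 7)"

definition digraph_of :: "(vtx \<Rightarrow> vtx \<Rightarrow> bool) \<Rightarrow> (nat, nat \<times> nat) pre_digraph" where
  "digraph_of t = \<lparr>verts = range label, arcs = {(label u, label v) | u v. t u v},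
     tail = fst, head = snd\<rparr>"

lemma inj_label: "inj label"
  unfolding label_def by (rule inj_get) simp

lemma represents_digraph_of: "represents label t (digraph_of t)"
  unfolding represents_def bij_betw_def digraph_of_def arcs_ends_conv
  using inj_label by (auto dest: injD simp: image_iff)

lemma tournament_digraph_of:
  assumes "oriented t"
  shows "tournament (digraph_of t)"
proof -
  note r = representsD[OF represents_digraph_of[of t]]
  have o: "t u v \<longleftrightarrow> u \<noteq> v \<and> \<not> t v u" for u v using assms unfolding oriented_def by blast
  have "arcs (digraph_of t) \<subseteq> range label \<times> range label"
    unfolding digraph_of_def by auto
  then have "finite (arcs (digraph_of t))"
    by (rule finite_subset) (simp add: finite_cartesian_product)
  then show ?thesis
  proof unfold_locales
    fix x y assume "x \<in> verts (digraph_of t)" "y \<in> verts (digraph_of t)" "x \<noteq> y"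
    then obtain u v where "x = label u" "y = label v" "u \<noteq> v" using r(2) by (metis imageE)
    then show "x \<rightarrow>\<^bsub>digraph_of t\<^esub> y \<and> \<not> y \<rightarrow>\<^bsub>digraph_of t\<^esub> x \<or> y \<rightarrow>\<^bsub>digraph_of t\<^esub> x \<and> \<not> x \<rightarrow>\<^bsub>digraph_of t\<^esub> y"
      using r(3) o by metis
  next
    fix e assume "e \<in> arcs (digraph_of t)"
    then obtain u v where "e = (label u, label v)" "t u v" unfolding digraph_of_def by auto
    moreover from this have "u \<noteq> v" using o[of u v] by blast
    ultimately show "tail (digraph_of t) e \<noteq> head (digraph_of t) e"
      using inj_label by (simp add: digraph_of_def inj_eq)
  qed (auto simp: digraph_of_def arc_to_ends_def)
qed

section \<open>The classification\<close>

theorem mainTheorem3: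
  shows "\<exists>S :: (nat, nat \<times> nat) pre_digraph set.
    card S = 64 \<and>
    (\<forall>T \<in> S. minimal_3_dichromatic_8 T) \<and>
    (\<forall>T \<in> S. \<forall>T' \<in> S. digraph_iso T T' \<longrightarrow> T = T') \<and>
    (\<forall>T :: ('a, 'b) pre_digraph. minimal_3_dichromatic_8 T \<longrightarrow> (\<exists>T' \<in> S. digraph_iso T T'))"
proof -
  define D where "D = (\<lambda>(i, j). digraph_of (adj (matrix (rep i j))))"
  have orient: "oriented (adj (matrix (rep i j)))" for i j
    using rep_critical unfolding critical_def by blast
  have tour: "tournament (D (i, j))" and repr: "represents label (adj (matrix (rep i j))) (D (i, j))" for i j
    unfolding D_def using tournament_digraph_of[OF orient] represents_digraph_of by auto
  have unique: "p = q" if iso: "digraph_iso (D p) (D q)" for p q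
  proof -
    obtain i j k l where pq: "p = (i, j)" "q = (k, l)" by (cases p; cases q) blast
    then obtain f where "bij f"
      "\<And>u v. adj (matrix (rep i j)) u v \<longleftrightarrow> adj (matrix (rep k l)) (f u) (f v)"
      using iso_represents[OF tour _ repr repr orient orient] iso by blast
    then show ?thesis using rep_iso_unique pq by blast
  qed
  have "digraph_iso (D p) (D p)" for p
    using represents_iso[OF tour tour repr repr bij_id] by (cases p) simp
  then have "inj D" using unique by (metis injI)
  then have "card (range D) = 64"
    by (simp add: card_image card_cartesian_product card_vtx flip: UNIV_Times_UNIV)
  moreover have "\<forall>T\<in>range D. minimal_3_dichromatic_8 T"
    using minimal_iff_critical[OF tour repr] rep_critical by (metis imageE surj_pair)
  moreover have "\<forall>T\<in>range D. \<forall>T'\<in>range D. digraph_iso T T' \<longrightarrow> T = T'"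
    using unique by blast
  moreover have "\<exists>T'\<in>range D. digraph_iso T T'" if T: "minimal_3_dichromatic_8 T" for T :: "('a, 'b) pre_digraph"
  proof -
    have "tournament T" "card (verts T) = 8" using T unfolding minimal_3_dichromatic_8_def by blast+
    then obtain g where g: "represents g (\<lambda>u v. g u \<rightarrow>\<^bsub>T\<^esub> g v) T" using ex_represents by blast
    then have "critical (\<lambda>u v. g u \<rightarrow>\<^bsub>T\<^esub> g v)"
      using minimal_iff_critical[OF \<open>tournament T\<close>] T by blast
    then obtain i j f where f: "bij f"
      "\<And>u v. adj (matrix (rep i j)) u v \<longleftrightarrow> g (f u) \<rightarrow>\<^bsub>T\<^esub> g (f v)"
      using critical_iso_rep by blast
    have "bij (inv f)" using f(1) by (rule bij_imp_bij_inv)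
    moreover have "g u \<rightarrow>\<^bsub>T\<^esub> g v \<longleftrightarrow> adj (matrix (rep i j)) (inv f u) (inv f v)" for u v
      using f surj_f_inv_f[OF bij_is_surj[OF f(1)]] by simp
    ultimately have "digraph_iso T (D (i, j))"
      using represents_iso[OF \<open>tournament T\<close> tour g repr] by blast
    then show ?thesis by blast
  qed
  ultimately show ?thesis by blast
qed

end
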